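(* Suppose that (i) $\Lambda$ is a Meyer set in $\mathbb{R}^n$; (ii) $\mu$ is a translation-bounded measure supported by $\Lambda$; (iii) $\gamma_\mu$ is an autocorrelation measure of $\mu$; and (iv) the diffraction measure $\hat\gamma_\mu$ is purely atomic and its support $S$ (the set of its non-zero atoms) is a discrete closed set. Then there is a lattice $L\subset\mathbb{R}^n$ such that $S$ is contained in a finite union of translates of $L$, and the diffraction measure has the form $$\hat\gamma_\mu=\sum_{j=1}^{N}\ \sum_{\lambda\in L+\tau_j}P_j(\lambda)\,\delta_\lambda$$ for some positive integer $N$, vectors $\tau_1,\dots,\tau_N\in\mathbb{R}^n$ and trigonometric polynomials $P_1,\dots,P_N$ on $\mathbb{R}^n$.
   Context: A set $A\subset\mathbb{R}^n$ is uniformly discrete if $\inf\{|x-y|:x,y\in A,\ x\neq y\}>0$; relatively dense if there is $R>0$ such that every ball of radius $R$ meets $A$; a Delone set if it is both; a discrete closed set if it has finitely many points in every bounded set. A Meyer set is a Delone set $\Lambda$ for which there is a finite set $F$ with $\Lambda-\Lambda\subset\Lambda+F$; equivalently (Lagarias), a Delone set such that $\Lambda-\Lambda$ is uniformly discrete. A complex, locally finite measure $\mu$ on $\mathbb{R}^n$ is translation-bounded if $\sup_{x}|\mu|(x+B_1)<\infty$, where $B_1$ is the open unit ball; it is supported by $\Lambda$ if $|\mu|(\mathbb{R}^n\setminus\Lambda)=0$. For such $\mu$, let $\mu_R$ be the restriction of $\mu$ to $[-R,R]^n$ and $\tilde\mu_R(E):=\overline{\mu_R(-E)}$. An autocorrelation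 measure $\gamma_\mu$ of $\mu$ is any weak limit point (tested against continuous compactly supported functions), as $R\to\infty$, of the measures $(2R)^{-n}\,\mu_R*\tilde\mu_R$. It is translation-bounded and positive-definite, so its Fourier transform $\hat\gamma_\mu$ (as a temperate distribution, with $\hat\varphi(t)=\int\varphi(x)e^{-2\pi i\langle t,x\rangle}dx$ and $\langle\hat\gamma_\mu,\varphi\rangle=\langle\gamma_\mu,\hat\varphi\rangle$) is a positive measure, called a diffraction measure of $\mu$. A lattice is the image of $\mathbb{Z}^n$ under an invertible linear map of $\mathbb{R}^n$. A trigonometric polynomial is a finite sum $\sum_k c_k e^{2\pi i\langle\omega_k,x\rangle}$ with $c_k\in\mathbb{C}$, $\omega_k\in\mathbb{R}^n$. *)

theory Defs
  imports "HOL-Analysis.Analysis"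
begin

section \<open>Point sets\<close>

definition relatively_dense :: "'a::metric_space set \<Rightarrow> bool" where
  "relatively_dense A \<longleftrightarrow> (\<exists>R>0. \<forall>x. ball x R \<inter> A \<noteq> {})"

definition Delone_set :: "'a::metric_space set \<Rightarrow> bool" where
  "Delone_set A \<longleftrightarrow> uniform_discrete A \<and> relatively_dense A"

definition discrete_closed_set :: "'a::metric_space set \<Rightarrow> bool" where
  "discrete_closed_set A \<longleftrightarrow> (\<forall>B. bounded B \<longrightarrow> finite (A \<inter> B))"

definition Meyer_set :: "'a::real_normed_vector set \<Rightarrow> bool" where
  "Meyer_set \<Lambda> \<longleftrightarrow> Delone_set \<Lambda> \<and>
     (\<exists>F. finite F \<and> {x - y |x y. x \<in> \<Lambda> \<and> y \<in> \<Lambda>} \<subseteq> {x + f |x f. x \<in> \<Lambda> \<and> f \<in> F})"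

definition lattice_set :: "(real^'n) set \<Rightarrow> bool" where
  "lattice_set L \<longleftrightarrow> (\<exists>T::real^'n \<Rightarrow> real^'n. linear T \<and> bij T \<and> L = T ` {z. \<forall>i. z $ i \<in> \<int>})"

definition translate :: "'a::ab_group_add set \<Rightarrow> 'a \<Rightarrow> 'a set" where
  "translate L \<tau> = (\<lambda>x. x + \<tau>) ` L"


section \<open>Complex, locally finite measures\<close>

text \<open>A complex, locally finite measure need not assign a value to unbounded sets, so it is a
  function on sets that is countably additive on the bounded Borel sets. Only its values on these
  sets are meaningful.\<close>

definition bounded_borel :: "'a::{metric_space} set set" where
  "bounded_borel = {B. B \<in> sets borel \<and> bounded B}"

definition cmeasure :: "('a::metric_space set \<Rightarrow> complex) \<Rightarrow> bool" where
  "cmeasure \<mu> \<longleftrightarrow>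
     (\<forall>A::nat \<Rightarrow> 'a set. range A \<subseteq> bounded_borel \<and> disjoint_family A \<and> bounded (\<Union>i. A i) \<longrightarrow>
        (\<lambda>i. \<mu> (A i)) sums \<mu> (\<Union>i. A i))"

definition total_variation :: "('a::metric_space set \<Rightarrow> complex) \<Rightarrow> 'a set \<Rightarrow> ennreal" where
  "total_variation \<mu> E =
     (SUP \<A> \<in> {\<A>. finite \<A> \<and> disjoint \<A> \<and> \<A> \<subseteq> bounded_borel \<and> \<Union>\<A> \<subseteq> E}.
        \<Sum>A\<in>\<A>. ennreal (cmod (\<mu> A)))"

definition translation_bounded :: "('a::metric_space set \<Rightarrow> complex) \<Rightarrow> bool" where
  "translation_bounded \<mu> \<longleftrightarrow> (SUP x. total_variation \<mu> (ball x 1)) < \<infinity>"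

definition supported_by :: "('a::metric_space set \<Rightarrow> complex) \<Rightarrow> 'a set \<Rightarrow> bool" where
  "supported_by \<mu> \<Lambda> \<longleftrightarrow> total_variation \<mu> (UNIV - \<Lambda>) = 0"

text \<open>The positive part in the Jordan decomposition of a real, locally finite measure; the
  negative part of \<open>\<nu>\<close> is the positive part of \<open>- \<nu>\<close>. (Note that \<^const>\<open>ennreal\<close> sends negative
  numbers to 0.)\<close>

definition pos_variation :: "('a::metric_space set \<Rightarrow> real) \<Rightarrow> 'a measure" where
  "pos_variation \<nu> =
     measure_of UNIV (sets borel) (\<lambda>E. SUP B \<in> {B \<in> bounded_borel. B \<subseteq> E}. ennreal (\<nu> B))"

definition cm_integral :: "('a::metric_space set \<Rightarrow> complex) \<Rightarrow> ('a \<Rightarrow> complex) \<Rightarrow> complex" where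
  "cm_integral \<mu> f =
     (integral\<^sup>L (pos_variation (\<lambda>B. Re (\<mu> B))) f
        - integral\<^sup>L (pos_variation (\<lambda>B. - Re (\<mu> B))) f)
     + \<i> * (integral\<^sup>L (pos_variation (\<lambda>B. Im (\<mu> B))) f
        - integral\<^sup>L (pos_variation (\<lambda>B. - Im (\<mu> B))) f)"


section \<open>Autocorrelation\<close>

definition cube_restrict :: "((real^'n) set \<Rightarrow> complex) \<Rightarrow> real \<Rightarrow> (real^'n) set \<Rightarrow> complex" where
  "cube_restrict \<mu> R E = \<mu> (E \<inter> {x. \<forall>i. \<bar>x $ i\<bar> \<le> R})"

definition tilde :: "((real^'n) set \<Rightarrow> complex) \<Rightarrow> (real^'n) set \<Rightarrow> complex" where
  "tilde \<mu> E = cnj (\<mu> (uminus ` E))"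

definition convolution ::
  "((real^'n) set \<Rightarrow> complex) \<Rightarrow> ((real^'n) set \<Rightarrow> complex) \<Rightarrow> (real^'n) set \<Rightarrow> complex" where
  "convolution \<mu> \<nu> E = cm_integral \<nu> (\<lambda>y. \<mu> {x. x + y \<in> E})"

definition approx_autocorrelation ::
  "((real^'n) set \<Rightarrow> complex) \<Rightarrow> real \<Rightarrow> (real^'n) set \<Rightarrow> complex" where
  "approx_autocorrelation \<mu> R E =
     convolution (cube_restrict \<mu> R) (tilde (cube_restrict \<mu> R)) E
       / complex_of_real ((2 * R) ^ CARD('n))"

definition test_functions :: "(real^'n \<Rightarrow> complex) set" where
  "test_functions = {f. continuous_on UNIV f \<and> (\<exists>K. compact K \<and> (\<forall>x. x \<notin> K \<longrightarrow> f x = 0))}"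

text \<open>The finite sets \<open>F\<close> of test functions and the numbers \<open>\<epsilon>\<close> index a basis of weak
  neighbourhoods of \<open>\<gamma>\<close>; a limit point is one each of whose neighbourhoods is visited for
  arbitrarily large \<open>R\<close>.\<close>

definition autocorrelation_measure ::
  "((real^'n) set \<Rightarrow> complex) \<Rightarrow> ((real^'n) set \<Rightarrow> complex) \<Rightarrow> bool" where
  "autocorrelation_measure \<mu> \<gamma> \<longleftrightarrow> cmeasure \<gamma> \<and>
     (\<forall>F \<epsilon>. finite F \<and> F \<subseteq> test_functions \<and> \<epsilon> > 0 \<longrightarrow>
        (\<exists>\<^sub>F R in at_top. \<forall>f\<in>F.
           dist (cm_integral (approx_autocorrelation \<mu> R) f) (cm_integral \<gamma> f) < \<epsilon>))"


section \<open>Diffraction\<close>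

definition partial_deriv :: "'n \<Rightarrow> (real^'n \<Rightarrow> complex) \<Rightarrow> real^'n \<Rightarrow> complex" where
  "partial_deriv i f x = vector_derivative (\<lambda>t. f (x + t *\<^sub>R axis i 1)) (at 0)"

text \<open>A multi-index is given as the list \<open>is\<close> of the directions of differentiation.
  Differentiability of all iterated partial derivatives amounts to smoothness.\<close>

definition schwartz :: "(real^'n \<Rightarrow> complex) \<Rightarrow> bool" where
  "schwartz \<phi> \<longleftrightarrow>
     (\<forall>is. (\<forall>x. foldr partial_deriv is \<phi> differentiable (at x)) \<and>
           (\<forall>k::nat. bounded (range (\<lambda>x. (1 + norm x) ^ k *\<^sub>R foldr partial_deriv is \<phi> x))))"

definition fourier :: "(real^'n \<Rightarrow> complex) \<Rightarrow> real^'n \<Rightarrow> complex" where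
  "fourier \<phi> t = (LINT x|lborel. \<phi> x * exp (- 2 * pi * \<i> * complex_of_real (t \<bullet> x)))"

text \<open>\<open>\<nu>\<close> is a positive measure that represents the temperate distribution \<open>\<gamma>\<close>-hat. The
  temperate distribution \<open>\<gamma>\<close>-hat determines \<open>\<nu>\<close>.\<close>

definition diffraction_measure :: "((real^'n) set \<Rightarrow> complex) \<Rightarrow> (real^'n) measure \<Rightarrow> bool" where
  "diffraction_measure \<gamma> \<nu> \<longleftrightarrow> sets \<nu> = sets borel \<and> (\<forall>B\<in>bounded_borel. emeasure \<nu> B < \<infinity>) \<and>
     (\<forall>\<phi>. schwartz \<phi> \<longrightarrow> integrable \<nu> \<phi> \<and> integral\<^sup>L \<nu> \<phi> = cm_integral \<gamma> (fourier \<phi>))"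

definition atoms :: "'a measure \<Rightarrow> 'a set" where
  "atoms \<nu> = {x. emeasure \<nu> {x} \<noteq> 0}"

definition purely_atomic :: "'a measure \<Rightarrow> bool" where
  "purely_atomic \<nu> \<longleftrightarrow> (\<forall>E\<in>sets \<nu>. emeasure \<nu> E = (\<integral>\<^sup>+x. emeasure \<nu> {x} \<partial>count_space E))"

definition trig_polynomial :: "(real^'n \<Rightarrow> complex) \<Rightarrow> bool" where
  "trig_polynomial P \<longleftrightarrow> (\<exists>\<Omega> c. finite \<Omega> \<and>
     P = (\<lambda>x. \<Sum>\<omega>\<in>\<Omega>. c \<omega> * exp (2 * pi * \<i> * complex_of_real (\<omega> \<bullet> x))))"

text \<open>The measure \<open>\<Sum>\<^bsub>x\<in>A\<^esub> w(x) \<delta>\<^bsub>x\<^esub>\<close> for a discrete closed set \<open>A\<close>; on a bounded set the sum is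
  finite.\<close>

definition weighted_comb :: "'a set \<Rightarrow> ('a \<Rightarrow> complex) \<Rightarrow> 'a set \<Rightarrow> complex" where
  "weighted_comb A w E = (\<Sum>x \<in> A \<inter> E. w x)"

end

theory Submission
  imports "HOL-Probability.Characteristic_Functions" Defs
begin

text \<open>Write \<open>D = \<Lambda> - \<Lambda>\<close>. The autocorrelation \<open>\<gamma>\<close> is carried by \<open>D\<close> with bounded masses, so, testing with
  Gaussians, \<open>N(x) = \<nu>{x}\<close> is a limit of exponential sums \<open>\<Sum> \<omega>\<^sub>i(d) e(- d \<bullet> x)\<close> over \<open>d \<in> D\<close> of bounded total
  mass. As \<open>\<Lambda>\<close> is a Meyer set, the coordinates of \<open>d \<in> D\<close> in an integer basis \<open>g\<^sub>j\<close> have the form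
  \<open>a\<^sub>j \<bullet> d + b\<^sub>j(d)\<close> with bounded \<open>b\<^sub>j\<close>. Hence \<open>N(x + \<Sum> c\<^sub>j a\<^sub>j)\<close> is the value at the integer vector \<open>c\<close> of a
  limit \<open>F(x, y)\<close> of exponential sums in \<open>y\<close> with bounded frequencies \<open>b(d)\<close>. If the discreteness of the
  support of \<open>N\<close> did not force \<open>b\<close> to take finitely many values, then \<open>F(x, \<cdot>)\<close>, times a polynomial of tiny
  degree, would vanish on a net that is fine compared with its bandwidth, hence everywhere. With finitely
  many values of \<open>b\<close>, \<open>N\<close> is a trigonometric polynomial on each coset of the lattice spanned by \<open>n\<close>
  independent vectors \<open>a\<^sub>j\<close>, with the same frequencies on all cosets; such a function is determined by
  finitely many points of the coset, so that the atoms meet finitely many cosets only.\<close>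

section \<open>A Bernstein type inequality for families of exponential sums\<close>

text \<open>The limits of \<open>F x y\<close> are known only at integer vectors and along their
  flow orbits, a dense set; at other \<open>y\<close> the sums need not converge. So the Bernstein
  inequality is stated for limits superior of sequences of finite sums, with a constant that depends
  on the range of the frequencies only and not on the number of terms or their total mass. The
  second obstacle is the order of choices. The mesh of the net is dictated by the bandwidth; only
  then is it known how many atoms near \<open>x\<close> matter on the net, and a polynomial that
  vanishes at the slopes of all these atoms must not enlarge the bandwidth for which the mesh was
  chosen. It does not, because its basic frequency \<open>\<kappa>\<close> is chosen last: a product
  of \<open>card Q\<close> linear factors in a character of frequency \<open>\<kappa>\<close> has
  bandwidth of order \<open>\<kappa> * card Q\<close>, which can be kept below a constant reserved
  in advance. This is how the finiteness of the atoms in one ball becomes a statement about all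
  \<open>y\<close>.\<close>

definition limsup_le :: "(nat \<Rightarrow> complex) \<Rightarrow> real \<Rightarrow> bool" where
  "limsup_le f M \<longleftrightarrow> (\<forall>e>0. \<forall>\<^sub>F i in sequentially. cmod (f i) \<le> M + e)"

lemma limsup_le_mono: "limsup_le f M \<Longrightarrow> M \<le> M' \<Longrightarrow> limsup_le f M'"
  unfolding limsup_le_def
proof (intro allI impI)
  fix e :: real assume A: "\<forall>e>0. \<forall>\<^sub>F i in sequentially. cmod (f i) \<le> M + e" "M \<le> M'" "e > 0"
  from A(1,3) have "\<forall>\<^sub>F i in sequentially. cmod (f i) \<le> M + e" by blast
  then show "\<forall>\<^sub>F i in sequentially. cmod (f i) \<le> M' + e"
    by eventually_elim (use A(2) in simp)
qed

lemma limsup_le_add: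
  assumes "limsup_le f M" "limsup_le g M'"
  shows "limsup_le (\<lambda>i. f i + g i) (M + M')"
  unfolding limsup_le_def
proof (intro allI impI)
  fix e :: real assume "e > 0"
  then have "\<forall>\<^sub>F i in sequentially. cmod (f i) \<le> M + e/2" "\<forall>\<^sub>F i in sequentially. cmod (g i) \<le> M' + e/2"
    using assms unfolding limsup_le_def by (meson half_gt_zero)+
  then show "\<forall>\<^sub>F i in sequentially. cmod (f i + g i) \<le> M + M' + e"
  proof eventually_elim
    case (elim i)
    then show ?case using norm_triangle_ineq[of "f i" "g i"] by linarith
  qed
qed

lemma limsup_le_cmult:
  assumes "limsup_le f M"
  shows "limsup_le (\<lambda>i. c * f i) (cmod c * M)"
  unfolding limsup_le_def
proof (intro allI impI)
  fix e :: real assume "e > 0"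
  define d where "d = e / (cmod c + 1)"
  have c1: "cmod c + 1 > 0" by (smt (verit) norm_ge_zero)
  have "d > 0" using \<open>e > 0\<close> c1 by (simp add: d_def)
  have "cmod c * d \<le> e" 
    using c1 \<open>e>0\<close> by (simp add: d_def divide_simps)
  from \<open>d > 0\<close> have "\<forall>\<^sub>F i in sequentially. cmod (f i) \<le> M + d"
    using assms unfolding limsup_le_def by blast
  then show "\<forall>\<^sub>F i in sequentially. cmod (c * f i) \<le> cmod c * M + e"
  proof eventually_elim
    case (elim i)
    then have "cmod (c * f i) \<le> cmod c * (M + d)" by (simp add: norm_mult mult_left_mono)
    then show ?case using \<open>cmod c * d \<le> e\<close> by (simp add: algebra_simps)
  qed
qed

lemma limsup_le_nonneg: "limsup_le f M \<Longrightarrow> 0 \<le> M"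
proof (rule ccontr)
  assume "limsup_le f M" "\<not> 0 \<le> M"
  then have "\<forall>\<^sub>F i in sequentially. cmod (f i) \<le> M + (-M/2)"
    unfolding limsup_le_def by (meson linorder_not_le neg_0_less_iff_less half_gt_zero)
  then obtain i where "cmod (f i) \<le> M + (-M/2)" using eventually_happens'[OF sequentially_bot] by blast
  then show False using \<open>\<not> 0 \<le> M\<close> norm_ge_zero[of "f i"] by linarith
qed

lemma limsup_le_0_iff: "limsup_le f 0 \<longleftrightarrow> f \<longlonglongrightarrow> 0"
proof
  assume A: "limsup_le f 0"
  show "f \<longlonglongrightarrow> 0"
  proof (rule tendstoI)
    fix e :: real assume "e > 0"
    then have "\<forall>\<^sub>F i in sequentially. cmod (f i) \<le> 0 + e/2"
      using A unfolding limsup_le_def by (meson half_gt_zero)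
    then show "\<forall>\<^sub>F i in sequentially. dist (f i) 0 < e"
      by eventually_elim (use \<open>e > 0\<close> in simp)
  qed
next
  assume A: "f \<longlonglongrightarrow> 0"
  show "limsup_le f 0"
    unfolding limsup_le_def
  proof (intro allI impI)
    fix e :: real assume "e > 0"
    from tendstoD[OF A this] show "\<forall>\<^sub>F i in sequentially. cmod (f i) \<le> 0 + e"
      by eventually_elim simp
  qed
qed

text \<open>Each \<open>h\<close> gives a sequence of functions \<open>k \<mapsto> \<Sum>\<^sub>j h i j cis (k \<theta>\<^sub>j)\<close> on the integers; the operator
  that multiplies \<open>h i j\<close> by \<open>u (\<theta>\<^sub>j)\<close> has norm at most \<open>c\<close> in the supremum over \<open>k\<close> of the limit
  superior over \<open>i\<close>, provided that the frequencies lie in \<open>[-r, r]\<close>. (The value at \<open>k = 0\<close> suffices,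
  as a translation in \<open>k\<close> can be absorbed in \<open>h\<close>.)\<close>
definition fourier_multiplier :: "(nat \<Rightarrow> 'j set) \<Rightarrow> real \<Rightarrow> (real \<Rightarrow> complex) \<Rightarrow> real \<Rightarrow> bool" where
  "fourier_multiplier I r u c \<longleftrightarrow>
     (\<forall>h \<theta> M. (\<exists>C. \<forall>i. (\<Sum>j\<in>I i. cmod (h i j)) \<le> C) \<longrightarrow> (\<forall>i. \<forall>j\<in>I i. \<bar>\<theta> j\<bar> \<le> r) \<longrightarrow>
        (\<forall>k::int. limsup_le (\<lambda>i. \<Sum>j\<in>I i. h i j * cis (k * \<theta> j)) M) \<longrightarrow>
        limsup_le (\<lambda>i. \<Sum>j\<in>I i. h i j * u (\<theta> j)) (c * M))"

lemma fourier_multiplierD: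
  assumes "fourier_multiplier I r u c" "\<And>i. (\<Sum>j\<in>I i. cmod (h i j)) \<le> C"
    "\<And>i j. j \<in> I i \<Longrightarrow> \<bar>\<theta> j\<bar> \<le> r"
    "\<And>k::int. limsup_le (\<lambda>i. \<Sum>j\<in>I i. h i j * cis (k * \<theta> j)) M"
  shows "limsup_le (\<lambda>i. \<Sum>j\<in>I i. h i j * u (\<theta> j)) (c * M)"
proof -
  have "\<exists>C. \<forall>i. (\<Sum>j\<in>I i. cmod (h i j)) \<le> C" using assms(2) by blast
  with assms(1,3,4) show ?thesis unfolding fourier_multiplier_def by simp
qed

lemma fourier_multiplierI:
  assumes "\<And>h \<theta> M C. (\<And>i. (\<Sum>j\<in>I i. cmod (h i j)) \<le> C) \<Longrightarrow>
    (\<And>i j. j \<in> I i \<Longrightarrow> \<bar>\<theta> j\<bar> \<le> r) \<Longrightarrow>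
    (\<And>k::int. limsup_le (\<lambda>i. \<Sum>j\<in>I i. h i j * cis (k * \<theta> j)) M) \<Longrightarrow>
    limsup_le (\<lambda>i. \<Sum>j\<in>I i. h i j * u (\<theta> j)) (c * M)"
  shows "fourier_multiplier I r u c"
  unfolding fourier_multiplier_def
proof (intro allI impI)
  fix h :: "nat \<Rightarrow> 'a \<Rightarrow> complex" and \<theta> M
  assume "\<exists>C. \<forall>i. (\<Sum>j\<in>I i. cmod (h i j)) \<le> C" and A: "\<forall>i. \<forall>j\<in>I i. \<bar>\<theta> j\<bar> \<le> r"
    "\<forall>k::int. limsup_le (\<lambda>i. \<Sum>j\<in>I i. h i j * cis (k * \<theta> j)) M"
  then obtain C where "\<And>i. (\<Sum>j\<in>I i. cmod (h i j)) \<le> C" by blast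
  from assms[OF this] A show "limsup_le (\<lambda>i. \<Sum>j\<in>I i. h i j * u (\<theta> j)) (c * M)" by simp
qed

lemma fourier_multiplier_mono:
  assumes "fourier_multiplier I r u c" "c \<le> c'" "r' \<le> r" shows "fourier_multiplier I r' u c'"
proof (rule fourier_multiplierI)
  fix h \<theta> M C
  assume A: "\<And>i. (\<Sum>j\<in>I i. cmod (h i j)) \<le> C" "\<And>i j. j \<in> I i \<Longrightarrow> \<bar>\<theta> j\<bar> \<le> r'"
    and B: "\<And>k::int. limsup_le (\<lambda>i. \<Sum>j\<in>I i. h i j * cis (k * \<theta> j)) M"
  have "limsup_le (\<lambda>i. \<Sum>j\<in>I i. h i j * u (\<theta> j)) (c * M)"
    by (rule fourier_multiplierD[OF assms(1) A(1) _ B]) (use A(2) assms(3) in force)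
  moreover have "c * M \<le> c' * M"
    using limsup_le_nonneg[OF B] assms(2) by (simp add: mult_right_mono)
  ultimately show "limsup_le (\<lambda>i. \<Sum>j\<in>I i. h i j * u (\<theta> j)) (c' * M)"
    by (rule limsup_le_mono)
qed

lemma fourier_multiplier_cong:
  assumes "fourier_multiplier I r u c" "\<And>t. \<bar>t\<bar> \<le> r \<Longrightarrow> u t = v t"
  shows "fourier_multiplier I r v c"
proof (rule fourier_multiplierI)
  fix h \<theta> M C
  assume A: "\<And>i. (\<Sum>j\<in>I i. cmod (h i j)) \<le> C" "\<And>i j. j \<in> I i \<Longrightarrow> \<bar>\<theta> j\<bar> \<le> r"
    and B: "\<And>k::int. limsup_le (\<lambda>i. \<Sum>j\<in>I i. h i j * cis (k * \<theta> j)) M"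
  have "(\<lambda>i. \<Sum>j\<in>I i. h i j * v (\<theta> j)) = (\<lambda>i. \<Sum>j\<in>I i. h i j * u (\<theta> j))"
    by (rule ext, rule sum.cong[OF refl]) (simp add: A(2) assms(2))
  then show "limsup_le (\<lambda>i. \<Sum>j\<in>I i. h i j * v (\<theta> j)) (c * M)"
    using fourier_multiplierD[OF assms(1) A B] by simp
qed

lemma fourier_multiplier_add:
  assumes "fourier_multiplier I r u c" "fourier_multiplier I r v d"
  shows "fourier_multiplier I r (\<lambda>t. u t + v t) (c + d)"
proof (rule fourier_multiplierI)
  fix h \<theta> M C
  assume A: "\<And>i. (\<Sum>j\<in>I i. cmod (h i j)) \<le> C" "\<And>i j. j \<in> I i \<Longrightarrow> \<bar>\<theta> j\<bar> \<le> r"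
    "\<And>k::int. limsup_le (\<lambda>i. \<Sum>j\<in>I i. h i j * cis (k * \<theta> j)) M"
  show "limsup_le (\<lambda>i. \<Sum>j\<in>I i. h i j * (u (\<theta> j) + v (\<theta> j))) ((c + d) * M)"
    using limsup_le_add[OF fourier_multiplierD[OF assms(1) A] fourier_multiplierD[OF assms(2) A]]
    by (simp add: algebra_simps sum.distrib)
qed

lemma fourier_multiplier_cmult:
  assumes "fourier_multiplier I r u c"
  shows "fourier_multiplier I r (\<lambda>t. a * u t) (cmod a * c)"
proof (rule fourier_multiplierI)
  fix h \<theta> M C
  assume A: "\<And>i. (\<Sum>j\<in>I i. cmod (h i j)) \<le> C" "\<And>i j. j \<in> I i \<Longrightarrow> \<bar>\<theta> j\<bar> \<le> r"
    "\<And>k::int. limsup_le (\<lambda>i. \<Sum>j\<in>I i. h i j * cis (k * \<theta> j)) M"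
  show "limsup_le (\<lambda>i. \<Sum>j\<in>I i. h i j * (a * u (\<theta> j))) (cmod a * c * M)"
    using limsup_le_cmult[OF fourier_multiplierD[OF assms A], where c = a]
    by (simp add: algebra_simps sum_distrib_left)
qed

text \<open>Operators compose: the bound for \<open>u\<close> is applied to each
  \<open>h i j * cis (k * \<theta> j)\<close>, whose translates are again below \<open>M\<close>,
  and then \<open>v\<close> acts on \<open>h i j * u (\<theta> j)\<close>. The global bound
  \<open>K\<close> on \<open>u\<close> keeps the total mass of the latter finite.\<close>

lemma fourier_multiplier_mult:
  assumes "fourier_multiplier I r u c" "fourier_multiplier I r v d"
    and bd: "\<And>t. cmod (u t) \<le> K"
  shows "fourier_multiplier I r (\<lambda>t. u t * v t) (c * d)"
proof (rule fourier_multiplierI)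
  fix h \<theta> M C
  assume A: "\<And>i. (\<Sum>j\<in>I i. cmod (h i j)) \<le> C" "\<And>i j. j \<in> I i \<Longrightarrow> \<bar>\<theta> j\<bar> \<le> r"
    and B: "\<And>k::int. limsup_le (\<lambda>i. \<Sum>j\<in>I i. h i j * cis (k * \<theta> j)) M"
  have "K \<ge> 0" using bd[of 0] norm_ge_zero order_trans by blast
  have "limsup_le (\<lambda>i. \<Sum>j\<in>I i. (h i j * cis (k * \<theta> j)) * u (\<theta> j)) (c * M)" for k :: int
  proof (rule fourier_multiplierD[OF assms(1), where C = C])
    fix l :: int
    show "limsup_le (\<lambda>i. \<Sum>j\<in>I i. h i j * cis (k * \<theta> j) * cis (l * \<theta> j)) M"
      using B[of "k + l"] by (simp add: cis_mult algebra_simps)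
  qed (use A in \<open>auto simp: norm_mult\<close>)
  then have *: "limsup_le (\<lambda>i. \<Sum>j\<in>I i. (h i j * u (\<theta> j)) * cis (k * \<theta> j)) (c * M)" for k :: int
    by (simp add: mult_ac)
  have "(\<Sum>j\<in>I i. cmod (h i j * u (\<theta> j))) \<le> C * K" for i
  proof -
    have "(\<Sum>j\<in>I i. cmod (h i j * u (\<theta> j))) \<le> (\<Sum>j\<in>I i. cmod (h i j) * K)"
      by (intro sum_mono) (simp add: norm_mult mult_left_mono bd)
    also have "\<dots> \<le> C * K" using A(1)[of i] \<open>K \<ge> 0\<close> by (simp flip: sum_distrib_right add: mult_right_mono)
    finally show ?thesis .
  qed
  from fourier_multiplierD[OF assms(2) this A(2) *]
  show "limsup_le (\<lambda>i. \<Sum>j\<in>I i. h i j * (u (\<theta> j) * v (\<theta> j))) (c * d * M)"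
    by (simp add: mult_ac)
qed

text \<open>Multiplying the frequencies by \<open>K\<close> samples the exponential sums at the
  multiples of \<open>K\<close> only, so the supremum cannot grow. This is what makes the half angle
  formulas profitable.\<close>

lemma fourier_multiplier_scale:
  assumes "fourier_multiplier I (of_nat K * r) u c"
  shows "fourier_multiplier I r (\<lambda>t. u (of_nat K * t)) c"
proof (rule fourier_multiplierI)
  fix h \<theta> M C
  assume A: "\<And>i. (\<Sum>j\<in>I i. cmod (h i j)) \<le> C" "\<And>i j. j \<in> I i \<Longrightarrow> \<bar>\<theta> j\<bar> \<le> r"
    and B: "\<And>k::int. limsup_le (\<lambda>i. \<Sum>j\<in>I i. h i j * cis (k * \<theta> j)) M"
  show "limsup_le (\<lambda>i. \<Sum>j\<in>I i. h i j * u (of_nat K * \<theta> j)) (c * M)"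
  proof (rule fourier_multiplierD[OF assms, where h = h and C = C and \<theta> = "\<lambda>j. of_nat K * \<theta> j"])
    fix i j assume "j \<in> I i"
    then show "\<bar>of_nat K * \<theta> j\<bar> \<le> of_nat K * r" using A(2) by (simp add: abs_mult mult_left_mono)
  next
    fix k :: int
    show "limsup_le (\<lambda>i. \<Sum>j\<in>I i. h i j * cis (k * (of_nat K * \<theta> j))) M"
      using B[of "k * int K"] by (simp add: mult_ac)
  qed (use A in auto)
qed

text \<open>An error \<open>d\<close> on \<open>[-r, r]\<close> moves every sum by at most
  \<open>C * d\<close>. The mass \<open>C\<close> influences the choice of \<open>n\<close> but not
  the resulting norm.\<close>

lemma fourier_multiplier_uniform_limit:
  assumes "\<And>n. fourier_multiplier I r (p n) c"
    and lim: "\<And>e. e > 0 \<Longrightarrow> \<exists>n. \<forall>t. \<bar>t\<bar> \<le> r \<longrightarrow> cmod (p n t - u t) \<le> e"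
  shows "fourier_multiplier I r u c"
proof (rule fourier_multiplierI)
  fix h \<theta> M C
  assume A: "\<And>i. (\<Sum>j\<in>I i. cmod (h i j)) \<le> C" "\<And>i j. j \<in> I i \<Longrightarrow> \<bar>\<theta> j\<bar> \<le> r"
    and B: "\<And>k::int. limsup_le (\<lambda>i. \<Sum>j\<in>I i. h i j * cis (k * \<theta> j)) M"
  have C0: "C \<ge> 0" using A(1)[of 0] by (meson norm_ge_zero order_trans sum_nonneg)
  show "limsup_le (\<lambda>i. \<Sum>j\<in>I i. h i j * u (\<theta> j)) (c * M)"
    unfolding limsup_le_def
  proof (intro allI impI)
    fix e :: real assume "e > 0"
    define d where "d = e / 2 / (C + 1)"
    have "d > 0" "C * d \<le> e / 2" using \<open>e > 0\<close> C0 by (auto simp: d_def field_simps)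
    then obtain n where n: "\<And>t. \<bar>t\<bar> \<le> r \<Longrightarrow> cmod (p n t - u t) \<le> d" using lim by blast
    have "\<forall>\<^sub>F i in sequentially. cmod (\<Sum>j\<in>I i. h i j * p n (\<theta> j)) \<le> c * M + e / 2"
      using fourier_multiplierD[OF assms(1)[of n] A B] \<open>e > 0\<close> unfolding limsup_le_def by simp
    then show "\<forall>\<^sub>F i in sequentially. cmod (\<Sum>j\<in>I i. h i j * u (\<theta> j)) \<le> c * M + e"
    proof eventually_elim
      case (elim i)
      have "cmod ((\<Sum>j\<in>I i. h i j * p n (\<theta> j)) - (\<Sum>j\<in>I i. h i j * u (\<theta> j)))
          = cmod (\<Sum>j\<in>I i. h i j * (p n (\<theta> j) - u (\<theta> j)))"
        by (simp add: sum_subtractf algebra_simps)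
      also have "\<dots> \<le> (\<Sum>j\<in>I i. cmod (h i j) * d)"
        by (rule sum_norm_le) (use n A(2) in \<open>auto simp: norm_mult intro!: mult_left_mono\<close>)
      also have "\<dots> \<le> C * d" using A(1)[of i] \<open>d > 0\<close> by (simp flip: sum_distrib_right add: mult_right_mono)
      finally show ?case using elim \<open>C * d \<le> e / 2\<close>
        by (smt (verit) field_sum_of_halves norm_minus_commute norm_triangle_sub)
    qed
  qed
qed

lemma fourier_multiplier_cis: "fourier_multiplier I r (\<lambda>t. cis (of_int k * t)) 1"
  by (rule fourier_multiplierI) simp

lemma fourier_multiplier_zero: "fourier_multiplier I r (\<lambda>t. 0) 0"
  by (rule fourier_multiplierI) (simp add: limsup_le_def)

lemma fourier_multiplier_sin: "fourier_multiplier I r (\<lambda>t. of_real (sin t)) 1"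
proof -
  have "fourier_multiplier I r
     (\<lambda>t. (-\<i>/2) * cis (of_int 1 * t) + (\<i>/2) * cis (of_int (-1) * t)) (cmod (-\<i>/2) * 1 + cmod (\<i>/2) * 1)"
    by (intro fourier_multiplier_add fourier_multiplier_cmult fourier_multiplier_cis)
  then have "fourier_multiplier I r
     (\<lambda>t. (-\<i>/2) * cis (of_int 1 * t) + (\<i>/2) * cis (of_int (-1) * t)) 1" by (simp add: norm_divide)
  then show ?thesis
    by (rule fourier_multiplier_cong) (simp add: complex_eq_iff)
qed

text \<open>\<open>E = 1 - cos\<close> solves \<open>E = (sin\<^sup>2 + E\<^sup>2) / 2\<close>, and the fixed point iteration that starts at 0
  converges to it uniformly as long as \<open>E\<close> stays away from 1.\<close>
lemma fourier_multiplier_one_minus_cos: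
  fixes I :: "nat \<Rightarrow> 'j set"
  assumes s: "fourier_multiplier I r (\<lambda>t. of_real ((sin t)\<^sup>2)) a" and "r \<le> 1" "0 \<le> b" "(a + b\<^sup>2) / 2 \<le> b"
  shows "fourier_multiplier I r (\<lambda>t. of_real (1 - cos t)) b"
proof (rule fourier_multiplier_uniform_limit)
  \<comment> \<open>The hypothesis \<open>(a + b\<^sup>2) / 2 \<le> b\<close> says that the norm
    bound \<open>b\<close> survives one step of this iteration.\<close>
  define p where "p = rec_nat (\<lambda>t::real. 0::real) (\<lambda>n q t. ((sin t)\<^sup>2 + (q t)\<^sup>2) / 2)"
  have p0: "p 0 t = 0" and pS: "p (Suc n) t = ((sin t)\<^sup>2 + (p n t)\<^sup>2) / 2" for n t
    by (simp_all add: p_def)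
  have bd: "0 \<le> p n t \<and> p n t \<le> 1" for n t
  proof (induction n)
    case (Suc n)
    then have "(p n t)\<^sup>2 \<le> 1" by (simp add: power_le_one)
    moreover have "(sin t)\<^sup>2 \<le> 1" using sin_cos_squared_add[of t] by (smt (verit) zero_le_power2)
    ultimately show ?case by (simp add: pS)
  qed (simp add: p0)
  show "fourier_multiplier I r (\<lambda>t. of_real (p n t)) b" for n
  proof (induction n)
    case 0 
    have "fourier_multiplier I r (\<lambda>t. 0) b"
      by (rule fourier_multiplier_mono[OF fourier_multiplier_zero]) (use assms in auto)
    then show ?case by (simp add: p0)
  next
    case (Suc n)
    have "fourier_multiplier I r (\<lambda>t. of_real (p n t) * of_real (p n t)) (b * b)"
      by (rule fourier_multiplier_mult[OF Suc Suc, where K = 1]) (use bd in auto)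
    then have "fourier_multiplier I r (\<lambda>t. (1/2) * (of_real ((sin t)\<^sup>2) + of_real (p n t) * of_real (p n t))) (cmod (1/2) * (a + b * b))"
      by (intro fourier_multiplier_cmult fourier_multiplier_add s)
    then have "fourier_multiplier I r (\<lambda>t. (1/2) * (of_real ((sin t)\<^sup>2) + of_real (p n t) * of_real (p n t))) b"
      by (rule fourier_multiplier_mono) (use assms in \<open>simp_all add: power2_eq_square\<close>)
    then show ?case
      by (rule fourier_multiplier_cong) (simp add: pS power2_eq_square)
  qed
  \<comment> \<open>One step multiplies the error \<open>q - p n t\<close> by
    \<open>(q + p n t) / 2\<close>; as \<open>p n t \<le> q \<le> 1/2\<close>, this factor is at
    most 1/2.\<close>
  have E: "1 - cos t \<le> 1/2" if "\<bar>t\<bar> \<le> r" for t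
  proof -
    have "\<bar>sin (t/2)\<bar> \<le> 1/2" using abs_sin_x_le_abs_x[of "t/2"] that assms by simp
    then have "(sin (t/2))\<^sup>2 \<le> (1/2)\<^sup>2" using abs_le_square_iff[of "sin (t/2)" "1/2"] by simp
    then show ?thesis using cos_double_sin[of "t/2"] by (simp add: power2_eq_square)
  qed
  have err: "0 \<le> 1 - cos t - p n t \<and> 1 - cos t - p n t \<le> (1/2)^n" if "\<bar>t\<bar> \<le> r" for n t
  proof (induction n)
    case 0 
    show ?case using E[OF that] by (auto simp: p0)
  next
    case (Suc n)
    define q where "q = 1 - cos t"
    have "q = ((sin t)\<^sup>2 + q\<^sup>2) / 2"
      using sin_cos_squared_add[of t] by (simp add: q_def power2_eq_square algebra_simps)
    then have *: "q - p (Suc n) t = (q - p n t) * ((q + p n t) / 2)"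
      by (simp add: pS power2_eq_square field_simps)
    have "0 \<le> q - p n t" "q - p n t \<le> (1/2)^n" using Suc by (auto simp: q_def)
    moreover have "0 \<le> (q + p n t) / 2" "(q + p n t) / 2 \<le> 1/2"
      using calculation E[OF that] bd[of n t] by (auto simp: q_def)
    ultimately have "0 \<le> q - p (Suc n) t" "q - p (Suc n) t \<le> (1/2)^n * (1/2)"
      unfolding * by (intro mult_nonneg_nonneg mult_mono; simp)+
    then show ?case by (simp add: q_def)
  qed
  show "\<exists>n. \<forall>t. \<bar>t\<bar> \<le> r \<longrightarrow> cmod (of_real (p n t) - of_real (1 - cos t)) \<le> e" if "e > 0" for e
  proof -
    obtain n where "(1/2::real)^n < e" using real_arch_pow_inv[of e "1/2::real"] \<open>e > 0\<close> by auto
    then have "\<forall>t. \<bar>t\<bar> \<le> r \<longrightarrow> cmod (of_real (p n t) - of_real (1 - cos t)) \<le> e"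
      using err[of _ n] by (smt (verit) norm_of_real of_real_diff)
    then show ?thesis ..
  qed
qed

text \<open>The square of \<open>sin t\<close> is \<open>(1 - cos (2 * t)) / 2\<close> and doubling
  the frequency costs nothing, so on half the window the norm is half as large.\<close>

lemma fourier_multiplier_sin_square_half:
  assumes "fourier_multiplier I r (\<lambda>t. of_real (1 - cos t)) b"
  shows "fourier_multiplier I (r/2) (\<lambda>t. of_real ((sin t)\<^sup>2)) (b/2)"
proof -
  have "fourier_multiplier I (r/2) (\<lambda>t. of_real (1 - cos (of_nat 2 * t))) b"
    by (rule fourier_multiplier_scale) (use assms in simp)
  from fourier_multiplier_cmult[OF this, of "1/2"]
  have "fourier_multiplier I (r/2) (\<lambda>t. (1/2) * of_real (1 - cos (of_nat 2 * t))) (b/2)" by simp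
  then show ?thesis
    by (rule fourier_multiplier_cong) (simp add: cos_double_sin)
qed

text \<open>Rests on \<open>sin t = sin (2 * t) / 2 + sin t * (1 - cos t)\<close>: the first term
  gains a factor 1/2, the second is small together with \<open>1 - cos t\<close>.\<close>

lemma fourier_multiplier_sin_half:
  assumes "fourier_multiplier I r (\<lambda>t. of_real (sin t)) a"
    "fourier_multiplier I (r/2) (\<lambda>t. of_real (sin t)) c"
    "fourier_multiplier I (r/2) (\<lambda>t. of_real (1 - cos t)) b"
  shows "fourier_multiplier I (r/2) (\<lambda>t. of_real (sin t)) (a/2 + c * b)"
proof -
  have 1: "fourier_multiplier I (r/2) (\<lambda>t. of_real (sin (of_nat 2 * t))) a"
    by (rule fourier_multiplier_scale) (use assms in simp)
  have "fourier_multiplier I (r/2) (\<lambda>t. (1/2) * of_real (sin (of_nat 2 * t)) +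
      of_real (sin t) * of_real (1 - cos t)) (cmod (1/2) * a + c * b)"
    by (intro fourier_multiplier_add fourier_multiplier_cmult 1 fourier_multiplier_mult[where K = 1] assms)
       auto
  then have "fourier_multiplier I (r/2) (\<lambda>t. (1/2) * of_real (sin (of_nat 2 * t)) +
      of_real (sin t) * of_real (1 - cos t)) (a/2 + c * b)" by simp
  then show ?thesis
  proof (rule fourier_multiplier_cong)
    fix t :: real
    have "(1/2) * sin (of_nat 2 * t) + sin t * (1 - cos t) = sin t"
      using sin_double[of t] by (simp add: algebra_simps)
    then have "complex_of_real ((1/2) * sin (of_nat 2 * t) + sin t * (1 - cos t)) = of_real (sin t)"
      by (simp only:)
    then show "(1/2) * complex_of_real (sin (of_nat 2 * t)) + of_real (sin t) * of_real (1 - cos t) = of_real (sin t)"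
      by simp
  qed
qed

text \<open>What matters is a norm below 1, which can be iterated. The window is halved three times,
  from 1 to 1/8. The bounds 1, 3/10, 8/100, 21/1000 for \<open>1 - cos\<close> are the smaller root
  of \<open>b = (a + b\<^sup>2) / 2\<close>, rounded up; those for the sine are 1, 58/100 and
  311/1000. The last two bounds add up to 0.332, which is below 1/2.\<close>

lemma fourier_multiplier_cis_minus_one: "fourier_multiplier I (1/8) (\<lambda>t. cis t - 1) (1/2)"
proof -
  have sin: "fourier_multiplier I r (\<lambda>t. of_real (sin t)) 1" for r
    by (rule fourier_multiplier_sin)
  have "fourier_multiplier I 1 (\<lambda>t. of_real (sin t) * of_real (sin t)) (1 * 1)"
    by (rule fourier_multiplier_mult[OF sin sin, where K = 1]) auto
  then have "fourier_multiplier I 1 (\<lambda>t. of_real ((sin t)\<^sup>2)) 1" by (simp add: power2_eq_square)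
  then have "fourier_multiplier I 1 (\<lambda>t. of_real (1 - cos t)) 1"
    by (rule fourier_multiplier_one_minus_cos) auto
  then have "fourier_multiplier I (1/2) (\<lambda>t. of_real ((sin t)\<^sup>2)) (1/2)"
    by (rule fourier_multiplier_sin_square_half)
  then have "fourier_multiplier I (1/2) (\<lambda>t. of_real (1 - cos t)) (3/10)"
    by (rule fourier_multiplier_one_minus_cos) (auto simp: power2_eq_square)
  then have "fourier_multiplier I (1/2/2) (\<lambda>t. of_real ((sin t)\<^sup>2)) (3/10/2)"
    by (rule fourier_multiplier_sin_square_half)
  then have c4: "fourier_multiplier I (1/2/2) (\<lambda>t. of_real (1 - cos t)) (8/100)"
    by (rule fourier_multiplier_one_minus_cos) (auto simp: power2_eq_square)
  then have "fourier_multiplier I (1/2/2/2) (\<lambda>t. of_real ((sin t)\<^sup>2)) (8/100/2)"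
    by (rule fourier_multiplier_sin_square_half)
  then have c8: "fourier_multiplier I (1/2/2/2) (\<lambda>t. of_real (1 - cos t)) (21/1000)"
    by (rule fourier_multiplier_one_minus_cos) (auto simp: power2_eq_square)
  have "fourier_multiplier I (1/2/2) (\<lambda>t. of_real (sin t)) (1/2 + 1 * (8/100))"
    by (rule fourier_multiplier_sin_half[OF sin sin c4])
  from fourier_multiplier_sin_half[OF this sin c8]
  have s8: "fourier_multiplier I (1/2/2/2) (\<lambda>t. of_real (sin t)) (311/1000)" by simp
  have "fourier_multiplier I (1/2/2/2) (\<lambda>t. (-1) * of_real (1 - cos t) + \<i> * of_real (sin t))
     (cmod (-1) * (21/1000) + cmod \<i> * (311/1000))"
    by (intro fourier_multiplier_add fourier_multiplier_cmult c8 s8)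
  then have "fourier_multiplier I (1/8) (\<lambda>t. (-1) * of_real (1 - cos t) + \<i> * of_real (sin t)) (1/2)"
    by (rule fourier_multiplier_mono) auto
  then show ?thesis
    by (rule fourier_multiplier_cong) (simp add: complex_eq_iff)
qed

section \<open>Characters, and exponential sums that vanish on a fine net\<close>

definition unit_char :: "real \<Rightarrow> complex" where
  "unit_char t = cis (2 * pi * t)"

lemma unit_char_add: "unit_char (s + t) = unit_char s * unit_char t"
  by (simp add: unit_char_def cis_mult ring_distribs)

lemma norm_unit_char [simp]: "cmod (unit_char t) = 1"
  by (simp add: unit_char_def)

lemma unit_char_0 [simp]: "unit_char 0 = 1"
  by (simp add: unit_char_def)

lemma unit_char_Ints: "k \<in> \<int> \<Longrightarrow> unit_char k = 1"
  by (auto simp: unit_char_def elim!: Ints_cases)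

lemma unit_char_of_nat_mult: "unit_char (of_nat k * t) = unit_char t ^ k"
  by (induction k) (simp_all add: unit_char_add ring_distribs)

lemma norm_unit_char_diff: "cmod (unit_char s - unit_char t) \<le> 2 * pi * \<bar>s - t\<bar>"
proof -
  have "unit_char s - unit_char t = unit_char t * (unit_char (s - t) - 1)"
    using unit_char_add[of t "s - t"] by (simp add: algebra_simps)
  then have "cmod (unit_char s - unit_char t) = cmod (unit_char (s - t) - 1)"
    by (simp add: norm_mult)
  also have "\<dots> \<le> \<bar>2 * pi * (s - t)\<bar>"
  proof -
    define x where "x = 2 * pi * (s - t)"
    have "(cmod (cis x - 1))\<^sup>2 = (cos x - 1)\<^sup>2 + (sin x)\<^sup>2" by (simp add: cmod_power2)
    also have "\<dots> = 2 - 2 * cos x"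
      using sin_cos_squared_add[of x] by (simp add: power2_eq_square algebra_simps)
    also have "\<dots> = (2 * sin (x/2))\<^sup>2"
      using cos_double_sin[of "x/2"] by (simp add: power2_eq_square)
    also have "\<dots> \<le> x\<^sup>2"
      using abs_sin_x_le_abs_x[of "x/2"] abs_le_square_iff[of "2 * sin (x/2)" x] by (simp add: abs_mult)
    finally show ?thesis
      using abs_le_square_iff[of "cmod (cis x - 1)" x] by (simp add: unit_char_def x_def)
  qed
  finally show ?thesis by (simp add: abs_mult)
qed

text \<open>By the Bernstein type inequality \<open>fourier_multiplier_cis_minus_one\<close>, passing from \<open>y\<close> to a nearby zero
  changes \<open>f\<close> by at most half of the supremum over all \<open>y\<close> of its limit superior.\<close>
lemma tendsto_zero_of_zeros_on_net:
  fixes I :: "nat \<Rightarrow> 's set" and J :: "'j set" and \<beta> :: "'s \<Rightarrow> 'j \<Rightarrow> real"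
    and h :: "nat \<Rightarrow> 's \<Rightarrow> complex"
  defines "f \<equiv> \<lambda>y i. \<Sum>s\<in>I i. h i s * unit_char (\<Sum>j\<in>J. y j * \<beta> s j)"
  assumes C: "\<And>i. (\<Sum>s\<in>I i. cmod (h i s)) \<le> C"
    and net: "\<And>y. \<exists>y'. f y' \<longlonglongrightarrow> 0 \<and>
        (\<forall>i. \<forall>s\<in>I i. \<bar>2 * pi * (\<Sum>j\<in>J. (y' j - y j) * \<beta> s j)\<bar> \<le> 1/8)"
  shows "f y \<longlonglongrightarrow> 0"
proof -
  \<comment> \<open>The bound must hold for all \<open>y\<close> at once: the multiplier uses it at
    every point \<open>y + k * (y' - y)\<close> of an arithmetic progression.\<close>
  have claim: "limsup_le (f y) (C / 2^n)" for y n
  proof (induction n arbitrary: y)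
    case 0
    have "cmod (f y i) \<le> C" for i
      unfolding f_def by (rule order_trans[OF sum_norm_le C[of i]]) (simp add: norm_mult)
    then show ?case unfolding limsup_le_def
      by (auto intro!: always_eventually simp: add_increasing2)
  next
    case (Suc n)
    obtain y' where y': "f y' \<longlonglongrightarrow> 0"
      and small: "\<And>i s. s \<in> I i \<Longrightarrow> \<bar>2 * pi * (\<Sum>j\<in>J. (y' j - y j) * \<beta> s j)\<bar> \<le> 1/8"
      using net[of y] by blast
    define \<theta> where "\<theta> s = 2 * pi * (\<Sum>j\<in>J. (y' j - y j) * \<beta> s j)" for s
    define h' where "h' i s = h i s * unit_char (\<Sum>j\<in>J. y j * \<beta> s j)" for i s
    have shift: "(\<Sum>s\<in>I i. h' i s * cis (of_int k * \<theta> s)) = f (\<lambda>j. y j + of_int k * (y' j - y j)) i" for i and k :: int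
    proof -
      have "unit_char (\<Sum>j\<in>J. y j * \<beta> s j) * cis (of_int k * \<theta> s)
          = unit_char (\<Sum>j\<in>J. (y j + of_int k * (y' j - y j)) * \<beta> s j)" for s
      proof -
        have "(\<Sum>j\<in>J. (y j + of_int k * (y' j - y j)) * \<beta> s j)
            = (\<Sum>j\<in>J. y j * \<beta> s j) + of_int k * (\<Sum>j\<in>J. (y' j - y j) * \<beta> s j)"
          unfolding sum_distrib_left sum.distrib[symmetric] by (simp add: algebra_simps)
        moreover have "cis (of_int k * \<theta> s) = unit_char (of_int k * (\<Sum>j\<in>J. (y' j - y j) * \<beta> s j))"
          by (simp add: unit_char_def \<theta>_def mult.left_commute)
        ultimately show ?thesis by (simp add: unit_char_add)
      qed
      then show ?thesis by (simp add: f_def h'_def mult.assoc)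
    qed
    have "limsup_le (\<lambda>i. \<Sum>s\<in>I i. h' i s * (cis (\<theta> s) - 1)) (1/2 * (C / 2^n))"
    proof (rule fourier_multiplierD[OF fourier_multiplier_cis_minus_one])
      show "(\<Sum>s\<in>I i. cmod (h' i s)) \<le> C" for i using C[of i] by (simp add: h'_def norm_mult)
      show "\<bar>\<theta> s\<bar> \<le> 1/8" if "s \<in> I i" for i s using small[OF that] by (simp add: \<theta>_def)
      show "limsup_le (\<lambda>i. \<Sum>s\<in>I i. h' i s * cis (of_int k * \<theta> s)) (C / 2^n)" for k :: int
        unfolding shift by (rule Suc.IH)
    qed
    moreover have "(\<Sum>s\<in>I i. h' i s * (cis (\<theta> s) - 1)) = f y' i - f y i" for i
      using shift[of i 1] shift[of i 0] by (simp add: algebra_simps sum_subtractf)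
    ultimately have "limsup_le (\<lambda>i. f y' i - f y i) (C / 2^Suc n)" by simp
    from limsup_le_add[OF limsup_le_cmult[OF this, where c = "-1"] limsup_le_0_iff[THEN iffD2, OF y']]
    show ?case by simp
  qed
  have "limsup_le (f y) 0"
    unfolding limsup_le_def
  proof (intro allI impI)
    fix e :: real assume "e > 0"
    have "(\<lambda>n. C * (1/2)^n) \<longlonglongrightarrow> C * 0"
      by (intro tendsto_intros) (auto simp: LIMSEQ_realpow_zero)
    then have "\<forall>\<^sub>F n in sequentially. C * (1/2)^n < e/2"
      by (rule order_tendstoD) (use \<open>e > 0\<close> in simp)
    then obtain n where n: "C * (1/2)^n < e/2"
      using eventually_happens'[OF sequentially_bot] by blast
    have "\<forall>\<^sub>F i in sequentially. cmod (f y i) \<le> C / 2^n + e/2"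
      using claim[of y n] \<open>e > 0\<close> unfolding limsup_le_def by (meson half_gt_zero)
    then show "\<forall>\<^sub>F i in sequentially. cmod (f y i) \<le> 0 + e"
    proof eventually_elim
      case (elim i)
      have "C / 2^n = C * (1/2)^n" by (simp add: power_one_over)
      then show ?case using elim n by linarith
    qed
  qed
  then show ?thesis by (simp add: limsup_le_0_iff)
qed

section \<open>Finite-dimensional duality and compactness of coefficients\<close>

text \<open>Gaussian elimination, one coordinate of \<open>J\<close> at a time. It serves twice:
  over the reals to reduce the relations among the \<open>a j\<close> to finitely many, and over the
  complex numbers to test a trigonometric polynomial on finitely many lattice points.\<close>

lemma finite_determining_subset:
  fixes P :: "('j \<Rightarrow> 'k::field) set"
  assumes "finite J"
  shows "\<exists>P'\<subseteq>P. finite P' \<and> (\<forall>l. (\<forall>p\<in>P'. (\<Sum>j\<in>J. l j * p j) = 0) \<longrightarrow> (\<forall>p\<in>P. (\<Sum>j\<in>J. l j * p j) = 0))"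
  using assms
proof (induction J arbitrary: P rule: finite_induct)
  case empty
  show ?case by (rule exI[of _ "{}"]) simp
next
  case (insert j0 J)
  show ?case
  proof (cases "\<forall>p\<in>P. p j0 = 0")
    case True
    obtain P' where P': "P' \<subseteq> P" "finite P'"
      "\<And>l. (\<forall>p\<in>P'. (\<Sum>j\<in>J. l j * p j) = 0) \<Longrightarrow> (\<forall>p\<in>P. (\<Sum>j\<in>J. l j * p j) = 0)"
      using insert.IH[of P] by (elim exE conjE) (rule that, assumption+, simp)
    have eq: "(\<Sum>j\<in>insert j0 J. l j * p j) = (\<Sum>j\<in>J. l j * p j)" if "p \<in> P" for l p
      using insert.hyps True that by simp
    have "\<forall>p\<in>P. (\<Sum>j\<in>insert j0 J. l j * p j) = 0"
      if l: "\<forall>p\<in>P'. (\<Sum>j\<in>insert j0 J. l j * p j) = 0" for l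
    proof -
      have "\<forall>p\<in>P'. (\<Sum>j\<in>J. l j * p j) = 0" using l by (simp add: eq subsetD[OF P'(1)])
      from P'(3)[OF this] show ?thesis by (simp add: eq)
    qed
    then show ?thesis using P'(1,2) by (intro exI[of _ P'] conjI allI impI)
  next
    case False
    then obtain p0 where p0: "p0 \<in> P" "p0 j0 \<noteq> 0" by blast
    \<comment> \<open>Pivot step: \<open>red p\<close> has coordinate 0 at \<open>j0\<close>, so the
      induction hypothesis for \<open>J\<close> applies to the reduced vectors.\<close>
    define red where "red p j = p j - p j0 / p0 j0 * p0 j" for p j
    obtain R where R: "R \<subseteq> red ` P" "finite R"
      "\<And>l. (\<forall>p\<in>R. (\<Sum>j\<in>J. l j * p j) = 0) \<Longrightarrow> (\<forall>p\<in>red ` P. (\<Sum>j\<in>J. l j * p j) = 0)"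
      using insert.IH[of "red ` P"] by (elim exE conjE) (rule that, assumption+, simp)
    obtain P'' where P'': "P'' \<subseteq> P" "finite P''" "R = red ` P''"
      using finite_subset_image[OF R(2,1)] by blast
    have eq: "(\<Sum>j\<in>insert j0 J. l j * p j)
        = (\<Sum>j\<in>J. l j * red p j) + p j0 / p0 j0 * (\<Sum>j\<in>insert j0 J. l j * p0 j)" for l p
    proof -
      have "(\<Sum>j\<in>insert j0 J. l j * red p j)
        = (\<Sum>j\<in>insert j0 J. l j * p j) - p j0 / p0 j0 * (\<Sum>j\<in>insert j0 J. l j * p0 j)"
        unfolding sum_distrib_left sum_subtractf[symmetric] red_def by (simp add: algebra_simps)
      moreover have "(\<Sum>j\<in>insert j0 J. l j * red p j) = (\<Sum>j\<in>J. l j * red p j)"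
        using insert.hyps p0 by (simp add: red_def)
      ultimately show ?thesis by simp
    qed
    have "\<forall>p\<in>P. (\<Sum>j\<in>insert j0 J. l j * p j) = 0"
      if l: "\<forall>p\<in>insert p0 P''. (\<Sum>j\<in>insert j0 J. l j * p j) = 0" for l
    proof -
      have "(\<Sum>j\<in>insert j0 J. l j * p0 j) = 0" using l by (rule bspec) simp
      note eq0 = eq[of l, unfolded this mult_zero_right add_0_right]
      have "\<forall>p\<in>R. (\<Sum>j\<in>J. l j * p j) = 0"
        unfolding P''(3) using l eq0 by simp
      from R(3)[OF this] show ?thesis using eq0 by auto
    qed
    moreover have "insert p0 P'' \<subseteq> P" "finite (insert p0 P'')" using P''(1,2) p0(1) by auto
    ultimately show ?thesis by (intro exI[of _ "insert p0 P''"] conjI allI impI)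
  qed
qed

lemma common_convergent_subsequence:
  fixes \<Phi> :: "nat \<Rightarrow> 'r \<Rightarrow> complex"
  assumes "finite R" "\<And>i r. r \<in> R \<Longrightarrow> cmod (\<Phi> i r) \<le> C"
  shows "\<exists>s \<phi>. strict_mono (s :: nat \<Rightarrow> nat) \<and> (\<forall>r\<in>R. (\<lambda>i. \<Phi> (s i) r) \<longlonglongrightarrow> \<phi> r)"
  using assms
proof (induction R rule: finite_induct)
  case empty
  show ?case by (intro exI[of _ id]) (auto simp: strict_mono_def)
next
  case (insert r R)
  obtain s \<phi> where s: "strict_mono (s :: nat \<Rightarrow> nat)" "\<And>r. r\<in>R \<Longrightarrow> (\<lambda>i. \<Phi> (s i) r) \<longlonglongrightarrow> \<phi> r"
  proof -
    have "\<exists>s \<phi>. strict_mono (s :: nat \<Rightarrow> nat) \<and> (\<forall>r\<in>R. (\<lambda>i. \<Phi> (s i) r) \<longlonglongrightarrow> \<phi> r)"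
      by (rule insert.IH) (simp add: insert.prems)
    then show ?thesis using that by fastforce
  qed
  have "bounded (range (\<lambda>i. \<Phi> (s i) r))"
    unfolding bounded_iff using insert.prems by blast
  then obtain l t where t: "strict_mono (t :: nat \<Rightarrow> nat)" "((\<lambda>i. \<Phi> (s i) r) \<circ> t) \<longlonglongrightarrow> l"
    using bounded_imp_convergent_subsequence by blast
  have "(\<lambda>i. \<Phi> ((s \<circ> t) i) r') \<longlonglongrightarrow> (\<phi>(r := l)) r'" if "r' \<in> insert r R" for r'
  proof (cases "r' = r")
    case False
    then show ?thesis
      using LIMSEQ_subseq_LIMSEQ[OF s(2) t(1), of r'] that by (simp add: o_def)
  qed (use t in \<open>simp add: o_def\<close>)
  then show ?case
    using strict_mono_o[OF s(1) t(1)] by (intro exI[of _ "s \<circ> t"] exI[of _ "\<phi>(r := l)"] conjI ballI)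
qed

section \<open>Combs with approximate periods\<close>

text \<open>A nonzero integer vector excludes only the \<open>w\<close> orthogonal to its
  combination of the \<open>g j\<close>, and countably many hyperplanes form a null set. Taking the
  vectors extensional on \<open>J\<close> makes them countable.\<close>

lemma integer_independent_generic_direction:
  fixes g :: "'j \<Rightarrow> 'v::euclidean_space"
  assumes "finite J" and indep: "\<And>k :: 'j \<Rightarrow> int. (\<Sum>j\<in>J. of_int (k j) *\<^sub>R g j) = 0 \<Longrightarrow> \<forall>j\<in>J. k j = 0"
  shows "\<exists>w. \<forall>k :: 'j \<Rightarrow> int. (\<Sum>j\<in>J. of_int (k j) * (g j \<bullet> w)) = 0 \<longrightarrow> (\<forall>j\<in>J. k j = 0)"
proof -
  define Z where "Z = (PiE J (\<lambda>_. UNIV :: int set)) - {k. \<forall>j\<in>J. k j = 0}"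
  have cZ: "countable Z" unfolding Z_def by (intro countable_Diff countable_PiE assms) auto
  have "negligible (\<Union>k\<in>Z. {w. (\<Sum>j\<in>J. of_int (k j) *\<^sub>R g j) \<bullet> w = 0})"
  proof (rule negligible_countable_Union)
    show "countable ((\<lambda>k. {w. (\<Sum>j\<in>J. of_int (k j) *\<^sub>R g j) \<bullet> w = 0}) ` Z)" using cZ by auto
    show "negligible S" if S: "S \<in> (\<lambda>k. {w. (\<Sum>j\<in>J. of_int (k j) *\<^sub>R g j) \<bullet> w = 0}) ` Z" for S
    proof -
      obtain k where k: "k \<in> Z" "S = {w. (\<Sum>j\<in>J. of_int (k j) *\<^sub>R g j) \<bullet> w = 0}" using S by blast
      have "(\<Sum>j\<in>J. of_int (k j) *\<^sub>R g j) \<noteq> 0"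
      proof
        assume "(\<Sum>j\<in>J. of_int (k j) *\<^sub>R g j) = 0"
        from indep[OF this] show False using k(1) by (simp add: Z_def)
      qed
      then show ?thesis unfolding k(2) by (intro negligible_hyperplane) simp
    qed
  qed
  then obtain w where w: "w \<notin> (\<Union>k\<in>Z. {w. (\<Sum>j\<in>J. of_int (k j) *\<^sub>R g j) \<bullet> w = 0})"
    using non_negligible_UNIV by (metis (no_types, lifting) UNIV_eq_I)
  have "\<forall>j\<in>J. k j = 0" if k: "(\<Sum>j\<in>J. of_int (k j) * (g j \<bullet> w)) = 0" for k :: "'j \<Rightarrow> int"
  proof (rule ccontr)
    assume "\<not> (\<forall>j\<in>J. k j = 0)"
    then have "restrict k J \<in> Z" by (auto simp: Z_def)
    moreover have "(\<Sum>j\<in>J. of_int (restrict k J j) *\<^sub>R g j) \<bullet> w = 0"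
      using k by (simp add: inner_sum_left)
    ultimately show False using w by blast
  qed
  then show ?thesis by blast
qed

text \<open>Along a generic direction \<open>w\<close> the flow has a single real time parameter and
  integer-independent speeds \<open>g j \<bullet> w\<close>, to which Kronecker's theorem
  applies.\<close>

lemma Kronecker_linear_flow:
  fixes g :: "'j \<Rightarrow> 'v::euclidean_space" and y :: "'j \<Rightarrow> real"
  assumes "finite J" and indep: "\<And>k :: 'j \<Rightarrow> int. (\<Sum>j\<in>J. of_int (k j) *\<^sub>R g j) = 0 \<Longrightarrow> \<forall>j\<in>J. k j = 0"
    and "\<epsilon> > 0"
  shows "\<exists>(c :: 'j \<Rightarrow> int) u. \<forall>j\<in>J. \<bar>of_int (c j) + g j \<bullet> u - y j\<bar> \<le> \<epsilon>"
proof -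
  obtain w where w: "\<And>k :: 'j \<Rightarrow> int. (\<Sum>j\<in>J. of_int (k j) * (g j \<bullet> w)) = 0 \<Longrightarrow> \<forall>j\<in>J. k j = 0"
    using integer_independent_generic_direction[of J g, OF assms(1) indep] by blast
  define n where "n = card J"
  obtain f where f: "bij_betw f {..<n} J"
    using ex_bij_betw_nat_finite[OF assms(1)] by (auto simp: n_def lessThan_atLeast0)
  define \<theta> where "\<theta> i = g (f i) \<bullet> w" for i
  \<comment> \<open>The reals as a module over the integers, so that \<open>independent\<close>
    means independence over the integers.\<close>
  interpret Modules.module "(\<lambda>r. (*) (real_of_int r))"
    by (simp add: Modules.module.intro distrib_left mult.commute)
  have key: "\<forall>i<n. k i = 0" if "(\<Sum>i<n. of_int (k i) * \<theta> i) = 0" for k :: "nat \<Rightarrow> int"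
  proof -
    define k' where "k' j = k (inv_into {..<n} f j)" for j
    have kf: "k' (f i) = k i" if "i < n" for i
      using bij_betw_inv_into_left[OF f, of i] that by (simp add: k'_def)
    have "(\<Sum>j\<in>J. of_int (k' j) * (g j \<bullet> w)) = (\<Sum>i<n. of_int (k i) * \<theta> i)"
      by (subst sum.reindex_bij_betw[OF f, symmetric]) (simp add: kf \<theta>_def)
    then have 0: "\<forall>j\<in>J. k' j = 0" using that w by simp
    have "f i \<in> J" if "i < n" for i using f that by (auto simp: bij_betw_def)
    then show ?thesis using kf 0 by metis
  qed
  have inj: "inj_on \<theta> {..<n}"
  proof (rule inj_onI, rule ccontr)
    fix i i' assume i: "i \<in> {..<n}" "i' \<in> {..<n}" "\<theta> i = \<theta> i'" "i \<noteq> i'"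
    define k :: "nat \<Rightarrow> int" where "k l = (if l = i then 1 else 0) - (if l = i' then 1 else 0)" for l
    have "(\<Sum>l<n. of_int (k l) * \<theta> l)
       = (\<Sum>l<n. if l = i then \<theta> l else 0) - (\<Sum>l<n. if l = i' then \<theta> l else 0)"
      unfolding sum_subtractf[symmetric] by (rule sum.cong) (auto simp: k_def)
    also have "\<dots> = 0" using i by simp
    finally have "k i = 0" using key i by blast
    then show False using i by (simp add: k_def)
  qed
  have ind: "independent (\<theta> ` {..<n})"
  proof
    assume "dependent (\<theta> ` {..<n})"
    then obtain u where u: "\<exists>v\<in>\<theta> ` {..<n}. u v \<noteq> 0" "(\<Sum>v\<in>\<theta> ` {..<n}. of_int (u v) * v) = 0"
      by (subst (asm) dependent_finite) auto
    have "(\<Sum>i<n. of_int (u (\<theta> i)) * \<theta> i) = 0"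
      using u(2) by (simp add: sum.reindex[OF inj])
    from key[OF this] show False using u(1) by auto
  qed
  obtain t h where th: "\<And>i. i < n \<Longrightarrow> \<bar>t * \<theta> i - of_int (h i) - y (f i)\<bar> < \<epsilon>"
    using Kronecker_thm_1[OF ind inj assms(3), of "\<lambda>i. y (f i)"] by metis
  show ?thesis
  proof (intro exI ballI)
    fix j assume "j \<in> J"
    then obtain i where i: "i < n" "j = f i" using f by (auto simp: bij_betw_def)
    have "inv_into {..<n} f j = i" using f i bij_betw_inv_into_left[of f] by simp
    then show "\<bar>of_int (- h (inv_into {..<n} f j)) + g j \<bullet> (t *\<^sub>R w) - y j\<bar> \<le> \<epsilon>"
      using th[OF i(1)] i(2) by (simp add: \<theta>_def)
  qed
qed

text \<open>The axioms describe a cut and project scheme. The integers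
  \<open>a j \<bullet> d + b d j\<close> are the coordinates of \<open>d\<close> in the basis
  \<open>g\<close>: by \<open>a_g\<close> their linear part alone gives back \<open>d\<close>, while
  by \<open>b_g\<close> their bounded part lies in the internal space and contributes nothing to
  \<open>d\<close>. \<open>N\<close> stands for the masses of the atoms, \<open>\<omega>\<close> for
  the weights of the exponential sums that tend to them.\<close>

locale almost_periodic_comb =
  fixes J :: "'j set" and g a :: "'j \<Rightarrow> 'v::euclidean_space" and b :: "'v \<Rightarrow> 'j \<Rightarrow> real"
    and D :: "'v set" and X :: "nat \<Rightarrow> 'v set" and \<omega> :: "nat \<Rightarrow> 'v \<Rightarrow> complex"
    and N :: "'v \<Rightarrow> complex" and B C :: real
  assumes finite_J: "finite J"
    and int: "\<And>d j. d \<in> D \<Longrightarrow> j \<in> J \<Longrightarrow> a j \<bullet> d + b d j \<in> \<int>"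
    and b_bound: "\<And>d j. d \<in> D \<Longrightarrow> j \<in> J \<Longrightarrow> \<bar>b d j\<bar> \<le> B"
    and b_g: "\<And>d. d \<in> D \<Longrightarrow> (\<Sum>j\<in>J. b d j *\<^sub>R g j) = 0"
    and a_g: "\<And>x. (\<Sum>j\<in>J. (a j \<bullet> x) *\<^sub>R g j) = x"
    and indep: "\<And>k :: 'j \<Rightarrow> int. (\<Sum>j\<in>J. of_int (k j) *\<^sub>R g j) = 0 \<Longrightarrow> \<forall>j\<in>J. k j = 0"
    and X_sub: "\<And>i. X i \<subseteq> D" and finite_X: "\<And>i. finite (X i)"
    and mass: "\<And>i. (\<Sum>d\<in>X i. cmod (\<omega> i d)) \<le> C"
    and lim: "\<And>x. (\<lambda>i. \<Sum>d\<in>X i. \<omega> i d * unit_char (- (d \<bullet> x))) \<longlonglongrightarrow> N x"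
    and discrete: "\<And>S. bounded S \<Longrightarrow> finite (S \<inter> {x. N x \<noteq> 0})"
begin

text \<open>\<open>F x\<close> interpolates \<open>N\<close> along its approximate periods \<open>a j\<close>: at an integer vector \<open>c\<close> it tends to
  \<open>N (x + \<Sum>\<^sub>j c\<^sub>j a\<^sub>j)\<close>, and it is invariant under the flow \<open>y\<^sub>j \<mapsto> y\<^sub>j + g\<^sub>j \<bullet> u\<close>, whose orbit of the
  integer vectors is dense.\<close>
definition F :: "'v \<Rightarrow> ('j \<Rightarrow> real) \<Rightarrow> nat \<Rightarrow> complex" where
  "F x y i = (\<Sum>d\<in>X i. \<omega> i d * unit_char (- (d \<bullet> x)) * unit_char (\<Sum>j\<in>J. y j * b d j))"

lemma C_nonneg: "0 \<le> C"
  using mass[of 0] by (meson norm_ge_zero order_trans sum_nonneg)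

lemma F_lim: "F x (\<lambda>_. 0) \<longlonglongrightarrow> N x"
  using lim[of x] by (simp add: F_def[abs_def])

text \<open>An integer combination of the integers \<open>a j \<bullet> d + b d j\<close> has
  trivial character, so a shift by \<open>c\<close> in the \<open>b\<close>-part can be traded for a
  shift of \<open>x\<close> in the \<open>a\<close>-part.\<close>

lemma F_integer_shift:
  fixes c :: "'j \<Rightarrow> int"
  shows "F x (\<lambda>j. y j + of_int (c j)) i = F (x + (\<Sum>j\<in>J. of_int (c j) *\<^sub>R a j)) y i"
  unfolding F_def
proof (rule sum.cong[OF refl])
  fix d assume "d \<in> X i"
  then have d: "d \<in> D" using X_sub by auto
  have "(\<Sum>j\<in>J. of_int (c j) * (a j \<bullet> d + b d j)) \<in> \<int>"
    by (intro Ints_sum Ints_mult int d Ints_of_int)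
  then have 1: "unit_char (\<Sum>j\<in>J. of_int (c j) * (a j \<bullet> d + b d j)) = 1" by (rule unit_char_Ints)
  have e1: "(\<Sum>j\<in>J. (y j + of_int (c j)) * b d j) = (\<Sum>j\<in>J. y j * b d j) + (\<Sum>j\<in>J. of_int (c j) * b d j)"
    by (simp add: sum.distrib distrib_right)
  have e2: "- (d \<bullet> (x + (\<Sum>j\<in>J. of_int (c j) *\<^sub>R a j))) + (\<Sum>j\<in>J. of_int (c j) * (a j \<bullet> d + b d j))
     = - (d \<bullet> x) + (\<Sum>j\<in>J. of_int (c j) * b d j)"
    by (simp add: inner_add_right inner_sum_right sum.distrib distrib_left inner_commute)
  have "unit_char (- (d \<bullet> x)) * unit_char (\<Sum>j\<in>J. of_int (c j) * b d j)
     = unit_char (- (d \<bullet> (x + (\<Sum>j\<in>J. of_int (c j) *\<^sub>R a j))))"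
    unfolding unit_char_add[symmetric] e2[symmetric] unfolding unit_char_add 1 by simp
  then show "\<omega> i d * unit_char (- (d \<bullet> x)) * unit_char (\<Sum>j\<in>J. (y j + of_int (c j)) * b d j)
    = \<omega> i d * unit_char (- (d \<bullet> (x + (\<Sum>j\<in>J. of_int (c j) *\<^sub>R a j)))) * unit_char (\<Sum>j\<in>J. y j * b d j)"
    unfolding e1 unit_char_add by (simp add: mult_ac)
qed

lemma F_flow_invariant: "F x (\<lambda>j. y j + g j \<bullet> u) i = F x y i"
  unfolding F_def
proof (rule sum.cong[OF refl])
  fix d assume "d \<in> X i"
  then have "d \<in> D" using X_sub by auto
  have "(\<Sum>j\<in>J. (y j + g j \<bullet> u) * b d j) = (\<Sum>j\<in>J. y j * b d j) + (\<Sum>j\<in>J. b d j *\<^sub>R g j) \<bullet> u"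
    by (simp add: inner_sum_left algebra_simps flip: sum.distrib)
  then show "\<omega> i d * unit_char (- (d \<bullet> x)) * unit_char (\<Sum>j\<in>J. (y j + g j \<bullet> u) * b d j)
    = \<omega> i d * unit_char (- (d \<bullet> x)) * unit_char (\<Sum>j\<in>J. y j * b d j)"
    using b_g[OF \<open>d \<in> D\<close>] by simp
qed

lemma F_integer_lim:
  fixes c :: "'j \<Rightarrow> int"
  shows "F x (\<lambda>j. of_int (c j) + g j \<bullet> u) \<longlonglongrightarrow> N (x + (\<Sum>j\<in>J. of_int (c j) *\<^sub>R a j))"
proof -
  have "F x (\<lambda>j. of_int (c j) + g j \<bullet> u) = F (x + (\<Sum>j\<in>J. of_int (c j) *\<^sub>R a j)) (\<lambda>_. 0)"
    using F_integer_shift[of x "\<lambda>_. 0" c] by (intro ext) (simp add: F_flow_invariant)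
  then show ?thesis using F_lim by simp
qed

lemma g_a: "(\<Sum>j\<in>J. (g j \<bullet> u) *\<^sub>R a j) = u"
proof (rule vector_eq_ldot[THEN iffD1], rule allI)
  fix x
  have "x \<bullet> (\<Sum>j\<in>J. (g j \<bullet> u) *\<^sub>R a j) = (\<Sum>j\<in>J. (a j \<bullet> x) *\<^sub>R g j) \<bullet> u"
    by (simp add: inner_sum_left inner_sum_right inner_commute mult.commute)
  then show "x \<bullet> (\<Sum>j\<in>J. (g j \<bullet> u) *\<^sub>R a j) = x \<bullet> u" by (simp add: a_g)
qed

text \<open>Kronecker's theorem gives a pair \<open>(c, u)\<close> for each target separately; a
  finite grid of mesh below \<open>\<eta> / 2\<close> makes the bound on \<open>u\<close>
  uniform.\<close>

lemma compact_net_unit_cube: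
  assumes "\<eta> > 0"
  shows "\<exists>r. \<forall>y. (\<forall>j\<in>J. 0 \<le> y j \<and> y j \<le> 1) \<longrightarrow>
     (\<exists>(c :: 'j \<Rightarrow> int) u. norm u \<le> r \<and> (\<forall>j\<in>J. \<bar>of_int (c j) + g j \<bullet> u - y j\<bar> \<le> \<eta>))"
proof -
  obtain M :: nat where M: "1 / real (Suc M) < \<eta> / 2" using assms nat_approx_posE half_gt_zero by metis
  define P where "P = PiE J (\<lambda>_. {..Suc M})"
  have finP: "finite P" unfolding P_def by (intro finite_PiE finite_J) auto
  have "\<forall>p. \<exists>c u. \<forall>j\<in>J. \<bar>of_int (c j) + g j \<bullet> u - real (p j) / Suc M\<bar> \<le> \<eta>/2" for p :: "'j \<Rightarrow> nat"
    by (rule allI, rule Kronecker_linear_flow[OF finite_J indep]) (use assms in auto)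
  then obtain c u where cu: "\<And>p j. j \<in> J \<Longrightarrow> \<bar>of_int (c p j) + g j \<bullet> u p - real (p j) / Suc M\<bar> \<le> \<eta>/2"
    by metis
  define r where "r = (\<Sum>p\<in>P. norm (u p))"
  show ?thesis
  proof (intro exI[of _ r] allI impI)
    fix y assume y: "\<forall>j\<in>J. 0 \<le> y j \<and> y j \<le> (1::real)"
    define p where "p = restrict (\<lambda>j. nat \<lfloor>y j * Suc M\<rfloor>) J"
    have p: "\<bar>real (p j) / Suc M - y j\<bar> \<le> \<eta>/2" "p j \<le> Suc M" if "j \<in> J" for j
    proof -
      have y0: "0 \<le> y j * Suc M" "y j * Suc M \<le> Suc M" using y that by (auto simp: mult_le_cancel_right1)
      have "real (p j) = of_int \<lfloor>y j * Suc M\<rfloor>" using y0 that by (simp add: p_def)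
      then have "\<bar>real (p j) - y j * Suc M\<bar> \<le> 1" "real (p j) \<le> Suc M" using y0(2) by linarith+
      then have "\<bar>real (p j) - y j * Suc M\<bar> / Suc M \<le> 1 / Suc M" by (intro divide_right_mono) auto
      moreover have "\<bar>real (p j) - y j * Suc M\<bar> / Suc M = \<bar>real (p j) / Suc M - y j\<bar>"
        by (simp add: field_simps flip: abs_mult) 
      ultimately show "\<bar>real (p j) / Suc M - y j\<bar> \<le> \<eta>/2" using M by linarith
      show "p j \<le> Suc M" using \<open>real (p j) \<le> Suc M\<close> by simp
    qed
    then have "p \<in> P" by (auto simp: P_def p_def)
    then have "norm (u p) \<le> r" unfolding r_def by (intro member_le_sum finP) auto
    moreover have "\<bar>of_int (c p j) + g j \<bullet> u p - y j\<bar> \<le> \<eta>" if "j \<in> J" for j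
      using cu[OF that, of p] p[OF that] by linarith
    ultimately show "\<exists>c u. norm u \<le> r \<and> (\<forall>j\<in>J. \<bar>of_int (c j) + g j \<bullet> u - y j\<bar> \<le> \<eta>)" by blast
  qed
qed

text \<open>The mesh \<open>\<eta>\<close> is for the Bernstein inequality. The radius
  \<open>r\<close>, uniform in \<open>y\<close>, ensures that only the atoms within \<open>r\<close>
  of \<open>x\<close> influence \<open>F x\<close> on the net.\<close>

lemma net:
  assumes "\<eta> > 0"
  shows "\<exists>r. \<forall>y. \<exists>(c :: 'j \<Rightarrow> int) u. norm (\<Sum>j\<in>J. of_int (c j) *\<^sub>R a j) \<le> r \<and>
      (\<forall>j\<in>J. \<bar>of_int (c j) + g j \<bullet> u - y j\<bar> \<le> \<eta>)"
proof -
  obtain r where r: "\<And>y. (\<forall>j\<in>J. 0 \<le> y j \<and> y j \<le> 1) \<Longrightarrow>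
     (\<exists>(c :: 'j \<Rightarrow> int) u. norm u \<le> r \<and> (\<forall>j\<in>J. \<bar>of_int (c j) + g j \<bullet> u - y j\<bar> \<le> \<eta>))"
    using compact_net_unit_cube[OF assms] by auto
  define r' where "r' = r + (\<Sum>j\<in>J. \<eta> * norm (a j))"
  show ?thesis
  proof (intro exI[of _ r'] allI)
    fix y :: "'j \<Rightarrow> real"
    \<comment> \<open>Flowing back by \<open>u0\<close> removes the component along the flow:
      \<open>(\<Sum>j\<in>J. y' j *\<^sub>R a j) = 0\<close> by \<open>g_a\<close>. So the
      combination of the \<open>a j\<close> with coefficients \<open>c'\<close> consists of rounding
      errors and \<open>u\<close> only.\<close>
    define u0 where "u0 = (\<Sum>j\<in>J. y j *\<^sub>R a j)"
    define y' where "y' j = y j - g j \<bullet> u0" for j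
    obtain c u where cu: "norm u \<le> r" "\<forall>j\<in>J. \<bar>of_int (c j) + g j \<bullet> u - frac (y' j)\<bar> \<le> \<eta>"
      using r[of "\<lambda>j. frac (y' j)"] by (auto simp: frac_ge_0 frac_lt_1 less_imp_le)
    define c' where "c' j = c j + \<lfloor>y' j\<rfloor>" for j
    have c': "\<bar>of_int (c' j) + g j \<bullet> u - y' j\<bar> \<le> \<eta>" if "j \<in> J" for j
      using cu(2) that by (simp add: c'_def frac_def algebra_simps)
    have "(\<Sum>j\<in>J. (of_int (c' j) + g j \<bullet> u - y' j) *\<^sub>R a j)
       = (\<Sum>j\<in>J. of_int (c' j) *\<^sub>R a j) + (\<Sum>j\<in>J. (g j \<bullet> u) *\<^sub>R a j)
          - (\<Sum>j\<in>J. y j *\<^sub>R a j) + (\<Sum>j\<in>J. (g j \<bullet> u0) *\<^sub>R a j)"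
      by (simp add: y'_def scaleR_add_left scaleR_diff_left sum.distrib sum_subtractf)
    then have eq: "(\<Sum>j\<in>J. of_int (c' j) *\<^sub>R a j) = (\<Sum>j\<in>J. (of_int (c' j) + g j \<bullet> u - y' j) *\<^sub>R a j) - u"
      by (simp add: g_a flip: u0_def)
    have "norm (\<Sum>j\<in>J. (of_int (c' j) + g j \<bullet> u - y' j) *\<^sub>R a j) \<le> (\<Sum>j\<in>J. \<eta> * norm (a j))"
      by (rule sum_norm_le) (use c' in \<open>auto intro!: mult_right_mono\<close>)
    then have "norm (\<Sum>j\<in>J. of_int (c' j) *\<^sub>R a j) \<le> r'"
      unfolding eq r'_def using cu(1) norm_triangle_ineq4 by (smt (verit))
    moreover have "\<bar>of_int (c' j) + g j \<bullet> (u + u0) - y j\<bar> \<le> \<eta>" if "j \<in> J" for j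
      using c'[OF that] by (simp add: y'_def inner_add_right algebra_simps)
    ultimately show "\<exists>c u. norm (\<Sum>j\<in>J. of_int (c j) *\<^sub>R a j) \<le> r' \<and>
      (\<forall>j\<in>J. \<bar>of_int (c j) + g j \<bullet> u - y j\<bar> \<le> \<eta>)" by blast
  qed
qed

end

section \<open>Rigidity forced by the discreteness of the support\<close>

context almost_periodic_comb
begin

text \<open>A slope \<open>l\<close> that is constant along the flow \<open>g\<close> and vanishes on the relations between the
  \<open>a j\<close> gives a function \<open>y \<mapsto> l \<cdot> y\<close> that, on the \<open>\<eta>\<close>-net of points at which \<open>F\<close> takes the value of
  a nearby atom, has finitely many values \<open>Q\<close>. A trigonometric polynomial of small degree \<open>\<kappa>\<close> times
  \<open>card Q\<close> that vanishes on \<open>Q\<close> makes \<open>F\<close> vanish on the whole net.\<close>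
lemma no_slope:
  fixes l :: "'j \<Rightarrow> real"
  assumes l_g: "(\<Sum>j\<in>J. l j *\<^sub>R g j) = 0"
    and l_rel: "\<And>c :: 'j \<Rightarrow> int. (\<Sum>j\<in>J. of_int (c j) *\<^sub>R a j) = 0 \<Longrightarrow> (\<Sum>j\<in>J. l j * of_int (c j)) = 0"
    and j0: "j0 \<in> J" "l j0 \<noteq> 0"
  shows "N x = 0"
proof -
  define B' where "B' = max B 0"
  \<comment> \<open>With \<open>card J\<close> coordinates and frequencies at most
    \<open>B' + 1\<close>, this mesh keeps the phase change within the window 1/8 of the Bernstein
    inequality. The 1 in \<open>B' + 1\<close> is reserved for the polynomial
    \<open>p\<close>.\<close>
  define \<eta> where "\<eta> = 1 / (16 * pi * (B' + 1) * (real (card J) + 1))"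
  define l1 where "l1 = (\<Sum>j\<in>J. \<bar>l j\<bar>)"
  have B': "B' \<ge> 0" "B \<le> B'" by (auto simp: B'_def)
  have "\<eta> > 0" using B' by (simp add: \<eta>_def)
  have l1: "\<bar>l j\<bar> \<le> l1" if "j \<in> J" for j
    unfolding l1_def by (rule member_le_sum) (use that finite_J in auto)
  then have "l1 \<ge> 0" using j0 by fastforce
  obtain r where r: "\<And>y. \<exists>(c :: 'j \<Rightarrow> int) u. norm (\<Sum>j\<in>J. of_int (c j) *\<^sub>R a j) \<le> r \<and>
      (\<forall>j\<in>J. \<bar>of_int (c j) + g j \<bullet> u - y j\<bar> \<le> \<eta>)"
    using net[OF \<open>\<eta> > 0\<close>] by blast
  define A where "A c = (\<Sum>j\<in>J. of_int (c j) *\<^sub>R a j)" for c :: "'j \<Rightarrow> int"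
  define sl where "sl c = (\<Sum>j\<in>J. l j * of_int (c j))" for c :: "'j \<Rightarrow> int"
  define Q where "Q = sl ` {c. norm (A c) \<le> r \<and> N (x + A c) \<noteq> 0}"
  \<comment> \<open>By \<open>l_rel\<close> the slope depends on the point \<open>A c\<close> only,
    so \<open>Q\<close> has no more elements than there are atoms in a ball of radius
    \<open>r\<close>.\<close>
  have sl_A: "sl c = sl c'" if "A c = A c'" for c c'
  proof -
    have "(\<Sum>j\<in>J. of_int (c j - c' j) *\<^sub>R a j) = 0"
      using that by (simp add: A_def scaleR_diff_left sum_subtractf)
    from l_rel[OF this] show ?thesis by (simp add: sl_def right_diff_distrib sum_subtractf)
  qed
  have finQ: "finite Q"
  proof -
    have "finite (cball x r \<inter> {x. N x \<noteq> 0})" by (rule discrete) auto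
    then have "finite ((\<lambda>v. sl (SOME c. x + A c = v)) ` (cball x r \<inter> {x. N x \<noteq> 0}))" by (rule finite_imageI)
    moreover have "Q \<subseteq> (\<lambda>v. sl (SOME c. x + A c = v)) ` (cball x r \<inter> {x. N x \<noteq> 0})"
    proof
      fix q assume "q \<in> Q"
      then obtain c where c: "q = sl c" "norm (A c) \<le> r" "N (x + A c) \<noteq> 0" by (auto simp: Q_def)
      have "x + A (SOME c'. x + A c' = x + A c) = x + A c" by (rule someI[of "\<lambda>c'. x + A c' = x + A c" c]) (rule refl)
      then have "q = sl (SOME c'. x + A c' = x + A c)" unfolding c(1) by (intro sl_A) simp
      moreover have "x + A c \<in> cball x r \<inter> {x. N x \<noteq> 0}" using c by (simp add: dist_norm)
      ultimately show "q \<in> (\<lambda>v. sl (SOME c. x + A c = v)) ` (cball x r \<inter> {x. N x \<noteq> 0})" by blast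
    qed
    ultimately show ?thesis by (rule finite_subset[rotated])
  qed
  \<comment> \<open>Chosen after \<open>Q\<close>, so that
    \<open>card Q * \<kappa> * \<bar>l j\<bar> \<le> 1\<close>: multiplication by \<open>p\<close>
    adds at most 1 to the bandwidth, however many zeros are prescribed.\<close>
  define \<kappa> where "\<kappa> = 1 / ((real (card Q) + 1) * (l1 + 1))"
  have "\<kappa> > 0" using \<open>l1 \<ge> 0\<close> by (simp add: \<kappa>_def)
  define p where "p = (\<Prod>q\<in>Q. [:- unit_char (\<kappa> * q), 1:])"
  have p0: "p \<noteq> 0" unfolding p_def by (simp add: prod_zero_iff finQ)
  have degp: "degree p \<le> card Q"
    unfolding p_def using degree_prod_sum_le[OF finQ, of "\<lambda>q. [:- unit_char (\<kappa> * q), 1:]"] by simp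
  have proot: "poly p (unit_char (\<kappa> * q)) = 0" if "q \<in> Q" for q
    unfolding p_def poly_prod using that finQ by (intro prod_zero) auto
  \<comment> \<open>Expanding \<open>p\<close> turns the product of \<open>F x y\<close> with the
    polynomial into a single exponential sum over pairs \<open>(d, k)\<close> with frequencies
    \<open>\<beta>\<close>.\<close>
  define I where "I i = X i \<times> {..degree p}" for i
  define h where "h i s = \<omega> i (fst s) * unit_char (- (fst s \<bullet> x)) * coeff p (snd s)" for i s
  define \<beta> where "\<beta> s j = b (fst s) j + real (snd s) * \<kappa> * l j" for s j
  have f: "(\<Sum>s\<in>I i. h i s * unit_char (\<Sum>j\<in>J. y j * \<beta> s j))
     = F x y i * poly p (unit_char (\<kappa> * (\<Sum>j\<in>J. y j * l j)))" for y i
  proof -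
    have e: "(\<Sum>j\<in>J. y j * \<beta> (d,k) j) = (\<Sum>j\<in>J. y j * b d j) + real k * (\<kappa> * (\<Sum>j\<in>J. y j * l j))" for d k
      by (simp add: \<beta>_def sum_distrib_left algebra_simps flip: sum.distrib)
    have "(\<Sum>s\<in>I i. h i s * unit_char (\<Sum>j\<in>J. y j * \<beta> s j))
      = (\<Sum>d\<in>X i. \<Sum>k\<le>degree p. h i (d,k) * unit_char (\<Sum>j\<in>J. y j * \<beta> (d,k) j))"
      unfolding I_def by (simp add: sum.cartesian_product)
    also have "\<dots> = (\<Sum>d\<in>X i. \<Sum>k\<le>degree p. (\<omega> i d * unit_char (- (d \<bullet> x)) * unit_char (\<Sum>j\<in>J. y j * b d j)) *
        (coeff p k * unit_char (\<kappa> * (\<Sum>j\<in>J. y j * l j)) ^ k))"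
      unfolding e h_def unit_char_add unit_char_of_nat_mult by (simp add: mult_ac)
    also have "\<dots> = F x y i * poly p (unit_char (\<kappa> * (\<Sum>j\<in>J. y j * l j)))"
      unfolding F_def poly_altdef sum_product ..
    finally show ?thesis .
  qed
  have vanish: "(\<lambda>i. \<Sum>s\<in>I i. h i s * unit_char (\<Sum>j\<in>J. y j * \<beta> s j)) \<longlonglongrightarrow> 0" for y
  proof (rule tendsto_zero_of_zeros_on_net)
    fix i
    have "(\<Sum>s\<in>I i. cmod (h i s)) = (\<Sum>d\<in>X i. cmod (\<omega> i d)) * (\<Sum>k\<le>degree p. cmod (coeff p k))"
      unfolding I_def h_def sum_product by (simp add: sum.cartesian_product norm_mult case_prod_unfold)
    also have "\<dots> \<le> C * (\<Sum>k\<le>degree p. cmod (coeff p k))"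
      by (intro mult_right_mono mass sum_nonneg) auto
    finally show "(\<Sum>s\<in>I i. cmod (h i s)) \<le> C * (\<Sum>k\<le>degree p. cmod (coeff p k))" .
  next
    fix y
    obtain c u where cu: "norm (A c) \<le> r" "\<And>j. j \<in> J \<Longrightarrow> \<bar>of_int (c j) + g j \<bullet> u - y j\<bar> \<le> \<eta>"
      using r[of y] unfolding A_def by blast
    define y' where "y' j = of_int (c j) + g j \<bullet> u" for j
    have "(\<Sum>j\<in>J. y' j * l j) = sl c + (\<Sum>j\<in>J. l j *\<^sub>R g j) \<bullet> u"
      by (simp add: y'_def sl_def inner_sum_left algebra_simps flip: sum.distrib)
    then have sl: "(\<Sum>j\<in>J. y' j * l j) = sl c" by (simp add: l_g)
    have "(\<lambda>i. F x y' i * poly p (unit_char (\<kappa> * sl c))) \<longlonglongrightarrow> N (x + A c) * poly p (unit_char (\<kappa> * sl c))"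
      unfolding y'_def A_def by (intro tendsto_intros F_integer_lim)
    also have "N (x + A c) * poly p (unit_char (\<kappa> * sl c)) = 0"
      using proot[of "sl c"] cu(1) by (cases "N (x + A c) = 0") (auto simp: Q_def)
    finally have lim0: "(\<lambda>i. \<Sum>s\<in>I i. h i s * unit_char (\<Sum>j\<in>J. y' j * \<beta> s j)) \<longlonglongrightarrow> 0"
      unfolding f sl .
    have "\<bar>2 * pi * (\<Sum>j\<in>J. (y' j - y j) * \<beta> s j)\<bar> \<le> 1/8" if s: "s \<in> I i" for i s
    proof -
      obtain d k where dk: "s = (d,k)" "d \<in> D" "k \<le> card Q"
        using s degp subsetD[OF X_sub] by (cases s) (auto simp: I_def)
      have beta: "\<bar>\<beta> s j\<bar> \<le> B' + 1" if "j \<in> J" for j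
      proof -
        have "real k * \<kappa> * \<bar>l j\<bar> \<le> (real (card Q) + 1) * \<kappa> * (l1 + 1)"
          using dk l1[OF that] \<open>\<kappa> > 0\<close> \<open>l1 \<ge> 0\<close> by (intro mult_mono) auto
        also have "\<dots> = 1" using \<open>l1 \<ge> 0\<close> by (simp add: \<kappa>_def)
        finally have "\<bar>real k * \<kappa> * l j\<bar> \<le> 1" using \<open>\<kappa> > 0\<close> by (simp add: abs_mult)
        then show ?thesis using b_bound[OF dk(2) that] B'(2) by (simp add: \<beta>_def dk(1))
      qed
      have "\<bar>\<Sum>j\<in>J. (y' j - y j) * \<beta> s j\<bar> \<le> (\<Sum>j\<in>J. \<bar>(y' j - y j) * \<beta> s j\<bar>)" by (rule sum_abs)
      also have "\<dots> \<le> (\<Sum>j\<in>J. \<eta> * (B' + 1))"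
        using cu(2) beta \<open>\<eta> > 0\<close> by (intro sum_mono) (auto simp: abs_mult y'_def intro!: mult_mono)
      also have "\<dots> \<le> (real (card J) + 1) * \<eta> * (B' + 1)"
        using \<open>\<eta> > 0\<close> B'(1) by (simp add: algebra_simps)
      also have "\<dots> = 1 / (16 * pi)"
      proof -
        have "real (card J) + 1 \<noteq> 0" "B' + 1 \<noteq> 0" using B'(1) by auto
        then show ?thesis unfolding \<eta>_def by (simp add: divide_simps)
      qed
      finally show ?thesis by (simp add: abs_mult field_simps)
    qed
    with lim0 show "\<exists>y'. (\<lambda>i. \<Sum>s\<in>I i. h i s * unit_char (\<Sum>j\<in>J. y' j * \<beta> s j)) \<longlonglongrightarrow> 0 \<and>
        (\<forall>i. \<forall>s\<in>I i. \<bar>2 * pi * (\<Sum>j\<in>J. (y' j - y j) * \<beta> s j)\<bar> \<le> 1/8)" by blast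
  qed
  \<comment> \<open>If \<open>N x\<close> is nonzero then slope 0 belongs to \<open>Q\<close>, so
    the polynomial itself vanishes at \<open>y = 0\<close>. Therefore \<open>F x\<close> is examined
    at \<open>y j = t * l j\<close> for small \<open>t > 0\<close>, where the slope is
    \<open>t * l2\<close>.\<close>
  define l2 where "l2 = (\<Sum>j\<in>J. l j * l j)"
  have "l2 > 0" unfolding l2_def
    by (rule sum_pos2[OF finite_J j0(1)]) (use j0 in \<open>auto simp: zero_less_mult_iff\<close>)
  have near: "cmod (N x) \<le> t * (C * (2 * pi * (B' * l1)))"
    if t: "t > 0" "poly p (unit_char (\<kappa> * (t * l2))) \<noteq> 0" for t
  proof -
    let ?y = "\<lambda>j. t * l j"
    have eq: "(\<Sum>j\<in>J. t * l j * l j) = t * l2" by (simp add: l2_def sum_distrib_left mult.assoc)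
    have "(\<lambda>i. F x ?y i * poly p (unit_char (\<kappa> * (t * l2))) / poly p (unit_char (\<kappa> * (t * l2)))) \<longlonglongrightarrow>
        0 / poly p (unit_char (\<kappa> * (t * l2)))"
      using vanish[of ?y] t(2) unfolding f eq by (intro tendsto_intros) auto
    then have "F x ?y \<longlonglongrightarrow> 0" using t(2) by simp
    from tendsto_diff[OF F_lim[of x] this]
    have lim: "(\<lambda>i. F x (\<lambda>_. 0) i - F x ?y i) \<longlonglongrightarrow> N x" by simp
    have "cmod (F x (\<lambda>_. 0) i - F x ?y i) \<le> t * (C * (2 * pi * (B' * l1)))" for i
    proof -
      have "cmod (F x (\<lambda>_. 0) i - F x ?y i)
          = cmod (\<Sum>d\<in>X i. \<omega> i d * unit_char (- (d \<bullet> x)) * (unit_char 0 - unit_char (\<Sum>j\<in>J. ?y j * b d j)))"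
        by (simp add: F_def sum_subtractf algebra_simps)
      also have "\<dots> \<le> (\<Sum>d\<in>X i. cmod (\<omega> i d) * (2 * pi * (t * (B' * l1))))"
      proof (rule sum_norm_le)
        fix d assume "d \<in> X i"
        then have d: "d \<in> D" using X_sub by auto
        have "\<bar>\<Sum>j\<in>J. ?y j * b d j\<bar> \<le> (\<Sum>j\<in>J. \<bar>?y j * b d j\<bar>)" by (rule sum_abs)
        also have "\<dots> \<le> (\<Sum>j\<in>J. t * \<bar>l j\<bar> * B')"
        proof (rule sum_mono)
          fix j assume "j \<in> J"
          then have "\<bar>b d j\<bar> \<le> B'" using b_bound[OF d] B'(2) by force
          then show "\<bar>?y j * b d j\<bar> \<le> t * \<bar>l j\<bar> * B'"
            using t(1) by (simp add: abs_mult mult_left_mono)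
        qed
        also have "\<dots> = t * (B' * l1)"
          by (simp add: l1_def sum_distrib_left mult_ac)
        finally have "cmod (unit_char 0 - unit_char (\<Sum>j\<in>J. ?y j * b d j)) \<le> 2 * pi * (t * (B' * l1))"
          using norm_unit_char_diff[of 0 "\<Sum>j\<in>J. ?y j * b d j"]
          by (smt (verit, ccfv_SIG) abs_minus_commute diff_zero mult_left_mono pi_ge_zero)
        then show "cmod (\<omega> i d * unit_char (- (d \<bullet> x)) * (unit_char 0 - unit_char (\<Sum>j\<in>J. ?y j * b d j)))
          \<le> cmod (\<omega> i d) * (2 * pi * (t * (B' * l1)))"
          unfolding norm_mult norm_unit_char mult_1_right by (intro mult_left_mono) auto
      qed
      also have "\<dots> \<le> C * (2 * pi * (t * (B' * l1)))"
        unfolding sum_distrib_right[symmetric] using B'(1) \<open>l1 \<ge> 0\<close> t(1) by (intro mult_right_mono mass) auto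
      finally show ?thesis by (simp add: mult_ac)
    qed
    then show ?thesis by (intro tendsto_upperbound[OF tendsto_norm[OF lim]] always_eventually) auto
  qed
  show "N x = 0"
  proof (rule ccontr)
    assume "N x \<noteq> 0"
    define M where "M = C * (2 * pi * (B' * l1)) + 1"
    have "C * (2 * pi * (B' * l1)) \<ge> 0" using C_nonneg B'(1) \<open>l1 \<ge> 0\<close> by simp
    then have M: "M > 0" unfolding M_def by linarith
    \<comment> \<open>Below \<open>1 / (\<kappa> * l2)\<close> distinct \<open>t\<close> give
      distinct characters, so some \<open>t\<close> avoids the finitely many roots of
      \<open>p\<close>; below \<open>cmod (N x) / M\<close> the Lipschitz estimate
      \<open>near\<close> contradicts the size of \<open>N x\<close>.\<close>
    define t0 where "t0 = min (cmod (N x) / M) (1 / (\<kappa> * l2))"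
    have t0: "t0 > 0" using M \<open>N x \<noteq> 0\<close> \<open>\<kappa> > 0\<close> \<open>l2 > 0\<close> by (simp add: t0_def)
    have "inj_on (\<lambda>t. unit_char (\<kappa> * (t * l2))) {0<..<t0}"
    proof (rule inj_onI)
      fix s t assume st: "s \<in> {0<..<t0}" "t \<in> {0<..<t0}" "unit_char (\<kappa> * (s * l2)) = unit_char (\<kappa> * (t * l2))"
      have rng: "\<kappa> * (t * l2) \<in> {0..<1}" if "t \<in> {0<..<t0}" for t
      proof -
        have "t < 1 / (\<kappa> * l2)" using that by (simp add: t0_def)
        then have "t * (\<kappa> * l2) < 1" using \<open>\<kappa> > 0\<close> \<open>l2 > 0\<close> by (simp add: field_simps)
        then show ?thesis using that \<open>\<kappa> > 0\<close> \<open>l2 > 0\<close> by (simp add: mult_ac)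
      qed
      obtain k :: int where "2 * pi * (\<kappa> * (s * l2)) = 2 * pi * (\<kappa> * (t * l2)) + 2 * pi * k"
        using st(3) sin_cos_eq_iff[of "2 * pi * (\<kappa> * (s * l2))" "2 * pi * (\<kappa> * (t * l2))"]
        by (auto simp: unit_char_def complex_eq_iff)
      then have "2 * pi * (\<kappa> * (s * l2)) = 2 * pi * (\<kappa> * (t * l2) + k)" by (simp add: ring_distribs)
      then have k: "\<kappa> * (s * l2) = \<kappa> * (t * l2) + k" by simp
      then have "\<bar>of_int k :: real\<bar> < 1" using rng[OF st(1)] rng[OF st(2)] by auto
      then have "k = 0" by linarith
      with k show "s = t" using \<open>\<kappa> > 0\<close> \<open>l2 > 0\<close> by simp
    qed
    then have "infinite ((\<lambda>t. unit_char (\<kappa> * (t * l2))) ` {0<..<t0})"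
      using t0 by (simp add: finite_image_iff)
    then obtain z where z: "z \<in> (\<lambda>t. unit_char (\<kappa> * (t * l2))) ` {0<..<t0}" "poly p z \<noteq> 0"
      using poly_roots_finite[OF p0] by (metis (mono_tags, lifting) finite_subset mem_Collect_eq subsetI)
    then obtain t where t: "0 < t" "t < t0" "poly p (unit_char (\<kappa> * (t * l2))) \<noteq> 0" by auto
    have "cmod (N x) \<le> t * (M - 1)" using near[OF t(1,3)] by (simp add: M_def)
    also have "\<dots> < t * M" using t(1) by simp
    also have "\<dots> < cmod (N x) / M * M" using t(2) M by (intro mult_strict_right_mono) (auto simp: t0_def)
    finally show False using M by simp
  qed
qed

text \<open>A relation \<open>(\<Sum>j\<in>J. of_int (c j) *\<^sub>R a j) = 0\<close> pairs with
  \<open>b d\<close> to an integer, since the \<open>a\<close>-parts cancel, and this integer is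
  bounded. By \<open>no_slope\<close>, a difference of two values of \<open>b\<close> that pairs to
  0 with all relations is 0. So the pairings with finitely many determining relations map the values
  of \<open>b\<close> injectively into a finite set.\<close>

lemma finite_b:
  assumes "N x \<noteq> 0"
  shows "finite ((\<lambda>d. restrict (b d) J) ` D)"
proof -
  define K where "K = {c :: 'j \<Rightarrow> int. (\<Sum>j\<in>J. of_int (c j) *\<^sub>R a j) = 0}"
  obtain P where P: "P \<subseteq> (\<lambda>c j. real_of_int (c j)) ` K" "finite P"
    "\<And>l. (\<forall>p\<in>P. (\<Sum>j\<in>J. l j * p j) = 0) \<Longrightarrow> (\<forall>p\<in>(\<lambda>c j. real_of_int (c j)) ` K. (\<Sum>j\<in>J. l j * p j) = 0)"
    using finite_determining_subset[OF finite_J, of "(\<lambda>c j. real_of_int (c j)) ` K"] by (elim exE conjE) (rule that, assumption+, simp)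
  define m where "m p = (\<Sum>j\<in>J. B * \<bar>p j\<bar>)" for p :: "'j \<Rightarrow> real"
  define V where "V = PiE P (\<lambda>p. real_of_int ` {- \<lceil>m p\<rceil>..\<lceil>m p\<rceil>})"
  define \<psi> where "\<psi> r = restrict (\<lambda>p. \<Sum>j\<in>J. r j * p j) P" for r :: "'j \<Rightarrow> real"
  have "finite V" unfolding V_def by (intro finite_PiE P) auto
  moreover have "\<psi> ` ((\<lambda>d. restrict (b d) J) ` D) \<subseteq> V"
  proof -
    have "(\<Sum>j\<in>J. b d j * p j) \<in> real_of_int ` {- \<lceil>m p\<rceil>..\<lceil>m p\<rceil>}" if d: "d \<in> D" and p: "p \<in> P" for d p
    proof -
      obtain c where c: "c \<in> K" "p = (\<lambda>j. real_of_int (c j))" using P(1) p by blast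
      have "(\<Sum>j\<in>J. of_int (c j) * (a j \<bullet> d + b d j)) \<in> \<int>"
        by (intro Ints_sum Ints_mult int d Ints_of_int)
      also have "(\<Sum>j\<in>J. of_int (c j) * (a j \<bullet> d + b d j))
         = (\<Sum>j\<in>J. of_int (c j) *\<^sub>R a j) \<bullet> d + (\<Sum>j\<in>J. b d j * p j)"
        by (simp add: c(2) inner_sum_left algebra_simps flip: sum.distrib)
      also have "\<dots> = (\<Sum>j\<in>J. b d j * p j)" using c(1) by (simp add: K_def)
      finally obtain z where z: "(\<Sum>j\<in>J. b d j * p j) = of_int z" by (auto elim: Ints_cases)
      have "\<bar>\<Sum>j\<in>J. b d j * p j\<bar> \<le> m p" unfolding m_def
        by (rule order_trans[OF sum_abs sum_mono]) (use b_bound[OF d] in \<open>auto simp: abs_mult intro!: mult_right_mono\<close>)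
      then have "z \<in> {- \<lceil>m p\<rceil>..\<lceil>m p\<rceil>}" unfolding z atLeastAtMost_iff by linarith
      then show ?thesis unfolding z by blast
    qed
    then show ?thesis by (auto simp: V_def \<psi>_def intro!: PiE_I)
  qed
  ultimately have "finite (\<psi> ` ((\<lambda>d. restrict (b d) J) ` D))" by (rule finite_subset[rotated])
  moreover have "inj_on \<psi> ((\<lambda>d. restrict (b d) J) ` D)"
  proof (rule inj_onI)
    fix r r' assume "r \<in> (\<lambda>d. restrict (b d) J) ` D" "r' \<in> (\<lambda>d. restrict (b d) J) ` D" and eq: "\<psi> r = \<psi> r'"
    then obtain d d' where d: "d \<in> D" "r = restrict (b d) J" "d' \<in> D" "r' = restrict (b d') J" by auto
    define l where "l j = b d j - b d' j" for j
    have "\<forall>p\<in>P. (\<Sum>j\<in>J. l j * p j) = 0"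
    proof
      fix p assume "p \<in> P"
      then show "(\<Sum>j\<in>J. l j * p j) = 0"
        using fun_cong[OF eq, of p] by (simp add: \<psi>_def d l_def left_diff_distrib sum_subtractf)
    qed
    from P(3)[OF this] have rel: "(\<Sum>j\<in>J. l j * of_int (c j)) = 0"
      if "(\<Sum>j\<in>J. of_int (c j) *\<^sub>R a j) = 0" for c :: "'j \<Rightarrow> int" using that by (auto simp: K_def)
    have "(\<Sum>j\<in>J. l j *\<^sub>R g j) = 0"
      using b_g d by (simp add: l_def scaleR_diff_left sum_subtractf)
    from no_slope[OF this rel] have "l j = 0" if "j \<in> J" for j using assms that by blast
    then show "r = r'" by (auto simp: d l_def)
  qed
  ultimately show ?thesis by (simp add: finite_image_iff)
qed

text \<open>Grouping by the value of \<open>b\<close> leaves finitely many frequencies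
  \<open>R\<close>, the same for all \<open>x\<close>. Convergence is known for the sums and not for
  their coefficients; these are obtained by compactness along a subsequence that may depend on
  \<open>x\<close>.\<close>

lemma comb_on_cosets:
  assumes "N x0 \<noteq> 0"
  obtains R :: "('j \<Rightarrow> real) set" and \<phi> where "finite R"
    "\<And>x (c :: 'j \<Rightarrow> int). N (x + (\<Sum>j\<in>J. of_int (c j) *\<^sub>R a j))
       = (\<Sum>r\<in>R. \<phi> x r * unit_char (\<Sum>j\<in>J. of_int (c j) * r j))"
proof -
  define R where "R = (\<lambda>d. restrict (b d) J) ` D"
  have finR: "finite R" unfolding R_def by (rule finite_b[OF assms])
  define \<Phi> where "\<Phi> x i r = (\<Sum>d\<in>{d\<in>X i. restrict (b d) J = r}. \<omega> i d * unit_char (- (d \<bullet> x)))" for x i r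
  have F: "F x y i = (\<Sum>r\<in>R. \<Phi> x i r * unit_char (\<Sum>j\<in>J. y j * r j))" for x y i
  proof -
    have "F x y i = (\<Sum>r\<in>R. \<Sum>d\<in>{d\<in>X i. restrict (b d) J = r}.
       \<omega> i d * unit_char (- (d \<bullet> x)) * unit_char (\<Sum>j\<in>J. y j * b d j))"
      unfolding F_def by (rule sum.group[symmetric]) (use X_sub finite_X finR in \<open>auto simp: R_def\<close>)
    also have "\<dots> = (\<Sum>r\<in>R. \<Phi> x i r * unit_char (\<Sum>j\<in>J. y j * r j))"
      unfolding \<Phi>_def sum_distrib_right by (intro sum.cong refl) (auto cong: sum.cong)
    finally show ?thesis .
  qed
  have bd: "cmod (\<Phi> x i r) \<le> C" for x i r
  proof -
    have "cmod (\<Phi> x i r) \<le> (\<Sum>d\<in>{d\<in>X i. restrict (b d) J = r}. cmod (\<omega> i d))"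
      unfolding \<Phi>_def by (rule sum_norm_le) (simp add: norm_mult)
    also have "\<dots> \<le> (\<Sum>d\<in>X i. cmod (\<omega> i d))" by (rule sum_mono2) (use finite_X in auto)
    finally show ?thesis using mass[of i] by linarith
  qed
  have "\<exists>\<phi>. \<forall>c :: 'j \<Rightarrow> int. N (x + (\<Sum>j\<in>J. of_int (c j) *\<^sub>R a j))
       = (\<Sum>r\<in>R. \<phi> r * unit_char (\<Sum>j\<in>J. of_int (c j) * r j))" for x
  proof -
    obtain s \<phi> where s: "strict_mono (s :: nat \<Rightarrow> nat)" "\<And>r. r \<in> R \<Longrightarrow> (\<lambda>i. \<Phi> x (s i) r) \<longlonglongrightarrow> \<phi> r"
      using common_convergent_subsequence[OF finR, of "\<Phi> x" C] bd by fastforce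
    have "N (x + (\<Sum>j\<in>J. of_int (c j) *\<^sub>R a j)) = (\<Sum>r\<in>R. \<phi> r * unit_char (\<Sum>j\<in>J. of_int (c j) * r j))"
      for c :: "'j \<Rightarrow> int"
    proof (rule LIMSEQ_unique)
      show "(\<lambda>i. F x (\<lambda>j. of_int (c j)) (s i)) \<longlonglongrightarrow> N (x + (\<Sum>j\<in>J. of_int (c j) *\<^sub>R a j))"
        using LIMSEQ_subseq_LIMSEQ[OF F_integer_lim[of x c 0] s(1)] by (simp add: o_def)
      show "(\<lambda>i. F x (\<lambda>j. of_int (c j)) (s i)) \<longlonglongrightarrow> (\<Sum>r\<in>R. \<phi> r * unit_char (\<Sum>j\<in>J. of_int (c j) * r j))"
        unfolding F by (intro tendsto_intros s(2))
    qed
    then show ?thesis by blast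
  qed
  then obtain \<phi> where "\<And>x (c :: 'j \<Rightarrow> int). N (x + (\<Sum>j\<in>J. of_int (c j) *\<^sub>R a j))
       = (\<Sum>r\<in>R. \<phi> x r * unit_char (\<Sum>j\<in>J. of_int (c j) * r j))" by metis
  with finR show thesis by (rule that)
qed

end

section \<open>Lattices and trigonometric polynomials\<close>

lemma lattice_set_uminus_add:
  fixes L :: "(real^'n) set"
  assumes "lattice_set L"
  shows "0 \<in> L" "x \<in> L \<Longrightarrow> - x \<in> L" "x \<in> L \<Longrightarrow> y \<in> L \<Longrightarrow> x + y \<in> L"
proof -
  obtain T :: "real^'n \<Rightarrow> real^'n" where T: "linear T" "L = T ` {z. \<forall>i. z $ i \<in> \<int>}"
    using assms unfolding lattice_set_def by blast
  interpret linear T by (fact T(1))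
  show "0 \<in> L" unfolding T(2) by (rule image_eqI[of _ _ 0]) (simp_all add: zero)
  show "- x \<in> L" if x: "x \<in> L"
  proof -
    obtain z where "x = T z" "\<forall>i. z $ i \<in> \<int>" using x T(2) by auto
    then show ?thesis unfolding T(2) by (intro image_eqI[of _ _ "- z"]) (simp_all add: neg)
  qed
  show "x + y \<in> L" if xy: "x \<in> L" "y \<in> L"
  proof -
    obtain z z' where "x = T z" "\<forall>i. z $ i \<in> \<int>" "y = T z'" "\<forall>i. z' $ i \<in> \<int>" using xy T(2) by auto
    then show ?thesis unfolding T(2) by (intro image_eqI[of _ _ "z + z'"]) (simp_all add: add)
  qed
qed

lemma translate_iff: "x \<in> translate L \<tau> \<longleftrightarrow> x - \<tau> \<in> L"
  unfolding translate_def by (auto intro: image_eqI[of _ _ "x - \<tau>"])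

lemma finite_bounded_integer_vectors: "finite {z :: real^'n. (\<forall>i. z $ i \<in> \<int>) \<and> norm z \<le> M}"
proof -
  have "{z :: real^'n. (\<forall>i. z $ i \<in> \<int>) \<and> norm z \<le> M}
     \<subseteq> (\<lambda>f. \<chi> i. real_of_int (f i)) ` PiE UNIV (\<lambda>_. {-\<lceil>M\<rceil>..\<lceil>M\<rceil>})"
  proof
    fix z :: "real^'n" assume z: "z \<in> {z. (\<forall>i. z $ i \<in> \<int>) \<and> norm z \<le> M}"
    define f where "f i = \<lfloor>z $ i\<rfloor>" for i
    have zf: "z $ i = real_of_int (f i)" for i using z by (auto simp: f_def elim: Ints_cases)
    have "\<bar>z $ i\<bar> \<le> M" for i using z component_le_norm_cart[of z i] by auto
    then have "f i \<in> {-\<lceil>M\<rceil>..\<lceil>M\<rceil>}" for i unfolding zf atLeastAtMost_iff by (smt (verit) le_of_int_ceiling of_int_le_iff of_int_minus)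
    then show "z \<in> (\<lambda>f. \<chi> i. real_of_int (f i)) ` PiE UNIV (\<lambda>_. {-\<lceil>M\<rceil>..\<lceil>M\<rceil>})"
      using zf by (intro image_eqI[of _ _ f]) (auto simp: vec_eq_iff)
  qed
  then show ?thesis by (rule finite_subset) (intro finite_imageI finite_PiE; simp)
qed

lemma lattice_set_bounded_finite:
  fixes L :: "(real^'n) set"
  assumes "lattice_set L" "bounded S"
  shows "finite (translate L \<tau> \<inter> S)"
proof -
  obtain T :: "real^'n \<Rightarrow> real^'n" where T: "linear T" "bij T" "L = T ` {z. \<forall>i. z $ i \<in> \<int>}"
    using assms unfolding lattice_set_def by blast
  interpret linear T by (fact T(1))
  obtain T' where T': "linear T'" "T' \<circ> T = id"
    using linear_injective_left_inverse[OF T(1)] bij_is_inj[OF T(2)] by blast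
  have "bounded ((\<lambda>x. x - \<tau>) ` S)" using assms(2) bounded_translation_minus by blast
  then have "bounded (T' ` (\<lambda>x. x - \<tau>) ` S)" using bounded_linear_image T'(1) linear_conv_bounded_linear by blast
  then obtain M where M: "\<And>z. z \<in> T' ` (\<lambda>x. x - \<tau>) ` S \<Longrightarrow> norm z \<le> M" unfolding bounded_iff by blast
  have "translate L \<tau> \<inter> S \<subseteq> (\<lambda>z. T z + \<tau>) ` {z. (\<forall>i. z $ i \<in> \<int>) \<and> norm z \<le> M}"
  proof
    fix x assume x: "x \<in> translate L \<tau> \<inter> S"
    then obtain z where z: "\<forall>i. z $ i \<in> \<int>" "x - \<tau> = T z" using T(3) by (auto simp: translate_iff)
    have "T' (x - \<tau>) = z" using z(2) fun_cong[OF T'(2), of z] by simp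
    then have "norm z \<le> M" using M[of z] x by force
    then show "x \<in> (\<lambda>z. T z + \<tau>) ` {z. (\<forall>i. z $ i \<in> \<int>) \<and> norm z \<le> M}"
      using z by (intro image_eqI[of _ _ z]) (auto simp: algebra_simps)
  qed
  then show ?thesis by (rule finite_subset) (intro finite_imageI finite_bounded_integer_vectors)
qed

lemma unit_char_inner: "unit_char (w \<bullet> x) = exp (2 * pi * \<i> * complex_of_real (w \<bullet> x))"
  by (simp add: unit_char_def cis_conv_exp mult_ac)

lemma trig_polynomial_sum_unit_char:
  fixes w :: "'r \<Rightarrow> real^'n"
  assumes "finite R"
  shows "trig_polynomial (\<lambda>x. \<Sum>r\<in>R. \<phi> r * unit_char (w r \<bullet> x))"
proof -
  have "(\<lambda>x. \<Sum>r\<in>R. \<phi> r * unit_char (w r \<bullet> x))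
      = (\<lambda>x. \<Sum>v\<in>w ` R. (\<Sum>r\<in>{r\<in>R. w r = v}. \<phi> r) * exp (2 * pi * \<i> * complex_of_real (v \<bullet> x)))"
  proof
    fix x
    have "(\<Sum>r\<in>R. \<phi> r * unit_char (w r \<bullet> x))
        = (\<Sum>v\<in>w ` R. \<Sum>r\<in>{r\<in>R. w r = v}. \<phi> r * unit_char (w r \<bullet> x))"
      by (rule sum.group[symmetric]) (use assms in auto)
    also have "\<dots> = (\<Sum>v\<in>w ` R. (\<Sum>r\<in>{r\<in>R. w r = v}. \<phi> r) * exp (2 * pi * \<i> * complex_of_real (v \<bullet> x)))"
      by (simp add: sum_distrib_right unit_char_inner)
    finally show "(\<Sum>r\<in>R. \<phi> r * unit_char (w r \<bullet> x))
        = (\<Sum>v\<in>w ` R. (\<Sum>r\<in>{r\<in>R. w r = v}. \<phi> r) * exp (2 * pi * \<i> * complex_of_real (v \<bullet> x)))" .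
  qed
  then show ?thesis unfolding trig_polynomial_def
    by (intro exI[of _ "w ` R"] exI[of _ "\<lambda>v. \<Sum>r\<in>{r\<in>R. w r = v}. \<phi> r"] conjI) (use assms in auto)
qed

text \<open>A vector orthogonal to all \<open>a j\<close> is 0 by \<open>a_g\<close>.\<close>

lemma span_image_a:
  assumes "almost_periodic_comb J g a b D X \<omega> N B C"
  shows "span (a ` J) = UNIV"
proof -
  interpret almost_periodic_comb J g a b D X \<omega> N B C by fact
  show ?thesis
  proof (rule ccontr)
    assume "span (a ` J) \<noteq> UNIV"
    then obtain x where x: "x \<noteq> 0" "\<And>y. y \<in> span (a ` J) \<Longrightarrow> orthogonal x y"
      using orthogonal_to_subspace_exists_gen[of "a ` J" UNIV] by (auto simp: psubset_eq)
    have "a j \<bullet> x = 0" if "j \<in> J" for j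
      using x(2)[OF span_base, of "a j"] that by (simp add: orthogonal_def inner_commute)
    then have "x = 0" using a_g[of x] by simp
    with x show False by simp
  qed
qed

text \<open>The group generated by all \<open>a j\<close> need not be discrete, but a basis of the
  space selected from them spans a lattice. The frequency \<open>w r\<close> is the restriction of
  \<open>r\<close> to this basis, carried over by the adjoint of the inverse of \<open>T\<close>;
  \<open>M\<close> bounds the fundamental cell.\<close>

lemma comb_on_lattice_cosets:
  fixes N :: "real^'n \<Rightarrow> complex" and J :: "'j set"
  assumes ap: "almost_periodic_comb J g a b D X \<omega> N B C" and "N x0 \<noteq> 0"
  obtains L and R :: "('j \<Rightarrow> real) set" and w \<phi> M where "lattice_set L" "finite R"
    "\<And>x l. l \<in> L \<Longrightarrow> N (x + l) = (\<Sum>r\<in>R. \<phi> x r * unit_char (w r \<bullet> l))"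
    "\<And>x. \<exists>l\<in>L. norm (x - l) \<le> M"
proof -
  interpret almost_periodic_comb J g a b D X \<omega> N B C by fact
  obtain R :: "('j \<Rightarrow> real) set" and \<phi> where R: "finite R"
    "\<And>x (c :: 'j \<Rightarrow> int). N (x + (\<Sum>j\<in>J. of_int (c j) *\<^sub>R a j))
       = (\<Sum>r\<in>R. \<phi> x r * unit_char (\<Sum>j\<in>J. of_int (c j) * r j))"
    by (rule comb_on_cosets[OF assms(2)]) (rule that, assumption+)
  obtain E where E: "E \<subseteq> a ` J" "independent E" "a ` J \<subseteq> span E"
    using maximal_independent_subset by blast
  have spanE: "span E = UNIV" using span_image_a[OF ap] E(3) span_minimal subspace_span by blast
  have finE: "finite E" using E(1) finite_J finite_subset by blast
  have "card E = dim (UNIV :: (real^'n) set)" using basis_card_eq_dim[of E UNIV] E(2) spanE by simp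
  then have "card (UNIV :: 'n set) = card E" by simp
  then obtain v where v: "bij_betw v (UNIV :: 'n set) E" using finite_same_card_bij[OF finite finE] by blast
  have "v i \<in> a ` J" for i using bij_betwE[OF v] E(1) by blast
  then have "\<forall>i. \<exists>j\<in>J. a j = v i" by (metis imageE)
  then obtain s where s: "\<And>i. s i \<in> J" "\<And>i. a (s i) = v i" by metis
  define T where "T z = (\<Sum>i\<in>UNIV. z $ i *\<^sub>R a (s i))" for z :: "real^'n"
  have linT: "linear T" unfolding T_def
    by (rule linearI) (simp_all add: scaleR_add_left sum.distrib scaleR_sum_right)
  have "surj T"
  proof -
    have "x \<in> range T" for x
    proof -
      have "x \<in> span E" by (simp add: spanE)
      then obtain u where "x = (\<Sum>e\<in>E. u e *\<^sub>R e)" unfolding span_finite[OF finE] by blast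
      also have "\<dots> = (\<Sum>i\<in>UNIV. u (v i) *\<^sub>R v i)" by (rule sum.reindex_bij_betw[OF v, symmetric])
      also have "\<dots> = T (\<chi> i. u (v i))" by (simp add: T_def s)
      finally show ?thesis by blast
    qed
    then show ?thesis by blast
  qed
  then have bijT: "bij T" using linear_surjective_imp_injective[OF linT] by (simp add: bij_def)
  obtain T' where T': "linear T'" "T' \<circ> T = id"
    using linear_injective_left_inverse[OF linT] bij_is_inj[OF bijT] by blast
  define L where "L = T ` {z. \<forall>i. z $ i \<in> \<int>}"
  define w where "w r = adjoint T' (\<chi> i. r (s i))" for r
  define M where "M = (\<Sum>i\<in>UNIV. norm (a (s i)))"
  show thesis
  proof (rule that)
    show "lattice_set L" unfolding lattice_set_def L_def using linT bijT by blast
    show "finite R" by fact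
    show "N (x + l) = (\<Sum>r\<in>R. \<phi> x r * unit_char (w r \<bullet> l))" if l: "l \<in> L" for x l
    proof -
      obtain z where z: "\<forall>i. z $ i \<in> \<int>" "l = T z" using l by (auto simp: L_def)
      define c where "c j = (\<Sum>i\<in>UNIV. if s i = j then \<lfloor>z $ i\<rfloor> else 0)" for j
      have zi: "real_of_int \<lfloor>z $ i\<rfloor> = z $ i" for i using z(1) by (auto elim: Ints_cases)
      have cj: "real_of_int (c j) = (\<Sum>i\<in>UNIV. if s i = j then z $ i else 0)" for j
        unfolding c_def of_int_sum by (rule sum.cong) (auto simp: zi)
      have "(\<Sum>j\<in>J. of_int (c j) *\<^sub>R a j) = (\<Sum>i\<in>UNIV. \<Sum>j\<in>J. if s i = j then z $ i *\<^sub>R a j else 0)"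
        unfolding cj scaleR_sum_left by (subst sum.swap) (simp add: if_distrib[of "\<lambda>t. t *\<^sub>R _"] cong: if_cong)
      also have "\<dots> = l" using s(1) finite_J by (simp add: z(2) T_def)
      finally have ca: "(\<Sum>j\<in>J. of_int (c j) *\<^sub>R a j) = l" .
      have cr: "(\<Sum>j\<in>J. of_int (c j) * r j) = w r \<bullet> l" for r
      proof -
        have "(\<Sum>j\<in>J. of_int (c j) * r j) = (\<Sum>i\<in>UNIV. \<Sum>j\<in>J. if s i = j then z $ i * r j else 0)"
          unfolding cj sum_distrib_right by (subst sum.swap) (simp add: if_distrib[of "\<lambda>t. t * _"] cong: if_cong)
        also have "\<dots> = (\<chi> i. r (s i)) \<bullet> z" using s(1) finite_J by (simp add: inner_vec_def mult.commute)
        also have "\<dots> = (\<chi> i. r (s i)) \<bullet> T' l" using fun_cong[OF T'(2), of z] by (simp add: z(2))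
        also have "\<dots> = w r \<bullet> l" unfolding w_def using adjoint_works[OF T'(1), of l] by (simp add: inner_commute)
        finally show ?thesis .
      qed
      show ?thesis using R(2)[of x c] unfolding ca cr .
    qed
    show "\<exists>l\<in>L. norm (x - l) \<le> M" for x
    proof -
      obtain z where z: "x = T z" using \<open>surj T\<close> by blast
      have "norm (x - T (\<chi> i. of_int \<lfloor>z $ i\<rfloor>)) = norm (\<Sum>i\<in>UNIV. frac (z $ i) *\<^sub>R a (s i))"
        by (simp add: z T_def frac_def scaleR_diff_left sum_subtractf)
      also have "\<dots> \<le> M" unfolding M_def
        by (rule sum_norm_le) (simp add: frac_ge_0 frac_lt_1 less_imp_le mult_left_le_one_le)
      finally show ?thesis unfolding L_def by (intro bexI[of _ "T (\<chi> i. of_int \<lfloor>z $ i\<rfloor>)"]) auto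
    qed
  qed
qed

lemma lattice_set_integer_vectors: "lattice_set {z :: real^'n. \<forall>i. z $ i \<in> \<int>}"
  unfolding lattice_set_def by (rule exI[of _ id]) (simp add: linear_id)

theorem comb_structure:
  fixes N :: "real^'n \<Rightarrow> complex" and J :: "'j set"
  assumes ap: "almost_periodic_comb J g a b D X \<omega> N B C"
  shows "\<exists>L T P. lattice_set L \<and> finite T \<and> T \<noteq> {} \<and> {x. N x \<noteq> 0} \<subseteq> (\<Union>\<tau>\<in>T. translate L \<tau>) \<and>
     (\<forall>\<tau>\<in>T. \<forall>\<sigma>\<in>T. \<tau> \<noteq> \<sigma> \<longrightarrow> translate L \<tau> \<inter> translate L \<sigma> = {}) \<and>
     (\<forall>\<tau>\<in>T. trig_polynomial (P \<tau>) \<and> (\<forall>x\<in>translate L \<tau>. P \<tau> x = N x))"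
proof (cases "\<forall>x. N x = 0")
  case True
  have "trig_polynomial (\<lambda>x :: real^'n. 0)"
    using trig_polynomial_sum_unit_char[of "{}"] by simp
  note zero = this
  show ?thesis
    by (rule exI[of _ "{z :: real^'n. \<forall>i. z $ i \<in> \<int>}"], rule exI[of _ "{0}"], rule exI[of _ "\<lambda>_ _. 0"])
       (simp add: True lattice_set_integer_vectors zero)
next
  case False
  then obtain x0 where x0: "N x0 \<noteq> 0" by auto
  interpret almost_periodic_comb J g a b D X \<omega> N B C by fact
  obtain L and R :: "('j \<Rightarrow> real) set" and w \<phi> M where L: "lattice_set L" and R: "finite R"
    and N: "\<And>x l. l \<in> L \<Longrightarrow> N (x + l) = (\<Sum>r\<in>R. \<phi> x r * unit_char (w r \<bullet> l))"
    and M: "\<And>x. \<exists>l\<in>L. norm (x - l) \<le> M"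
    by (rule comb_on_lattice_cosets[OF ap x0]) (rule that, assumption+)
  \<comment> \<open>On a coset \<open>N\<close> is the pairing of the coefficient vector
    \<open>\<phi> x\<close> with \<open>ev l\<close>. A coefficient vector that annihilates
    \<open>ev q\<close> for all \<open>q \<in> Q\<close> annihilates \<open>ev\<close> on all of
    \<open>L\<close>, so every coset with an atom has an atom of norm at most
    \<open>K\<close>.\<close>
  define ev where "ev l r = unit_char (w r \<bullet> l)" for l r
  obtain P' where P': "P' \<subseteq> ev ` L" "finite P'"
    "\<And>f. (\<forall>p\<in>P'. (\<Sum>r\<in>R. f r * p r) = 0) \<Longrightarrow> (\<forall>p\<in>ev ` L. (\<Sum>r\<in>R. f r * p r) = 0)"
    using finite_determining_subset[OF R, of "ev ` L"] by (elim exE conjE) (rule that, assumption+, simp)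
  obtain Q where Q: "Q \<subseteq> L" "finite Q" "P' = ev ` Q" using finite_subset_image[OF P'(2,1)] by blast
  define K where "K = M + (\<Sum>q\<in>Q. norm q)"
  define T0 where "T0 = insert 0 (cball 0 K \<inter> {x. N x \<noteq> 0})"
  have finT0: "finite T0" unfolding T0_def by (intro finite.insertI discrete) auto
  have cover: "\<exists>\<tau>\<in>T0. x \<in> translate L \<tau>" if x: "N x \<noteq> 0" for x
  proof -
    obtain l where l: "l \<in> L" "norm (x - l) \<le> M" using M[of x] by blast
    have "\<exists>q\<in>Q. N (x - l + q) \<noteq> 0"
    proof (rule ccontr)
      assume A: "\<not> (\<exists>q\<in>Q. N (x - l + q) \<noteq> 0)"
      have "(\<Sum>r\<in>R. \<phi> (x - l) r * ev q r) = 0" if "q \<in> Q" for q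
        using A N[of q "x - l"] Q(1) that unfolding ev_def by auto
      then have "\<forall>p\<in>P'. (\<Sum>r\<in>R. \<phi> (x - l) r * p r) = 0" unfolding Q(3) by simp
      from P'(3)[OF this] l(1) have "(\<Sum>r\<in>R. \<phi> (x - l) r * ev l r) = 0" by simp
      then have "N (x - l + l) = 0" using N[OF l(1), of "x - l"] unfolding ev_def by simp
      with x show False by simp
    qed
    then obtain q where q: "q \<in> Q" "N (x - l + q) \<noteq> 0" by blast
    have "norm q \<le> (\<Sum>q\<in>Q. norm q)" by (rule member_le_sum) (use q Q in auto)
    then have "x - l + q \<in> T0"
      using q(2) l(2) norm_triangle_ineq[of "x - l" q] by (simp add: T0_def K_def)
    moreover have "l + - q \<in> L" using lattice_set_uminus_add[OF L] l(1) q(1) Q(1) by blast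
    ultimately show ?thesis by (intro bexI[of _ "x - l + q"]) (auto simp: translate_iff)
  qed
  \<comment> \<open>One representative per coset makes the translates pairwise disjoint, so that no
    atom is counted twice when the combs are added.\<close>
  define rep where "rep \<tau> = (SOME \<sigma>. \<sigma> - \<tau> \<in> L)" for \<tau>
  have rep: "rep \<tau> - \<tau> \<in> L" for \<tau>
    unfolding rep_def by (rule someI[of _ \<tau>]) (simp add: lattice_set_uminus_add(1)[OF L])
  have rep_eq: "rep \<tau> = rep \<sigma>" if "\<tau> - \<sigma> \<in> L" for \<tau> \<sigma>
  proof -
    have "\<rho> - \<tau> \<in> L \<longleftrightarrow> \<rho> - \<sigma> \<in> L" for \<rho>
      using lattice_set_uminus_add(3)[OF L, of "\<rho> - \<tau>" "\<tau> - \<sigma>"]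
        lattice_set_uminus_add(3)[OF L, of "\<rho> - \<sigma>" "- (\<tau> - \<sigma>)"] lattice_set_uminus_add(2)[OF L that] that by auto
    then show ?thesis by (simp add: rep_def)
  qed
  define T where "T = rep ` T0"
  \<comment> \<open>The coefficient absorbs the phase at \<open>\<tau>\<close>, as the coset formula
    is in terms of \<open>l = x - \<tau>\<close>.\<close>
  define P where "P \<tau> x = (\<Sum>r\<in>R. (\<phi> \<tau> r * unit_char (- (w r \<bullet> \<tau>))) * unit_char (w r \<bullet> x))" for \<tau> x
  show ?thesis
  proof (rule exI[of _ L], rule exI[of _ T], rule exI[of _ P], intro conjI ballI impI)
    show "{x. N x \<noteq> 0} \<subseteq> (\<Union>\<tau>\<in>T. translate L \<tau>)"
    proof
      fix x assume "x \<in> {x. N x \<noteq> 0}"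
      then obtain \<tau> where \<tau>: "\<tau> \<in> T0" "x - \<tau> \<in> L" using cover by (auto simp: translate_iff)
      have "x - \<tau> + - (rep \<tau> - \<tau>) \<in> L" using lattice_set_uminus_add[OF L] \<tau>(2) rep by blast
      then have "x \<in> translate L (rep \<tau>)" by (simp add: translate_iff)
      then show "x \<in> (\<Union>\<tau>\<in>T. translate L \<tau>)" using \<tau>(1) by (auto simp: T_def)
    qed
    show "translate L \<tau> \<inter> translate L \<sigma> = {}" if T: "\<tau> \<in> T" "\<sigma> \<in> T" "\<tau> \<noteq> \<sigma>" for \<tau> \<sigma>
    proof (rule ccontr)
      assume "translate L \<tau> \<inter> translate L \<sigma> \<noteq> {}"
      then obtain x where x: "x - \<tau> \<in> L" "x - \<sigma> \<in> L" by (auto simp: translate_iff)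
      obtain \<tau>0 \<sigma>0 where ts: "\<tau> = rep \<tau>0" "\<sigma> = rep \<sigma>0" using T(1,2) by (auto simp: T_def)
      have "(rep \<tau>0 - \<tau>0) + (x - \<tau>) \<in> L" "(rep \<sigma>0 - \<sigma>0) + (x - \<sigma>) \<in> L"
        using x rep lattice_set_uminus_add(3)[OF L] by blast+
      then have "x - \<tau>0 \<in> L" "x - \<sigma>0 \<in> L" by (simp_all add: ts)
      then have "rep x = rep \<tau>0" "rep x = rep \<sigma>0" using rep_eq by blast+
      then show False using T(3) ts by simp
    qed
    show "trig_polynomial (P \<tau>)" for \<tau>
      unfolding P_def[abs_def] by (rule trig_polynomial_sum_unit_char[OF R])
    show "P \<tau> x = N x" if "x \<in> translate L \<tau>" for \<tau> x
    proof -
      have "N x = N (\<tau> + (x - \<tau>))" by simp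
      also have "\<dots> = P \<tau> x"
        using N[of "x - \<tau>" \<tau>] that
        by (simp add: translate_iff P_def inner_diff_right mult.assoc flip: unit_char_add)
      finally show ?thesis ..
    qed
  qed (use L finT0 in \<open>auto simp: T_def T0_def\<close>)
qed

section \<open>Meyer sets\<close>

lemma uniform_discrete_imp_discrete_closed_set:
  fixes A :: "'v::euclidean_space set"
  assumes "uniform_discrete A"
  shows "discrete_closed_set A"
  unfolding discrete_closed_set_def
proof (intro allI impI)
  fix B :: "'v set" assume B: "bounded B"
  show "finite (A \<inter> B)"
  proof (rule ccontr)
    assume inf: "infinite (A \<inter> B)"
    obtain e where e: "e > 0" "\<And>x y. x \<in> A \<Longrightarrow> y \<in> A \<Longrightarrow> dist x y < e \<Longrightarrow> x = y"
      using assms unfolding uniform_discrete_def by blast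
    have "compact (closure B)" using B by (simp add: compact_closure)
    then obtain x where "x islimpt (A \<inter> B)"
      using Heine_Borel_imp_Bolzano_Weierstrass[OF _ inf, of "closure B"] closure_subset[of B] by blast
    define S where "S = (A \<inter> B) \<inter> ball x (e/2)"
    have "infinite S"
      using \<open>x islimpt (A \<inter> B)\<close> e(1) unfolding islimpt_eq_infinite_ball S_def by simp
    then obtain y where y: "y \<in> S" using infinite_imp_nonempty by (metis all_not_in_conv)
    have "infinite (S - {y})" using \<open>infinite S\<close> by simp
    then obtain z where z: "z \<in> S - {y}" using infinite_imp_nonempty by (metis all_not_in_conv)
    have yz: "y \<in> (A \<inter> B) \<inter> ball x (e/2)" "z \<in> (A \<inter> B) \<inter> ball x (e/2)" "y \<noteq> z"
      using y z by (auto simp: S_def)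
    have "dist y z < e" using yz dist_triangle_half_r[of x y e z] by (auto simp: dist_commute)
    then show False using e(2) yz by blast
  qed
qed

lemma discrete_closed_set_subset: "discrete_closed_set B \<Longrightarrow> A \<subseteq> B \<Longrightarrow> discrete_closed_set A"
  unfolding discrete_closed_set_def
proof (intro allI impI)
  fix S :: "'a set" assume "\<forall>S. bounded S \<longrightarrow> finite (B \<inter> S)" "A \<subseteq> B" "bounded S"
  then have "finite (B \<inter> S)" "A \<inter> S \<subseteq> B \<inter> S" by auto
  then show "finite (A \<inter> S)" by (rule finite_subset[rotated])
qed

lemma discrete_closed_set_add_finite:
  fixes A :: "'v::real_normed_vector set"
  assumes A: "discrete_closed_set A" and "finite F"
  shows "discrete_closed_set {x + f |x f. x \<in> A \<and> f \<in> F}"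
  unfolding discrete_closed_set_def
proof (intro allI impI)
  fix B :: "'v set" assume B: "bounded B"
  have "{x + f |x f. x \<in> A \<and> f \<in> F} \<inter> B \<subseteq> (\<Union>f\<in>F. (\<lambda>x. x + f) ` (A \<inter> (\<lambda>x. x - f) ` B))"
  proof
    fix z assume z: "z \<in> {x + f |x f. x \<in> A \<and> f \<in> F} \<inter> B"
    then obtain x f where xf: "z = x + f" "x \<in> A" "f \<in> F" by blast
    then have "x \<in> (\<lambda>x. x - f) ` B" using z by (intro image_eqI[of _ _ z]) auto
    with xf show "z \<in> (\<Union>f\<in>F. (\<lambda>x. x + f) ` (A \<inter> (\<lambda>x. x - f) ` B))" by auto
  qed
  moreover have fin: "finite (A \<inter> (\<lambda>x. x - f) ` B)" for f
    using A bounded_translation_minus[OF B, of f] unfolding discrete_closed_set_def by blast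
  then have "finite (\<Union>f\<in>F. (\<lambda>x. x + f) ` (A \<inter> (\<lambda>x. x - f) ` B))" using assms(2) by simp
  ultimately show "finite ({x + f |x f. x \<in> A \<and> f \<in> F} \<inter> B)"
    by (rule finite_subset)
qed

lemma discrete_closed_setD: "discrete_closed_set A \<Longrightarrow> bounded B \<Longrightarrow> finite (A \<inter> B)"
  unfolding discrete_closed_set_def by blast

definition difference_set :: "'v::ab_group_add set \<Rightarrow> 'v set" where
  "difference_set A = {x - y |x y. x \<in> A \<and> y \<in> A}"

text \<open>Using the inclusion of the differences in \<open>\<Lambda> + F\<close> twice puts the
  iterated differences into \<open>\<Lambda> + (F + F - F)\<close>, a finite union of translates of
  a locally finite set.\<close>

lemma Meyer_set_iterated_difference:
  fixes \<Lambda> :: "'v::euclidean_space set"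
  assumes "Meyer_set \<Lambda>"
  shows "discrete_closed_set (difference_set (difference_set \<Lambda>))"
proof -
  obtain F where F: "finite F" "difference_set \<Lambda> \<subseteq> {x + f |x f. x \<in> \<Lambda> \<and> f \<in> F}"
    using assms unfolding Meyer_set_def difference_set_def by blast
  define F' where "F' = (\<lambda>(f, f', f''). f + f' - f'') ` (F \<times> F \<times> F)"
  have "finite F'" unfolding F'_def using F(1) by auto
  have "discrete_closed_set \<Lambda>"
    using assms unfolding Meyer_set_def Delone_set_def by (blast intro: uniform_discrete_imp_discrete_closed_set)
  moreover have "difference_set (difference_set \<Lambda>) \<subseteq> {x + f |x f. x \<in> \<Lambda> \<and> f \<in> F'}"
  proof
    fix e assume "e \<in> difference_set (difference_set \<Lambda>)"
    then obtain d d' where d: "d \<in> difference_set \<Lambda>" "d' \<in> difference_set \<Lambda>" "e = d - d'"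
      by (auto simp: difference_set_def)
    then obtain l f l' f' where l: "l \<in> \<Lambda>" "f \<in> F" "d = l + f" "l' \<in> \<Lambda>" "f' \<in> F" "d' = l' + f'"
      using F(2) by blast
    then have "l - l' \<in> difference_set \<Lambda>" by (auto simp: difference_set_def)
    then obtain m k where m: "m \<in> \<Lambda>" "k \<in> F" "l - l' = m + k" using F(2) by blast
    have "e = m + (k + f - f')" using d(3) l m(3) by (simp add: algebra_simps)
    moreover have "k + f - f' \<in> F'" unfolding F'_def using l m by force
    ultimately show "e \<in> {x + f |x f. x \<in> \<Lambda> \<and> f \<in> F'}" using m(1) by blast
  qed
  ultimately show ?thesis
    using discrete_closed_set_add_finite[OF _ \<open>finite F'\<close>] discrete_closed_set_subset by blast
qed

text \<open>Only finitely many differences are shorter than 1, so the nonzero ones are bounded away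
  from 0.\<close>

lemma uniform_discrete_of_difference_set:
  fixes A :: "'v::real_normed_vector set"
  assumes "discrete_closed_set (difference_set A)"
  shows "uniform_discrete A"
proof -
  have fin: "finite (difference_set A \<inter> ball 0 1)" by (rule discrete_closed_setD[OF assms]) auto
  obtain e where e: "e > 0" "\<forall>d\<in>difference_set A \<inter> ball 0 1. d \<noteq> 0 \<longrightarrow> e \<le> dist 0 d"
    using finite_set_avoid[OF fin, of 0] by blast
  show ?thesis unfolding uniform_discrete_def
  proof (intro exI[of _ "min e 1"] conjI ballI impI)
    fix x y assume xy: "x \<in> A" "y \<in> A" "dist x y < min e 1"
    then have d: "x - y \<in> difference_set A \<inter> ball 0 1"
      by (auto simp: difference_set_def dist_norm norm_minus_commute)
    show "x = y"
    proof (rule ccontr)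
      assume "x \<noteq> y"
      then have "e \<le> dist 0 (x - y)" using e(2) d by simp
      then show False using xy(3) by (simp add: dist_norm norm_minus_commute)
    qed
  qed (use e in auto)
qed

lemma relatively_denseE:
  fixes A :: "'v::real_normed_vector set"
  assumes "relatively_dense A"
  obtains R where "R > 0" "\<And>x. \<exists>p\<in>A. norm (p - x) \<le> R"
proof -
  obtain R where R: "R > 0" "\<And>x. ball x R \<inter> A \<noteq> {}" using assms unfolding relatively_dense_def by blast
  have "\<exists>p\<in>A. norm (p - x) \<le> R" for x
    using R(2)[of x] by (force simp: dist_norm norm_minus_commute)
  with R(1) show thesis by (rule that)
qed

text \<open>Two points of a relatively dense set are joined by a chain of points of the set with bounded
  steps.\<close>
lemma difference_set_generated:
  fixes A V :: "'v::real_normed_vector set"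
  assumes R: "R > 0" "\<And>x. \<exists>p\<in>A. norm (p - x) \<le> R"
    and V: "0 \<in> V" "\<And>v w. v \<in> V \<Longrightarrow> w \<in> V \<Longrightarrow> v + w \<in> V"
    and gen: "difference_set A \<inter> cball 0 (2 * R + 1) \<subseteq> V"
  shows "difference_set A \<subseteq> V"
proof -
  have "x - y \<in> V" if "x \<in> A" "y \<in> A" "norm (x - y) \<le> real n" for x y n
    using that
  proof (induction n arbitrary: x)
    case 0
    then show ?case using V(1) by simp
  next
    case (Suc n)
    show ?case
    proof (cases "norm (x - y) \<le> 2 * R + 1")
      case True
      then have "x - y \<in> difference_set A \<inter> cball 0 (2 * R + 1)"
        using Suc.prems by (auto simp: difference_set_def norm_minus_commute)
      then show ?thesis using gen by blast
    next
      case False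
      \<comment> \<open>The intermediate point is at distance \<open>R + 1\<close> from
        \<open>x\<close>. A point of \<open>A\<close> within \<open>R\<close> of it makes a step of
        length at most \<open>2 * R + 1\<close>, after which the distance to \<open>y\<close> has
        dropped by at least 1.\<close>
      define t where "t = (R + 1) / norm (x - y)"
      have n0: "norm (x - y) > 0" using False R(1) by linarith
      have t: "0 < t" "t \<le> 1" "t * norm (x - y) = R + 1" using n0 False R(1) by (auto simp: t_def divide_simps)
      obtain w where w: "w \<in> A" "norm (w - (x + t *\<^sub>R (y - x))) \<le> R" using R(2) by blast
      have "x - w = - (w - (x + t *\<^sub>R (y - x))) - t *\<^sub>R (y - x)" by simp
      then have "norm (x - w) \<le> norm (w - (x + t *\<^sub>R (y - x))) + norm (t *\<^sub>R (y - x))"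
        by (metis norm_minus_cancel norm_triangle_ineq4)
      also have "\<dots> \<le> R + (R + 1)" using w(2) t(1,3) by (simp add: norm_minus_commute)
      finally have "x - w \<in> difference_set A \<inter> cball 0 (2 * R + 1)"
        using Suc.prems(1) w(1) by (auto simp: difference_set_def norm_minus_commute)
      then have "x - w \<in> V" using gen by blast
      have "w - y = (w - (x + t *\<^sub>R (y - x))) + (1 - t) *\<^sub>R (x - y)" by (simp add: algebra_simps)
      then have "norm (w - y) \<le> norm (w - (x + t *\<^sub>R (y - x))) + norm ((1 - t) *\<^sub>R (x - y))"
        by (metis norm_triangle_ineq)
      also have "norm ((1 - t) *\<^sub>R (x - y)) = (1 - t) * norm (x - y)" using t by simp
      also have "\<dots> = norm (x - y) - (R + 1)" using t(3) by (simp add: left_diff_distrib)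
      also have "norm (w - (x + t *\<^sub>R (y - x))) + (norm (x - y) - (R + 1)) \<le> R + (norm (x - y) - (R + 1))"
        using w(2) by simp
      finally have "w - y \<in> V" using Suc w(1) by simp
      then have "(x - w) + (w - y) \<in> V" using V(2) \<open>x - w \<in> V\<close> by blast
      then show ?thesis by simp
    qed
  qed
  then show ?thesis unfolding difference_set_def using real_arch_simple by blast
qed

text \<open>A basis of the rational span of \<open>A\<close> is divided by a common denominator of
  all coordinates. The group generated by \<open>G\<close> contains \<open>A\<close> and may be
  larger than the group generated by \<open>A\<close>.\<close>

lemma finitely_generated_integer_basis:
  fixes A :: "'v::real_vector set"
  assumes "finite A"
  obtains G where "finite G" "A \<subseteq> {\<Sum>g\<in>G. of_int (k g) *\<^sub>R g |k. True}"
    "\<And>k :: 'v \<Rightarrow> int. (\<Sum>g\<in>G. of_int (k g) *\<^sub>R g) = 0 \<Longrightarrow> \<forall>g\<in>G. k g = 0"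
proof -
  interpret Q: vector_space "\<lambda>(q::rat) (x::'v). of_rat q *\<^sub>R x"
    by unfold_locales (simp_all add: scaleR_add_right scaleR_add_left of_rat_add of_rat_mult)
  obtain B where B: "B \<subseteq> A" "Q.independent B" "A \<subseteq> Q.span B"
    using Q.maximal_independent_subset by blast
  have finB: "finite B" using B(1) assms finite_subset by blast
  have "\<exists>u. x = (\<Sum>b\<in>B. of_rat (u b) *\<^sub>R b)" if "x \<in> A" for x
    using B(3) that unfolding Q.span_finite[OF finB] by blast
  then obtain u where u: "\<And>x. x \<in> A \<Longrightarrow> x = (\<Sum>b\<in>B. of_rat (u x b) *\<^sub>R b)" by metis
  define q where "q = (\<Prod>(x,b)\<in>A \<times> B. snd (quotient_of (u x b)))"
  have q0: "q > 0" unfolding q_def by (intro prod_pos) (auto simp: quotient_of_denom_pos')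
  have int: "\<exists>k::int. of_int q * u x b = of_int k" if "x \<in> A" "b \<in> B" for x b
  proof -
    have "snd (quotient_of (u x b)) dvd q" unfolding q_def
      using dvd_prodI[of "A \<times> B" "(x,b)" "\<lambda>(x,b). snd (quotient_of (u x b))"] that assms finB by auto
    then obtain m where m: "q = snd (quotient_of (u x b)) * m" by blast
    have "u x b = of_int (fst (quotient_of (u x b))) / of_int (snd (quotient_of (u x b)))"
      by (rule quotient_of_div) simp
    moreover have "snd (quotient_of (u x b)) \<noteq> 0" using quotient_of_denom_pos'[of "u x b"] by linarith
    ultimately have "of_int q * u x b = of_int (m * fst (quotient_of (u x b)))"
      by (subst m) (simp add: field_simps)
    then show ?thesis by blast
  qed
  define s where "s b = (1 / real_of_int q) *\<^sub>R b" for b :: 'v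
  have inj: "inj_on s B" unfolding s_def using q0 by (auto intro!: inj_onI)
  have s: "real_of_int q *\<^sub>R s b = b" for b using q0 by (simp add: s_def)
  show thesis
  proof (rule that[of "s ` B"])
    show "finite (s ` B)" using finB by simp
    show "A \<subseteq> {\<Sum>g\<in>s ` B. of_int (k g) *\<^sub>R g |k. True}"
    proof
      fix x assume x: "x \<in> A"
      obtain k where k: "\<And>b. b \<in> B \<Longrightarrow> of_int q * u x b = rat_of_int (k b)" using int[OF x] by metis
      have "x = (\<Sum>b\<in>B. of_rat (u x b) *\<^sub>R b)" by (rule u[OF x])
      also have "\<dots> = (\<Sum>b\<in>B. of_int (k b) *\<^sub>R s b)"
      proof (rule sum.cong[OF refl])
        fix b assume b: "b \<in> B"
        have "real_of_rat (of_int q * u x b) = real_of_rat (of_int (k b))" by (simp only: k[OF b])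
        then have "real_of_int q * of_rat (u x b) = of_int (k b)" by (simp add: of_rat_mult)
        then have "of_int (k b) *\<^sub>R s b = of_rat (u x b) *\<^sub>R (real_of_int q *\<^sub>R s b)"
          by (simp add: mult.commute)
        then show "of_rat (u x b) *\<^sub>R b = of_int (k b) *\<^sub>R s b" by (simp only: s)
      qed
      also have "\<dots> = (\<Sum>g\<in>s ` B. of_int (k (inv_into B s g)) *\<^sub>R g)"
        by (simp add: sum.reindex[OF inj] inv_into_f_f[OF inj])
      finally show "x \<in> {\<Sum>g\<in>s ` B. of_int (k g) *\<^sub>R g |k. True}"
        by (intro CollectI exI[of _ "\<lambda>g. k (inv_into B s g)"] conjI TrueI)
    qed
    fix k :: "'v \<Rightarrow> int" assume "(\<Sum>g\<in>s ` B. of_int (k g) *\<^sub>R g) = 0"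
    then have "real_of_int q *\<^sub>R (\<Sum>b\<in>B. of_int (k (s b)) *\<^sub>R s b) = 0" by (simp add: sum.reindex[OF inj])
    moreover have "real_of_int q *\<^sub>R (\<Sum>b\<in>B. of_int (k (s b)) *\<^sub>R s b) = (\<Sum>b\<in>B. of_int (k (s b)) *\<^sub>R (real_of_int q *\<^sub>R s b))"
      by (simp add: scaleR_sum_right mult.commute)
    ultimately have 0: "(\<Sum>b\<in>B. of_rat (of_int (k (s b))) *\<^sub>R b) = 0" by (simp only: s of_rat_of_int_eq)
    show "\<forall>g\<in>s ` B. k g = 0"
    proof
      fix g assume "g \<in> s ` B"
      then obtain b where b: "b \<in> B" "g = s b" by blast
      have "rat_of_int (k (s b)) = 0"
        by (rule Q.independentD[OF B(2) finB subset_refl 0 b(1)])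
      then show "k g = 0" using b by simp
    qed
  qed
qed

text \<open>Additivity gives homogeneity over the integers, so
  \<open>A (t *\<^sub>R x) - t * A x\<close> depends only on the fractional part of \<open>t\<close>
  and is bounded. The error \<open>\<delta>\<close> at \<open>r\<close> becomes
  \<open>n * \<delta>\<close> at \<open>n * r\<close>, hence is 0.\<close>

lemma additive_bounded_imp_linear:
  fixes A :: "'v::real_normed_vector \<Rightarrow> real"
  assumes add: "\<And>x y. A (x + y) = A x + A y" and bd: "\<And>x. norm x \<le> 1 \<Longrightarrow> \<bar>A x\<bar> \<le> M"
  shows "linear A"
proof (rule linearI)
  fix r x
  have A0: "A 0 = 0" using add[of 0 0] by simp
  have nat: "A (real n *\<^sub>R y) = real n * A y" for n y
    by (induction n) (simp_all add: A0 add algebra_simps)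
  have minus: "A (- y) = - A y" for y using add[of y "- y"] A0 by simp
  have int: "A (of_int n *\<^sub>R y) = of_int n * A y" for n y
    by (cases n rule: int_cases2) (simp_all add: nat minus)
  show "A (r *\<^sub>R x) = r *\<^sub>R A x"
  proof -
    obtain N :: nat where N: "norm x \<le> real N" using real_arch_simple by blast
    obtain N' :: nat where N': "N' = N + 1" by simp
    define K where "K = real N' * M + \<bar>A x\<bar>"
    have bdd: "\<bar>A (t *\<^sub>R x) - t * A x\<bar> \<le> K" for t
    proof -
      have e: "t *\<^sub>R x = of_int \<lfloor>t\<rfloor> *\<^sub>R x + frac t *\<^sub>R x" by (simp add: frac_def algebra_simps)
      have f: "\<bar>frac t\<bar> \<le> 1" using frac_lt_1[of t] by (simp add: frac_ge_0 less_imp_le)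
      have "frac t *\<^sub>R x = real N' *\<^sub>R ((frac t / real N') *\<^sub>R x)" using N' by simp
      then have "A (frac t *\<^sub>R x) = real N' * A ((frac t / real N') *\<^sub>R x)" by (metis nat)
      moreover have "norm ((frac t / real N') *\<^sub>R x) \<le> 1"
      proof -
        have "\<bar>frac t\<bar> * norm x \<le> 1 * real N'" using f N N' by (intro mult_mono) auto
        then show ?thesis using N' by (simp add: divide_simps)
      qed
      ultimately have "\<bar>A (frac t *\<^sub>R x)\<bar> \<le> real N' * M" using bd by (simp add: abs_mult mult_left_mono)
      moreover have "A (t *\<^sub>R x) - t * A x = A (frac t *\<^sub>R x) - frac t * A x"
        using arg_cong[OF e, of A] by (simp add: add int frac_def left_diff_distrib)
      moreover have "\<bar>frac t * A x\<bar> \<le> \<bar>A x\<bar>" using f by (simp add: abs_mult mult_left_le_one_le)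
      ultimately show ?thesis unfolding K_def by linarith
    qed
    define \<delta> where "\<delta> = A (r *\<^sub>R x) - r * A x"
    have "real n * \<bar>\<delta>\<bar> \<le> K" for n
    proof -
      have "real n * \<delta> = A ((real n * r) *\<^sub>R x) - (real n * r) * A x"
        using nat[of n "r *\<^sub>R x"] by (simp add: \<delta>_def algebra_simps)
      then show ?thesis using bdd[of "real n * r"] by (metis abs_mult abs_of_nat)
    qed
    then have "\<bar>\<delta>\<bar> = 0"
      by (metis abs_ge_zero abs_le_zero_iff ex_less_of_nat_mult linorder_not_le order_antisym_conv)
    then show ?thesis by (simp add: \<delta>_def)
  qed
qed (rule add)

text \<open>The numbers \<open>\<phi> (2^n *\<^sub>R x) / 2^n\<close> change by at most
  \<open>K / 2^Suc n\<close> from one \<open>n\<close> to the next, so they converge; the limit is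
  additive because the defect is divided by \<open>2^n\<close>. The bound on the unit ball upgrades
  additive to linear.\<close>

lemma Hyers_Ulam:
  fixes \<phi> :: "'v::real_normed_vector \<Rightarrow> real"
  assumes quasi: "\<And>x y. \<bar>\<phi> (x + y) - \<phi> x - \<phi> y\<bar> \<le> K" and bd: "\<And>x. norm x \<le> 1 \<Longrightarrow> \<bar>\<phi> x\<bar> \<le> M"
  shows "\<exists>A. linear A \<and> (\<forall>x. \<bar>\<phi> x - A x\<bar> \<le> K)"
proof -
  define s where "s x n = \<phi> (2^n *\<^sub>R x) / 2^n" for x :: 'v and n :: nat
  have K0: "K \<ge> 0" using quasi[of 0 0] by linarith
  have step: "\<bar>s x (Suc n) - s x n\<bar> \<le> K * (1/2)^Suc n" for x n
  proof -
    have "\<bar>\<phi> (2^n *\<^sub>R x + 2^n *\<^sub>R x) - \<phi> (2^n *\<^sub>R x) - \<phi> (2^n *\<^sub>R x)\<bar> / 2^Suc n \<le> K / 2^Suc n"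
      by (intro divide_right_mono quasi) auto
    moreover have "2^n *\<^sub>R x + 2^n *\<^sub>R x = 2^Suc n *\<^sub>R x" by (simp flip: scaleR_add_left)
    moreover have "s x (Suc n) - s x n = (\<phi> (2^Suc n *\<^sub>R x) - \<phi> (2^n *\<^sub>R x) - \<phi> (2^n *\<^sub>R x)) / 2^Suc n"
      by (simp add: s_def field_simps)
    ultimately show ?thesis by (simp add: power_one_over abs_divide)
  qed
  have "summable (\<lambda>n. s x (Suc n) - s x n)" for x
  proof (rule summable_comparison_test')
    show "summable (\<lambda>n. K * (1/2)^Suc n)" by (intro summable_mult) (simp add: summable_geometric)
    show "norm (s x (Suc n) - s x n) \<le> K * (1/2)^Suc n" if "n \<ge> 0" for n using step by simp
  qed
  then have "convergent (s x)" for x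
    using summable_iff_convergent[of "\<lambda>n. s x (Suc n) - s x n"]
      convergent_add_const_iff[of "- s x 0" "s x"] by (simp add: sum_lessThan_telescope)
  then obtain A where A: "\<And>x. s x \<longlonglongrightarrow> A x" unfolding convergent_def by metis
  have close: "\<bar>\<phi> x - s x n\<bar> \<le> K * (1 - (1/2)^n)" for x n
  proof (induction n)
    case 0
    then show ?case by (simp add: s_def)
  next
    case (Suc n)
    have "K * (1 - (1/2)^n) + K * (1/2)^Suc n = K * (1 - (1/2)^Suc n)" by (simp add: algebra_simps)
    then show ?case using step[of x n] Suc.IH by linarith
  qed
  have phiA: "\<bar>\<phi> x - A x\<bar> \<le> K" for x
  proof (rule tendsto_upperbound)
    show "(\<lambda>n. \<bar>\<phi> x - s x n\<bar>) \<longlonglongrightarrow> \<bar>\<phi> x - A x\<bar>" by (intro tendsto_intros A)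
    have "K * (1 - (1/2)^n) \<le> K * 1" for n using K0 by (intro mult_left_mono) auto
    then show "\<forall>\<^sub>F n in sequentially. \<bar>\<phi> x - s x n\<bar> \<le> K"
      using close by (intro always_eventually allI) (metis mult_1_right order_trans)
  qed simp
  have "A (x + y) = A x + A y" for x y
  proof -
    have "(\<lambda>n. s (x + y) n - s x n - s y n) \<longlonglongrightarrow> A (x + y) - A x - A y" by (intro tendsto_intros A)
    moreover have "(\<lambda>n. s (x + y) n - s x n - s y n) \<longlonglongrightarrow> 0"
    proof (rule Lim_null_comparison)
      show "\<forall>\<^sub>F n in sequentially. norm (s (x + y) n - s x n - s y n) \<le> K * (1/2)^n"
      proof (intro always_eventually allI)
        fix n
        have "\<bar>\<phi> (2^n *\<^sub>R x + 2^n *\<^sub>R y) - \<phi> (2^n *\<^sub>R x) - \<phi> (2^n *\<^sub>R y)\<bar> / 2^n \<le> K / 2^n"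
          by (intro divide_right_mono quasi) auto
        then show "norm (s (x + y) n - s x n - s y n) \<le> K * (1/2)^n"
          by (simp add: s_def scaleR_add_right power_one_over abs_divide flip: diff_divide_distrib)
      qed
      have "(\<lambda>n. K * (1/2)^n) \<longlonglongrightarrow> K * 0" by (intro tendsto_intros) (simp add: LIMSEQ_realpow_zero)
      then show "(\<lambda>n. K * (1/2)^n) \<longlonglongrightarrow> 0" by simp
    qed
    ultimately show ?thesis using LIMSEQ_unique by fastforce
  qed
  moreover have "\<bar>A x\<bar> \<le> M + K" if "norm x \<le> 1" for x using bd[OF that] phiA[of x] by linarith
  ultimately have "linear A" by (rule additive_bounded_imp_linear)
  with phiA show ?thesis by blast
qed

text \<open>The key use of the Meyer property. Nearby points \<open>p x\<close> of
  \<open>\<Lambda>\<close> extend \<open>h\<close> to a function \<open>\<phi>\<close> on the whole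
  space, whose defect of additivity is \<open>h\<close> at an iterated difference of bounded norm.
  There are only finitely many of these, so the defect is bounded and \<open>Hyers_Ulam\<close>
  applies.\<close>

lemma additive_on_Meyer_set_almost_linear:
  fixes \<Lambda> V :: "'v::euclidean_space set" and h :: "'v \<Rightarrow> real"
  assumes Meyer: "Meyer_set \<Lambda>"
    and V: "difference_set \<Lambda> \<subseteq> V" "\<And>v w. v \<in> V \<Longrightarrow> w \<in> V \<Longrightarrow> v - w \<in> V"
    and h: "\<And>v w. v \<in> V \<Longrightarrow> w \<in> V \<Longrightarrow> h (v - w) = h v - h w"
  shows "\<exists>a B. \<forall>d\<in>difference_set \<Lambda>. \<bar>h d - a \<bullet> d\<bar> \<le> B"
proof -
  have "relatively_dense \<Lambda>" using Meyer by (simp add: Meyer_set_def Delone_set_def)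
  then obtain R where R: "R > 0" "\<And>x. \<exists>p\<in>\<Lambda>. norm (p - x) \<le> R" by (rule relatively_denseE) blast
  obtain p where p: "\<And>x. p x \<in> \<Lambda>" "\<And>x. norm (p x - x) \<le> R" using R(2) by metis
  define c where "c = p 0"
  define \<phi> where "\<phi> x = h (p x - c)" for x
  have D: "x - y \<in> difference_set \<Lambda>" if "x \<in> \<Lambda>" "y \<in> \<Lambda>" for x y
    using that by (auto simp: difference_set_def)
  have E: "discrete_closed_set (difference_set (difference_set \<Lambda>))" by (rule Meyer_set_iterated_difference[OF Meyer])
  have D0: "0 \<in> difference_set \<Lambda>" using D[OF p(1) p(1), of 0 0] by simp
  have D_E: "d \<in> difference_set (difference_set \<Lambda>)" if "d \<in> difference_set \<Lambda>" for d
    unfolding difference_set_def[of "difference_set \<Lambda>"] using that D0 by (intro CollectI exI[of _ d] exI[of _ 0]) auto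
  have "\<exists>K. \<forall>e\<in>difference_set (difference_set \<Lambda>) \<inter> cball 0 r. \<bar>h e\<bar> \<le> K" for r
  proof -
    have "finite (h ` (difference_set (difference_set \<Lambda>) \<inter> cball 0 r))"
      by (intro finite_imageI discrete_closed_setD[OF E]) auto
    then have "bounded (h ` (difference_set (difference_set \<Lambda>) \<inter> cball 0 r))" by (rule finite_imp_bounded)
    then show ?thesis unfolding bounded_iff by auto
  qed
  then obtain K where K: "\<And>r e. e \<in> difference_set (difference_set \<Lambda>) \<Longrightarrow> norm e \<le> r \<Longrightarrow> \<bar>h e\<bar> \<le> K r"
    by (metis IntI mem_cball_0)
  have quasi: "\<bar>\<phi> (x + y) - \<phi> x - \<phi> y\<bar> \<le> K (3 * R + norm c)" for x y
  proof -
    have V1: "p (x + y) - c \<in> V" "p x - c \<in> V" "p y - c \<in> V" "p (x + y) - p x \<in> V"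
      using D p(1) V(1) by (auto simp: c_def)
    have "\<phi> (x + y) - \<phi> x = h (p (x + y) - p x)"
      using h[OF V1(1,2)] by (simp add: \<phi>_def)
    then have "\<phi> (x + y) - \<phi> x - \<phi> y = h ((p (x + y) - p x) - (p y - c))"
      using h[OF V1(4,3)] by (simp add: \<phi>_def)
    moreover have "(p (x + y) - p x) - (p y - c) \<in> difference_set (difference_set \<Lambda>)"
      unfolding difference_set_def[of "difference_set \<Lambda>"] c_def using D p(1) by blast
    moreover have "norm ((p (x + y) - p x) - (p y - c)) \<le> 3 * R + norm c"
    proof -
      have "(p (x + y) - p x) - (p y - c) = (p (x + y) - (x + y)) - (p x - x) - (p y - y) + c" by simp
      then have "norm ((p (x + y) - p x) - (p y - c))
          \<le> norm (p (x + y) - (x + y)) + norm (p x - x) + norm (p y - y) + norm c"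
        by (smt (verit) norm_triangle_ineq norm_triangle_ineq4)
      then show ?thesis using p(2)[of "x + y"] p(2)[of x] p(2)[of y] by linarith
    qed
    ultimately show ?thesis using K by simp
  qed
  have "\<bar>\<phi> x\<bar> \<le> K (R + 1 + norm c)" if "norm x \<le> 1" for x
    unfolding \<phi>_def
  proof (rule K)
    show "p x - c \<in> difference_set (difference_set \<Lambda>)" using D_E D p(1) by (simp add: c_def)
    have "p x - c = (p x - x) + x - c" by simp
    then have "norm (p x - c) \<le> norm (p x - x) + norm x + norm c"
      by (smt (verit) norm_triangle_ineq norm_triangle_ineq4)
    then show "norm (p x - c) \<le> R + 1 + norm c" using p(2)[of x] that by linarith
  qed
  with quasi obtain A where A: "linear A" "\<And>x. \<bar>\<phi> x - A x\<bar> \<le> K (3 * R + norm c)"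
    using Hyers_Ulam[of \<phi> "K (3 * R + norm c)" "K (R + 1 + norm c)"] by blast
  define a where "a = adjoint A 1"
  have a: "A x = a \<bullet> x" for x
    using adjoint_works[OF A(1), of x 1] by (simp add: a_def inner_commute)
  have near: "\<bar>h (x - c) - A x\<bar> \<le> K R + K (3 * R + norm c)" if "x \<in> \<Lambda>" for x
  proof -
    have "h (x - c) - \<phi> x = h (x - p x)"
      using h[of "x - c" "p x - c"] V(1) D that p(1) by (auto simp: \<phi>_def c_def subset_iff)
    moreover have "\<bar>h (x - p x)\<bar> \<le> K R"
      by (rule K[OF D_E[OF D]]) (use that p in \<open>auto simp: norm_minus_commute\<close>)
    ultimately show ?thesis using A(2)[of x] by linarith
  qed
  have "\<bar>h d - a \<bullet> d\<bar> \<le> 2 * (K R + K (3 * R + norm c))" if d: "d \<in> difference_set \<Lambda>" for d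
  proof -
    obtain x y where xy: "x \<in> \<Lambda>" "y \<in> \<Lambda>" "d = x - y" using d by (auto simp: difference_set_def)
    have "h d = h (x - c) - h (y - c)"
      using h[of "x - c" "y - c"] V(1) D xy p(1) by (auto simp: c_def subset_iff)
    moreover have "a \<bullet> d = A x - A y" by (simp add: a xy inner_diff_right)
    ultimately have "h d - a \<bullet> d = (h (x - c) - A x) - (h (y - c) - A y)" by simp
    then have "\<bar>h d - a \<bullet> d\<bar> \<le> \<bar>h (x - c) - A x\<bar> + \<bar>h (y - c) - A y\<bar>"
      by (simp only: abs_triangle_ineq4)
    then show ?thesis using near[OF xy(1)] near[OF xy(2)] by simp
  qed
  then show ?thesis by blast
qed

text \<open>Each integer coordinate is additive on a group that contains the differences, hence
  almost linear on them: \<open>a g\<close> is the slope and \<open>b d g\<close> the bounded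
  error.\<close>

theorem Meyer_set_coordinates:
  fixes \<Lambda> :: "'v::euclidean_space set"
  assumes Meyer: "Meyer_set \<Lambda>"
  obtains G :: "'v set" and a b B where "finite G"
    "\<And>d g. d \<in> difference_set \<Lambda> \<Longrightarrow> g \<in> G \<Longrightarrow> a g \<bullet> d + b d g \<in> \<int>"
    "\<And>d g. d \<in> difference_set \<Lambda> \<Longrightarrow> g \<in> G \<Longrightarrow> \<bar>b d g\<bar> \<le> B"
    "\<And>d. d \<in> difference_set \<Lambda> \<Longrightarrow> (\<Sum>g\<in>G. b d g *\<^sub>R g) = 0"
    "\<And>x. (\<Sum>g\<in>G. (a g \<bullet> x) *\<^sub>R g) = x"
    "\<And>k :: 'v \<Rightarrow> int. (\<Sum>g\<in>G. of_int (k g) *\<^sub>R g) = 0 \<Longrightarrow> \<forall>g\<in>G. k g = 0"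
proof -
  have "relatively_dense \<Lambda>" using Meyer by (simp add: Meyer_set_def Delone_set_def)
  then obtain R where R: "R > 0" "\<And>x. \<exists>p\<in>\<Lambda>. norm (p - x) \<le> R" by (rule relatively_denseE) blast
  obtain c where c: "c \<in> \<Lambda>" using R(2) by blast
  have c0: "c - c \<in> difference_set \<Lambda>" unfolding difference_set_def using c by blast
  have "discrete_closed_set (difference_set \<Lambda>)"
  proof (rule discrete_closed_set_subset[OF Meyer_set_iterated_difference[OF Meyer]])
    show "difference_set \<Lambda> \<subseteq> difference_set (difference_set \<Lambda>)"
    proof
      fix d assume "d \<in> difference_set \<Lambda>"
      then show "d \<in> difference_set (difference_set \<Lambda>)"
        using c0 unfolding difference_set_def[of "difference_set \<Lambda>"] by (intro CollectI exI[of _ d] exI[of _ 0]) auto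
    qed
  qed
  then have fin: "finite (difference_set \<Lambda> \<inter> cball 0 (2 * R + 1))" by (rule discrete_closed_setD) auto
  obtain G where G: "finite G"
    "difference_set \<Lambda> \<inter> cball 0 (2 * R + 1) \<subseteq> {\<Sum>g\<in>G. of_int (k g) *\<^sub>R g |k. True}"
    "\<And>k :: 'v \<Rightarrow> int. (\<Sum>g\<in>G. of_int (k g) *\<^sub>R g) = 0 \<Longrightarrow> \<forall>g\<in>G. k g = 0"
    by (rule finitely_generated_integer_basis[OF fin]) (rule that, assumption+)
  define S where "S k = (\<Sum>g\<in>G. of_int (k g) *\<^sub>R g)" for k :: "'v \<Rightarrow> int"
  have S_diff: "S k - S l = S (\<lambda>g. k g - l g)" for k l
    by (simp add: S_def scaleR_diff_left sum_subtractf)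
  have S_add: "S k + S l = S (\<lambda>g. k g + l g)" for k l
    by (simp add: S_def scaleR_add_left sum.distrib)
  have S_inj: "k g = l g" if "S k = S l" "g \<in> G" for k l g
    using G(3)[of "\<lambda>g. k g - l g"] S_diff[of k l] that by (simp add: S_def)
  define V where "V = range S"
  \<comment> \<open>The chosen coefficients are unique on \<open>G\<close> only, by
    \<open>S_inj\<close>; values off \<open>G\<close> are arbitrary. So additivity is claimed
    pointwise for \<open>g \<in> G\<close>.\<close>
  define \<kappa> where "\<kappa> v = (SOME k. v = S k)" for v
  have \<kappa>: "v = S (\<kappa> v)" if "v \<in> V" for v
  proof -
    have "\<exists>k. v = S k" using that by (auto simp: V_def)
    then show ?thesis unfolding \<kappa>_def by (rule someI_ex)
  qed
  have V_diff: "v - w \<in> V" if "v \<in> V" "w \<in> V" for v w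
    using that S_diff by (auto simp: V_def)
  have DV: "difference_set \<Lambda> \<subseteq> V"
  proof (rule difference_set_generated[OF R])
    show "0 \<in> V" unfolding V_def S_def by (rule range_eqI[of _ _ "\<lambda>_. 0"]) simp
    show "v + w \<in> V" if "v \<in> V" "w \<in> V" for v w using that S_add by (auto simp: V_def)
    show "difference_set \<Lambda> \<inter> cball 0 (2 * R + 1) \<subseteq> V" using G(2) by (auto simp: V_def S_def)
  qed
  have \<kappa>_diff: "\<kappa> (v - w) g = \<kappa> v g - \<kappa> w g" if "v \<in> V" "w \<in> V" "g \<in> G" for v w g
  proof (rule S_inj[where g = g])
    show "S (\<kappa> (v - w)) = S (\<lambda>g. \<kappa> v g - \<kappa> w g)"
      using \<kappa>[OF V_diff[OF that(1,2)]] \<kappa>[OF that(1)] \<kappa>[OF that(2)] S_diff by metis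
  qed fact
  have "\<forall>g\<in>G. \<exists>a B. \<forall>d\<in>difference_set \<Lambda>. \<bar>of_int (\<kappa> d g) - a \<bullet> d\<bar> \<le> B"
  proof
    fix g assume g: "g \<in> G"
    show "\<exists>a B. \<forall>d\<in>difference_set \<Lambda>. \<bar>of_int (\<kappa> d g) - a \<bullet> d\<bar> \<le> B"
      by (rule additive_on_Meyer_set_almost_linear[OF Meyer DV V_diff]) (simp_all add: \<kappa>_diff g)
  qed
  then obtain a B where aB: "\<And>g d. g \<in> G \<Longrightarrow> d \<in> difference_set \<Lambda> \<Longrightarrow> \<bar>of_int (\<kappa> d g) - a g \<bullet> d\<bar> \<le> B g"
    by metis
  define b where "b d g = of_int (\<kappa> d g) - a g \<bullet> d" for d g
  \<comment> \<open>On differences \<open>T\<close> equals the sum of the bounded errors. The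
    differences are relatively dense, so the linear map \<open>T\<close> is bounded on the whole
    space and therefore 0, which gives both the identity for \<open>b\<close> and the one for
    \<open>a\<close>.\<close>
  define T where "T x = x - (\<Sum>g\<in>G. (a g \<bullet> x) *\<^sub>R g)" for x
  have T: "T d = (\<Sum>g\<in>G. b d g *\<^sub>R g)" if "d \<in> difference_set \<Lambda>" for d
    using \<kappa>[of d] DV that by (auto simp: T_def S_def b_def scaleR_diff_left sum_subtractf)
  have linT: "linear T"
    by (rule linearI) (simp_all add: T_def inner_add_right scaleR_add_left sum.distrib scaleR_sum_right scaleR_diff_right)
  define M where "M = onorm T * R + (\<Sum>g\<in>G. B g * norm g)"
  have blT: "bounded_linear T" using linT linear_conv_bounded_linear by blast
  have T_bound: "norm (T x) \<le> M" for x
  proof -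
    obtain q where q: "q \<in> \<Lambda>" "norm (q - (x + c)) \<le> R" using R(2) by blast
    define d where "d = q - c"
    have d: "d \<in> difference_set \<Lambda>" using q(1) c by (auto simp: d_def difference_set_def)
    have "norm (x - d) \<le> R" using q(2) by (simp add: d_def norm_minus_commute algebra_simps)
    have "norm (T (x - d)) \<le> onorm T * norm (x - d)" by (rule onorm[OF blT])
    also have "\<dots> \<le> onorm T * R" using \<open>norm (x - d) \<le> R\<close> onorm_pos_le[OF blT] by (intro mult_left_mono)
    finally have 1: "norm (T (x - d)) \<le> onorm T * R" .
    have 2: "norm (T d) \<le> (\<Sum>g\<in>G. B g * norm g)"
      unfolding T[OF d] by (rule sum_norm_le) (use aB d in \<open>auto simp: b_def intro!: mult_right_mono\<close>)
    have "T x = T (x - d) + T d" using linear_add[OF linT, of "x - d" d] by simp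
    then show ?thesis using 1 2 norm_triangle_ineq[of "T (x - d)" "T d"] by (simp add: M_def)
  qed
  have T0: "T x = 0" for x
  proof (rule ccontr)
    assume "T x \<noteq> 0"
    then obtain n where n: "M < real n * norm (T x)" using ex_less_of_nat_mult[of "norm (T x)" M] by auto
    have "norm (T (real n *\<^sub>R x)) = real n * norm (T x)" by (simp add: linear_cmul[OF linT])
    with T_bound[of "real n *\<^sub>R x"] n show False by simp
  qed
  show thesis
  proof (rule that[of G a b "\<Sum>g\<in>G. \<bar>B g\<bar>"])
    show "a g \<bullet> d + b d g \<in> \<int>" for d g by (simp add: b_def)
    show "\<bar>b d g\<bar> \<le> (\<Sum>g\<in>G. \<bar>B g\<bar>)" if "d \<in> difference_set \<Lambda>" "g \<in> G" for d g
    proof -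
      have "\<bar>b d g\<bar> \<le> B g" using aB that by (simp add: b_def)
      also have "\<dots> \<le> \<bar>B g\<bar>" by simp
      also have "\<dots> \<le> (\<Sum>g\<in>G. \<bar>B g\<bar>)" by (rule member_le_sum) (use that G(1) in auto)
      finally show ?thesis .
    qed
    show "(\<Sum>g\<in>G. b d g *\<^sub>R g) = 0" if "d \<in> difference_set \<Lambda>" for d using T[OF that] T0 by simp
    show "(\<Sum>g\<in>G. (a g \<bullet> x) *\<^sub>R g) = x" for x using T0[of x] by (simp add: T_def)
  qed (use G in auto)
qed

section \<open>Positive variations and atomic measures\<close>

definition signed_measure :: "('a::metric_space set \<Rightarrow> real) \<Rightarrow> bool" where
  "signed_measure \<nu> \<longleftrightarrow>
     (\<forall>A::nat \<Rightarrow> 'a set. range A \<subseteq> bounded_borel \<and> disjoint_family A \<and> bounded (\<Union>i. A i) \<longrightarrow>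
        (\<lambda>i. \<nu> (A i)) sums \<nu> (\<Union>i. A i))"

lemma bounded_borelI: "B \<in> sets borel \<Longrightarrow> bounded B \<Longrightarrow> B \<in> bounded_borel"
  by (simp add: bounded_borel_def)

lemma bounded_borel_empty [simp]: "{} \<in> bounded_borel"
  by (simp add: bounded_borel_def)

lemma bounded_borel_Int_left: "A \<in> sets borel \<Longrightarrow> B \<in> bounded_borel \<Longrightarrow> A \<inter> B \<in> bounded_borel"
  by (auto simp: bounded_borel_def bounded_Int)

lemma bounded_borel_Int_right: "A \<in> sets borel \<Longrightarrow> B \<in> bounded_borel \<Longrightarrow> B \<inter> A \<in> bounded_borel"
  by (auto simp: bounded_borel_def bounded_Int)

lemma bounded_borel_Diff: "A \<in> sets borel \<Longrightarrow> B \<in> bounded_borel \<Longrightarrow> B - A \<in> bounded_borel"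
  by (auto simp: bounded_borel_def bounded_diff)

lemma bounded_borel_Un: "A \<in> bounded_borel \<Longrightarrow> B \<in> bounded_borel \<Longrightarrow> A \<union> B \<in> bounded_borel"
  by (auto simp: bounded_borel_def)

lemma bounded_borel_finite: "finite (F :: 'a::metric_space set) \<Longrightarrow> F \<in> bounded_borel"
  by (auto simp: bounded_borel_def finite_imp_bounded intro: borel_closed finite_imp_closed)

lemma cmeasureD:
  fixes A :: "nat \<Rightarrow> 'a::metric_space set"
  assumes "cmeasure \<mu>" "\<And>i. A i \<in> bounded_borel" "disjoint_family A" "bounded (\<Union>i. A i)"
  shows "(\<lambda>i. \<mu> (A i)) sums \<mu> (\<Union>i. A i)"
proof -
  have "range A \<subseteq> bounded_borel" using assms(2) by auto
  with assms show ?thesis unfolding cmeasure_def by blast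
qed

lemma signed_measureD:
  fixes A :: "nat \<Rightarrow> 'a::metric_space set"
  assumes "signed_measure \<mu>" "\<And>i. A i \<in> bounded_borel" "disjoint_family A" "bounded (\<Union>i. A i)"
  shows "(\<lambda>i. \<mu> (A i)) sums \<mu> (\<Union>i. A i)"
proof -
  have "range A \<subseteq> bounded_borel" using assms(2) by auto
  with assms show ?thesis unfolding signed_measure_def by blast
qed

lemma signed_measure_of_cmeasure:
  assumes "cmeasure \<mu>"
  shows "signed_measure (\<lambda>B. Re (\<mu> B))" "signed_measure (\<lambda>B. - Re (\<mu> B))"
    "signed_measure (\<lambda>B. Im (\<mu> B))" "signed_measure (\<lambda>B. - Im (\<mu> B))"
proof -
  have *: "(\<lambda>i. \<mu> (A i)) sums \<mu> (\<Union>i. A i)"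
    if "range A \<subseteq> bounded_borel \<and> disjoint_family A \<and> bounded (\<Union>i. A i)" for A :: "nat \<Rightarrow> 'a set"
    using assms that unfolding cmeasure_def by blast
  show "signed_measure (\<lambda>B. Re (\<mu> B))" "signed_measure (\<lambda>B. - Re (\<mu> B))"
    "signed_measure (\<lambda>B. Im (\<mu> B))" "signed_measure (\<lambda>B. - Im (\<mu> B))"
    unfolding signed_measure_def using sums_Re[OF *] sums_Im[OF *] sums_minus[OF sums_Re[OF *]] sums_minus[OF sums_Im[OF *]]
    by (intro allI impI; simp)+
qed

lemma cmeasure_of_signed_measure:
  "signed_measure \<nu> \<Longrightarrow> cmeasure (\<lambda>B. complex_of_real (\<nu> B))"
  unfolding signed_measure_def cmeasure_def by (intro allI impI) (simp add: sums_of_real)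

lemma cmeasure_empty: 
  assumes "cmeasure \<mu>" shows "\<mu> {} = 0"
proof -
  have "(\<lambda>i::nat. \<mu> {}) sums \<mu> (\<Union>i::nat. {})"
    by (rule cmeasureD[OF assms]) (auto simp: disjoint_family_on_def)
  then have "summable (\<lambda>i::nat. \<mu> {})" by (rule sums_summable)
  then show ?thesis by (simp add: summable_const_iff)
qed

lemma cmeasure_Un:
  assumes \<mu>: "cmeasure \<mu>" and AB: "A \<in> bounded_borel" "B \<in> bounded_borel" "A \<inter> B = {}"
  shows "\<mu> (A \<union> B) = \<mu> A + \<mu> B"
proof -
  define S where "S i = (if i = 0 then A else if i = 1 then B else {})" for i :: nat
  have U: "(\<Union>i. S i) = A \<union> B"
  proof
    show "A \<union> B \<subseteq> (\<Union>i. S i)"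
      using UN_upper[of 0 UNIV S] UN_upper[of 1 UNIV S] by (auto simp: S_def)
  qed (auto simp: S_def split: if_splits)
  have "(\<lambda>i. \<mu> (S i)) sums \<mu> (\<Union>i. S i)"
  proof (rule cmeasureD[OF \<mu>])
    show "S i \<in> bounded_borel" for i using AB by (simp add: S_def)
    show "disjoint_family S" using AB(3) by (auto simp: disjoint_family_on_def S_def)
    show "bounded (\<Union>i. S i)" unfolding U using AB by (simp add: bounded_borel_def)
  qed
  moreover have "(\<lambda>i. \<mu> (S i)) sums (\<Sum>i\<in>{0,1}. \<mu> (S i))"
    by (rule sums_finite) (auto simp: S_def cmeasure_empty[OF \<mu>])
  ultimately have "\<mu> (\<Union>i. S i) = (\<Sum>i\<in>{0,1}. \<mu> (S i))" by (rule sums_unique2)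
  then show ?thesis unfolding U by (simp add: S_def)
qed

lemma cmeasure_Diff:
  assumes "cmeasure \<mu>" "A \<in> bounded_borel" "B \<in> bounded_borel" "A \<subseteq> B"
  shows "\<mu> (B - A) = \<mu> B - \<mu> A"
proof -
  have "B - A \<in> bounded_borel" using assms by (intro bounded_borel_Diff) (auto simp: bounded_borel_def)
  from cmeasure_Un[OF assms(1,2) this] assms(4) have "\<mu> (A \<union> (B - A)) = \<mu> A + \<mu> (B - A)" by simp
  moreover have "A \<union> (B - A) = B" using assms(4) by auto
  ultimately show ?thesis by simp
qed

lemma signed_measure_empty: "signed_measure \<nu> \<Longrightarrow> \<nu> {} = 0"
  using cmeasure_empty[OF cmeasure_of_signed_measure] by fastforce

lemma signed_measure_Un:
  assumes "signed_measure \<nu>" "A \<in> bounded_borel" "B \<in> bounded_borel" "A \<inter> B = {}"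
  shows "\<nu> (A \<union> B) = \<nu> A + \<nu> B"
  using cmeasure_Un[OF cmeasure_of_signed_measure[OF assms(1)] assms(2-4)]
  by (simp flip: of_real_add)

lemma signed_measure_Diff:
  assumes "signed_measure \<nu>" "A \<in> bounded_borel" "B \<in> bounded_borel" "A \<subseteq> B"
  shows "\<nu> (B - A) = \<nu> B - \<nu> A"
  using cmeasure_Diff[OF cmeasure_of_signed_measure[OF assms(1)] assms(2-4)]
  by (simp flip: of_real_diff)

lemma ennreal_sums_le:
  assumes "f sums s" shows "ennreal s \<le> (\<Sum>i. ennreal (f i))"
proof (rule LIMSEQ_le_const2)
  show "(\<lambda>n. ennreal (\<Sum>i<n. f i)) \<longlonglongrightarrow> ennreal s"
    using assms unfolding sums_def by (intro tendsto_ennrealI)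
  have "ennreal (\<Sum>i<n. f i) \<le> (\<Sum>i. ennreal (f i))" for n
  proof -
    have "ennreal (\<Sum>i<n. f i) \<le> ennreal (\<Sum>i<n. max 0 (f i))" by (intro ennreal_leI sum_mono) auto
    also have "\<dots> = (\<Sum>i<n. ennreal (max 0 (f i)))" by (rule sum_ennreal[symmetric]) simp
    also have "\<dots> = (\<Sum>i<n. ennreal (f i))" by (simp add: ennreal_max_0)
    also have "\<dots> \<le> (\<Sum>i. ennreal (f i))" by (rule sum_le_suminf) auto
    finally show ?thesis .
  qed
  then show "\<exists>N. \<forall>n\<ge>N. ennreal (\<Sum>i<n. f i) \<le> (\<Sum>i. ennreal (f i))" by blast
qed

lemma sets_pos_variation [simp, measurable_cong]: "sets (pos_variation \<nu>) = sets borel"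
  using sets.sigma_sets_eq[of borel] by (simp add: pos_variation_def)

lemma space_pos_variation [simp]: "space (pos_variation \<nu>) = UNIV"
  by (simp add: pos_variation_def space_measure_of_conv)

text \<open>\<open>measure_of\<close> returns the given set function only if it is a measure, so
  countable additivity has to be proved. One inequality is superadditivity on disjoint sets; for the
  other a bounded \<open>B\<close> is cut along the sets \<open>A i\<close>.\<close>

lemma emeasure_pos_variation:
  fixes \<nu> :: "'a::metric_space set \<Rightarrow> real"
  assumes \<nu>: "signed_measure \<nu>" and E: "E \<in> sets borel"
  shows "emeasure (pos_variation \<nu>) E = (SUP B \<in> {B \<in> bounded_borel. B \<subseteq> E}. ennreal (\<nu> B))"
proof -
  define f where "f E = (SUP B \<in> {B \<in> bounded_borel. B \<subseteq> E}. ennreal (\<nu> B))" for E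
  have super: "f A + f B \<le> f (A \<union> B)" if AB: "A \<inter> B = {}" for A B
  proof -
    have ne: "{C \<in> bounded_borel. C \<subseteq> X} \<noteq> {}" for X :: "'a set" using bounded_borel_empty by blast
    have ub: "ennreal (\<nu> C) \<le> f X" if "C \<in> bounded_borel" "C \<subseteq> X" for C X
      unfolding f_def using that by (intro SUP_upper) simp
    have "ennreal (\<nu> C) + ennreal (\<nu> C') \<le> f (A \<union> B)"
      if C: "C \<in> bounded_borel" "C \<subseteq> A" and C': "C' \<in> bounded_borel" "C' \<subseteq> B" for C C'
    proof -
      consider "\<nu> C \<le> 0" | "\<nu> C' \<le> 0" | "\<nu> C > 0" "\<nu> C' > 0" by linarith
      then show ?thesis
      proof cases
        case 1
        then have "ennreal (\<nu> C) = 0" by (simp add: ennreal_eq_0_iff)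
        then show ?thesis using ub[OF C'(1), of "A \<union> B"] C'(2) by (simp add: le_supI2)
      next
        case 2
        then have "ennreal (\<nu> C') = 0" by (simp add: ennreal_eq_0_iff)
        then show ?thesis using ub[OF C(1), of "A \<union> B"] C(2) by (simp add: le_supI1)
      next
        case 3
        have "ennreal (\<nu> C) + ennreal (\<nu> C') = ennreal (\<nu> (C \<union> C'))"
        proof -
          have "C \<inter> C' = {}" using C(2) C'(2) AB by blast
          from signed_measure_Un[OF \<nu> C(1) C'(1) this] show ?thesis using 3 by simp
        qed
        also have "\<dots> \<le> f (A \<union> B)"
          using C C' by (intro ub bounded_borel_Un) auto
        finally show ?thesis .
      qed
    qed
    then have "f A + ennreal (\<nu> C') \<le> f (A \<union> B)" if "C' \<in> bounded_borel" "C' \<subseteq> B" for C'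
      unfolding f_def[of A] using that by (subst ennreal_SUP_add_left[OF ne, symmetric]) (auto intro!: SUP_least)
    then show ?thesis
      unfolding f_def[of B] by (subst ennreal_SUP_add_right[OF ne]) (auto intro!: SUP_least)
  qed
  have f0: "f {} = 0"
  proof -
    have "{B \<in> bounded_borel. B \<subseteq> {}} = {{} :: 'a set}" by auto
    then show ?thesis by (simp add: f_def signed_measure_empty[OF \<nu>])
  qed
  have f_mono: "f A \<le> f B" if "A \<subseteq> B" for A B
    unfolding f_def by (rule SUP_subset_mono) (use that in auto)
  have "countably_additive (sets borel) f"
    unfolding countably_additive_def
  proof (intro allI impI)
    fix A :: "nat \<Rightarrow> 'a set" assume A: "range A \<subseteq> sets borel" "disjoint_family A"
    show "(\<Sum>i. f (A i)) = f (\<Union>i. A i)"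
    proof (rule antisym)
      have "(\<Sum>i<n. f (A i)) \<le> f (\<Union>i<n. A i)" for n
      proof (induction n)
        case (Suc n)
        have "(\<Union>i<n. A i) \<inter> A n = {}" 
        proof -
          have "A i \<inter> A n = {}" if "i < n" for i
            using disjoint_family_onD[OF A(2), of i n] that by simp
          then show ?thesis by blast
        qed
        from super[OF this] have "f (\<Union>i<n. A i) + f (A n) \<le> f (\<Union>i<Suc n. A i)"
          by (simp add: lessThan_Suc Un_commute)
        with add_right_mono[OF Suc, of "f (A n)"]
        have "(\<Sum>i<n. f (A i)) + f (A n) \<le> f (\<Union>i<Suc n. A i)" by (rule order_trans)
        then show ?case by simp
      qed (simp add: f0)
      then have "(\<Sum>i<n. f (A i)) \<le> f (\<Union>i. A i)" for n
        using f_mono[of "\<Union>i<n. A i" "\<Union>i. A i"] order_trans by blast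
      then show "(\<Sum>i. f (A i)) \<le> f (\<Union>i. A i)" by (intro suminf_le_const) auto
      show "f (\<Union>i. A i) \<le> (\<Sum>i. f (A i))"
        unfolding f_def[of "\<Union>i. A i"]
      proof (rule SUP_least)
        fix B assume "B \<in> {B \<in> bounded_borel. B \<subseteq> (\<Union>i. A i)}"
        then have B: "B \<in> bounded_borel" "B \<subseteq> (\<Union>i. A i)" by auto
        have BA: "B \<inter> A i \<in> bounded_borel" for i using B(1) A(1) by (intro bounded_borel_Int_right) auto
        have eq: "(\<Union>i. B \<inter> A i) = B" using B(2) by auto
        have "(\<lambda>i. \<nu> (B \<inter> A i)) sums \<nu> (\<Union>i. B \<inter> A i)"
        proof (rule signed_measureD[OF \<nu> BA])
          show "disjoint_family (\<lambda>i. B \<inter> A i)" using A(2) by (auto simp: disjoint_family_on_def)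
          show "bounded (\<Union>i. B \<inter> A i)" unfolding eq using B(1) by (simp add: bounded_borel_def)
        qed
        then have "ennreal (\<nu> B) \<le> (\<Sum>i. ennreal (\<nu> (B \<inter> A i)))" unfolding eq by (rule ennreal_sums_le)
        also have "\<dots> \<le> (\<Sum>i. f (A i))"
          unfolding f_def using BA by (intro suminf_le SUP_upper) auto
        finally show "ennreal (\<nu> B) \<le> (\<Sum>i. f (A i))" .
      qed
    qed
  qed
  moreover have "positive (sets borel) f" using f0 by (simp add: positive_def)
  moreover have "pos_variation \<nu> = measure_of UNIV (sets borel) f"
    by (simp add: pos_variation_def f_def[abs_def])
  ultimately have "emeasure (pos_variation \<nu>) E = f E"
    using E emeasure_measure_of_sigma[of UNIV "sets borel" f E] sets.sigma_algebra_axioms[of borel] by simp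
  then show ?thesis by (simp add: f_def)
qed

text \<open>If the values on subsets of \<open>E\<close> were unbounded, there would be a decreasing
  sequence of sets with the same defect whose successive differences all have absolute value at
  least 1. But these differences are disjoint in a bounded set, so their values are
  summable.\<close>

lemma emeasure_pos_variation_finite:
  fixes \<nu> :: "'a::metric_space set \<Rightarrow> real"
  assumes \<nu>: "signed_measure \<nu>" and E: "E \<in> bounded_borel"
  shows "emeasure (pos_variation \<nu>) E < \<infinity>"
proof (rule ccontr)
  assume inf: "\<not> emeasure (pos_variation \<nu>) E < \<infinity>"
  define bad where "bad X \<longleftrightarrow> X \<in> bounded_borel \<and> (\<forall>K. \<exists>B\<in>bounded_borel. B \<subseteq> X \<and> \<bar>\<nu> B\<bar> > K)" for X
  have "bad E"
  proof (rule ccontr)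
    assume "\<not> bad E"
    then obtain K where K: "\<And>B. B \<in> bounded_borel \<Longrightarrow> B \<subseteq> E \<Longrightarrow> \<bar>\<nu> B\<bar> \<le> K"
      using E unfolding bad_def by (metis linorder_not_le)
    have "emeasure (pos_variation \<nu>) E \<le> ennreal K"
      using E by (subst emeasure_pos_variation[OF \<nu>])
        (auto simp: bounded_borel_def intro!: SUP_least ennreal_leI order_trans[OF abs_ge_self K])
    also have "\<dots> < \<infinity>" by simp
    finally show False using inf by simp
  qed
  have split: "\<exists>Y. bad Y \<and> Y \<subseteq> X \<and> \<bar>\<nu> (X - Y)\<bar> \<ge> 1" if X: "bad X" for X
  proof -
    have Xb: "X \<in> bounded_borel" using X by (simp add: bad_def)
    \<comment> \<open>The surplus \<open>\<bar>\<nu> X\<bar>\<close> gives \<open>X - B\<close> as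
      well as \<open>B\<close> absolute value at least 1, so that whichever of the two is bad can be
      kept.\<close>
    obtain B where B: "B \<in> bounded_borel" "B \<subseteq> X" "\<bar>\<nu> B\<bar> > 1 + \<bar>\<nu> X\<bar>" using X unfolding bad_def by blast
    have d: "\<nu> (X - B) = \<nu> X - \<nu> B" by (rule signed_measure_Diff[OF \<nu> B(1) Xb B(2)])
    have XB: "X - B \<in> bounded_borel" using B(1) Xb by (intro bounded_borel_Diff) (auto simp: bounded_borel_def)
    have "bad B \<or> bad (X - B)"
    proof (rule ccontr)
      assume "\<not> (bad B \<or> bad (X - B))"
      then obtain K K' where K: "\<And>C. C \<in> bounded_borel \<Longrightarrow> C \<subseteq> B \<Longrightarrow> \<bar>\<nu> C\<bar> \<le> K"
         "\<And>C. C \<in> bounded_borel \<Longrightarrow> C \<subseteq> X - B \<Longrightarrow> \<bar>\<nu> C\<bar> \<le> K'"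
        using B(1) XB unfolding bad_def by (metis linorder_not_le)
      obtain C where C: "C \<in> bounded_borel" "C \<subseteq> X" "\<bar>\<nu> C\<bar> > K + K'" using X unfolding bad_def by blast
      have Bs: "B \<in> sets borel" using B(1) by (simp add: bounded_borel_def)
      have "\<nu> ((C \<inter> B) \<union> (C - B)) = \<nu> (C \<inter> B) + \<nu> (C - B)"
        using C(1) Bs by (intro signed_measure_Un[OF \<nu>] bounded_borel_Int_right bounded_borel_Diff) auto
      moreover have "(C \<inter> B) \<union> (C - B) = C" by auto
      moreover have "\<bar>\<nu> (C \<inter> B)\<bar> \<le> K" using C(1) Bs by (intro K bounded_borel_Int_right) auto
      moreover have "\<bar>\<nu> (C - B)\<bar> \<le> K'" using C Bs by (intro K bounded_borel_Diff) auto
      ultimately show False using C(3) by simp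
    qed
    then show ?thesis
    proof
      assume "bad B"
      then show ?thesis using B d by (intro exI[of _ B]) auto
    next
      assume "bad (X - B)"
      moreover have "X - (X - B) = B" using B(2) by auto
      ultimately show ?thesis using B by (intro exI[of _ "X - B"]) auto
    qed
  qed
  have "\<exists>Y. \<forall>n. bad (Y n) \<and> (Y (Suc n) \<subseteq> Y n \<and> \<bar>\<nu> (Y n - Y (Suc n))\<bar> \<ge> 1)"
    by (rule dependent_nat_choice) (use \<open>bad E\<close> split in blast)+
  then obtain Y where Y: "\<And>n. bad (Y n)" "\<And>n. Y (Suc n) \<subseteq> Y n" "\<And>n. \<bar>\<nu> (Y n - Y (Suc n))\<bar> \<ge> 1" by blast
  have Yb: "Y n \<in> bounded_borel" for n using Y(1) by (simp add: bad_def)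
  have dec: "decseq Y" using Y(2) by (rule decseq_SucI)
  have "(\<lambda>n. \<nu> (Y n - Y (Suc n))) sums \<nu> (\<Union>n. Y n - Y (Suc n))"
  proof (rule signed_measureD[OF \<nu>])
    show "Y n - Y (Suc n) \<in> bounded_borel" for n
      using Yb[of "Suc n"] Yb[of n] by (intro bounded_borel_Diff) (auto simp: bounded_borel_def)
    show "disjoint_family (\<lambda>n. Y n - Y (Suc n))"
      unfolding disjoint_family_on_def
    proof (intro ballI impI)
      fix m n :: nat assume "m \<noteq> n"
      then consider "Suc m \<le> n" | "Suc n \<le> m" by linarith
      then show "(Y m - Y (Suc m)) \<inter> (Y n - Y (Suc n)) = {}"
        using decseqD[OF dec] by cases blast+
    qed
    have "bounded (Y 0)" using Yb[of 0] by (simp add: bounded_borel_def)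
    moreover have "(\<Union>n. Y n - Y (Suc n)) \<subseteq> Y 0" using decseqD[OF dec, of 0] by blast
    ultimately show "bounded (\<Union>n. Y n - Y (Suc n))" by (rule bounded_subset)
  qed
  then have "(\<lambda>n. \<nu> (Y n - Y (Suc n))) \<longlonglongrightarrow> 0" by (rule summable_LIMSEQ_zero[OF sums_summable])
  then have "\<forall>\<^sub>F n in sequentially. norm (\<nu> (Y n - Y (Suc n)) - 0) < 1" by (rule LIMSEQ_D[THEN eventually_sequentially[THEN iffD2]]) simp
  then obtain n where "\<bar>\<nu> (Y n - Y (Suc n))\<bar> < 1" using eventually_happens'[OF sequentially_bot] by fastforce
  with Y(3)[of n] show False by simp
qed

text \<open>For \<open>B \<subseteq> E\<close> the value
  \<open>\<rho> B = \<rho> E - \<rho> (E - B)\<close> is at most \<open>\<rho> E\<close> plus the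
  negative variation of \<open>E\<close>. This inequality for \<open>\<nu>\<close> and for its
  negative yields equality.\<close>

lemma Jordan_decomposition:
  fixes \<nu> :: "'a::metric_space set \<Rightarrow> real"
  assumes \<nu>: "signed_measure \<nu>" "signed_measure (\<lambda>B. - \<nu> B)" and E: "E \<in> bounded_borel"
  shows "\<nu> E = measure (pos_variation \<nu>) E - measure (pos_variation (\<lambda>B. - \<nu> B)) E"
proof -
  have le: "measure (pos_variation \<rho>) E \<le> \<rho> E + measure (pos_variation (\<lambda>B. - \<rho> B)) E"
    if \<rho>: "signed_measure \<rho>" "signed_measure (\<lambda>B. - \<rho> B)" for \<rho>
  proof -
    have Eb: "E \<in> sets borel" using E by (simp add: bounded_borel_def)
    let ?P = "pos_variation \<rho>" and ?N = "pos_variation (\<lambda>B. - \<rho> B)"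
    have N: "emeasure ?N E = ennreal (measure ?N E)"
      using emeasure_pos_variation_finite[OF \<rho>(2) E] by (intro emeasure_eq_ennreal_measure) auto
    have upper: "\<rho> B \<le> \<rho> E + measure ?N E" if B: "B \<in> bounded_borel" "B \<subseteq> E" for B
    proof -
      have EB: "E - B \<in> bounded_borel" using B E by (intro bounded_borel_Diff) (auto simp: bounded_borel_def)
      have "ennreal (- \<rho> (E - B)) \<le> emeasure ?N E"
        unfolding emeasure_pos_variation[OF \<rho>(2) Eb] using EB by (intro SUP_upper) auto
      then have "- \<rho> (E - B) \<le> measure ?N E" unfolding N by (simp add: ennreal_le_iff)
      then show ?thesis using signed_measure_Diff[OF \<rho>(1) B(1) E B(2)] by simp
    qed
    have pos: "0 \<le> \<rho> E + measure ?N E" using upper[of "{}"] by (simp add: signed_measure_empty[OF \<rho>(1)])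
    have "emeasure ?P E \<le> ennreal (\<rho> E + measure ?N E)"
      unfolding emeasure_pos_variation[OF \<rho>(1) Eb] using upper by (intro SUP_least ennreal_leI) auto
    then show ?thesis unfolding measure_def[of ?P] using pos by (intro enn2real_leI) 
  qed
  have eq: "(\<lambda>B. - (- \<nu> B)) = \<nu>" by simp
  from le[OF \<nu>] le[OF \<nu>(2), unfolded eq, OF \<nu>(1)] show ?thesis by linarith
qed

section \<open>Measures carried by a discrete closed set\<close>

text \<open>The value type is generic in order to cover the real valued parts of a complex measure
  too.\<close>

definition atomic_on :: "('a::metric_space set \<Rightarrow> 'b::comm_monoid_add) \<Rightarrow> 'a set \<Rightarrow> ('a \<Rightarrow> 'b) \<Rightarrow> bool" where
  "atomic_on \<mu> D w \<longleftrightarrow> discrete_closed_set D \<and> (\<forall>B\<in>bounded_borel. \<mu> B = (\<Sum>d\<in>D \<inter> B. w d))"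

lemma cmeasure_of_atomic_on:
  assumes "atomic_on \<mu> D w"
  shows "cmeasure \<mu>"
  unfolding cmeasure_def
proof (intro allI impI)
  fix A :: "nat \<Rightarrow> 'a set"
  assume A: "range A \<subseteq> bounded_borel \<and> disjoint_family A \<and> bounded (\<Union>i. A i)"
  define F where "F = D \<inter> (\<Union>i. A i)"
  have F: "finite F" unfolding F_def
    by (rule discrete_closed_setD) (use assms A in \<open>auto simp: atomic_on_def\<close>)
  have Ab: "A i \<in> bounded_borel" for i using A by auto
  have Ub: "(\<Union>i. A i) \<in> bounded_borel" using A by (auto simp: bounded_borel_def)
  have "(\<lambda>i. \<Sum>d\<in>F. if d \<in> A i then w d else 0) sums (\<Sum>d\<in>F. w d)"
  proof (rule sums_sum)
    fix d assume "d \<in> F"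
    then obtain i where i: "d \<in> A i" by (auto simp: F_def)
    have iff: "d \<in> A j \<longleftrightarrow> j = i" for j
      using A i disjoint_family_onD[of A UNIV i j] by auto
    show "(\<lambda>i. if d \<in> A i then w d else 0) sums w d"
      unfolding iff by (rule sums_single)
  qed
  moreover have "(\<Sum>d\<in>F. if d \<in> A i then w d else 0) = \<mu> (A i)" for i
  proof -
    have "(\<Sum>d\<in>F. if d \<in> A i then w d else 0) = (\<Sum>d\<in>F \<inter> A i. w d)"
      by (simp add: sum.inter_restrict[OF F])
    also have "F \<inter> A i = D \<inter> A i" by (auto simp: F_def)
    finally show ?thesis using assms Ab[of i] by (simp add: atomic_on_def)
  qed
  moreover have "(\<Sum>d\<in>F. w d) = \<mu> (\<Union>i. A i)"
    using assms Ub by (simp add: atomic_on_def F_def)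
  ultimately show "(\<lambda>i. \<mu> (A i)) sums \<mu> (\<Union>i. A i)" by simp
qed

text \<open>For bounded \<open>E\<close> the supremum is attained at the finite set of its atoms of
  positive weight; the general case follows by exhaustion with balls.\<close>

lemma pos_variation_atomic:
  fixes \<nu> :: "'a::euclidean_space set \<Rightarrow> real"
  assumes \<nu>: "signed_measure \<nu>" and at: "atomic_on \<nu> D w"
  shows "pos_variation \<nu> = distr (density (count_space D) (\<lambda>d. ennreal (w d))) borel (\<lambda>x. x)"
    (is "_ = ?A")
proof (rule measure_eqI)
  fix E :: "'a set" assume "E \<in> sets (pos_variation \<nu>)"
  then have E: "E \<in> sets borel" by simp
  have meas: "(\<lambda>x. x) \<in> measurable (density (count_space D) (\<lambda>d. ennreal (w d))) borel"
    by simp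
  have bdd: "emeasure (pos_variation \<nu>) E = emeasure ?A E" if E: "E \<in> bounded_borel" for E
  proof -
    have Eb: "E \<in> sets borel" using E by (simp add: bounded_borel_def)
    have fin: "finite (D \<inter> E)" by (rule discrete_closed_setD) (use at E in \<open>auto simp: atomic_on_def bounded_borel_def\<close>)
    have "emeasure ?A E = emeasure (density (count_space D) (\<lambda>d. ennreal (w d))) (E \<inter> D)"
      using Eb by (subst emeasure_distr[OF meas]) auto
    also have "\<dots> = (\<integral>\<^sup>+ d. ennreal (w d) * indicator (E \<inter> D) d \<partial>count_space D)"
      by (rule emeasure_density) auto
    also have "\<dots> = (\<Sum>d\<in>D \<inter> E. ennreal (w d) * indicator (E \<inter> D) d)"
      using fin by (subst nn_integral_count_space'[of "D \<inter> E"]) (auto simp: indicator_def)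
    also have "\<dots> = (\<Sum>d\<in>D \<inter> E. ennreal (w d))" by (intro sum.cong) (auto simp: indicator_def)
    finally have A: "emeasure ?A E = (\<Sum>d\<in>D \<inter> E. ennreal (w d))" .
    have "emeasure (pos_variation \<nu>) E = (SUP B \<in> {B \<in> bounded_borel. B \<subseteq> E}. ennreal (\<nu> B))"
      by (rule emeasure_pos_variation[OF \<nu> Eb])
    also have "\<dots> = (\<Sum>d\<in>D \<inter> E. ennreal (w d))"
    proof (rule antisym)
      show "(SUP B \<in> {B \<in> bounded_borel. B \<subseteq> E}. ennreal (\<nu> B)) \<le> (\<Sum>d\<in>D \<inter> E. ennreal (w d))"
      proof (rule SUP_least)
        fix B assume "B \<in> {B \<in> bounded_borel. B \<subseteq> E}"
        then have B: "B \<in> bounded_borel" "B \<subseteq> E" by auto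
        have "ennreal (\<nu> B) = ennreal (\<Sum>d\<in>D \<inter> B. w d)" using at B by (simp add: atomic_on_def)
        also have "\<dots> \<le> ennreal (\<Sum>d\<in>D \<inter> B. max 0 (w d))" by (intro ennreal_leI sum_mono) auto
        also have "\<dots> = (\<Sum>d\<in>D \<inter> B. ennreal (max 0 (w d)))" by (rule sum_ennreal[symmetric]) simp
        also have "\<dots> = (\<Sum>d\<in>D \<inter> B. ennreal (w d))" by (simp add: ennreal_max_0)
        also have "\<dots> \<le> (\<Sum>d\<in>D \<inter> E. ennreal (w d))" by (rule sum_mono2[OF fin]) (use B in auto)
        finally show "ennreal (\<nu> B) \<le> (\<Sum>d\<in>D \<inter> E. ennreal (w d))" .
      qed
      define B where "B = {d \<in> D \<inter> E. w d > 0}"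
      have "finite B" unfolding B_def using fin by (rule rev_finite_subset) auto
      then have B: "finite B" "B \<in> bounded_borel" "B \<subseteq> E"
        by (auto simp: B_def intro!: bounded_borel_finite)
      have "(\<Sum>d\<in>D \<inter> E. ennreal (w d)) = (\<Sum>d\<in>B. ennreal (w d))"
        by (rule sum.mono_neutral_right[OF fin]) (auto simp: B_def ennreal_eq_0_iff not_less)
      also have "\<dots> = ennreal (\<Sum>d\<in>B. w d)" by (rule sum_ennreal) (auto simp: B_def)
      also have "(\<Sum>d\<in>B. w d) = \<nu> B"
      proof -
        have "D \<inter> B = B" by (auto simp: B_def)
        then show ?thesis using at B(2) by (simp add: atomic_on_def)
      qed
      finally show "(\<Sum>d\<in>D \<inter> E. ennreal (w d)) \<le> (SUP B \<in> {B \<in> bounded_borel. B \<subseteq> E}. ennreal (\<nu> B))"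
        using B by (auto intro: SUP_upper)
    qed
    finally show ?thesis using A by simp
  qed
  define En where "En n = E \<inter> cball 0 (real n)" for n
  have inc: "incseq En" by (auto simp: En_def incseq_def)
  have U: "(\<Union>n. En n) = E" unfolding En_def using real_arch_simple by (auto simp: mem_cball_0) 
  have Eb: "En n \<in> bounded_borel" for n
    unfolding En_def using E by (intro bounded_borelI) (auto simp: bounded_Int)
  have Es: "range En \<subseteq> sets (pos_variation \<nu>)" "range En \<subseteq> sets ?A" using Eb by (auto simp: bounded_borel_def)
  have "emeasure (pos_variation \<nu>) E = (SUP n. emeasure (pos_variation \<nu>) (En n))"
    unfolding SUP_emeasure_incseq[OF Es(1) inc] U ..
  also have "\<dots> = (SUP n. emeasure ?A (En n))" using bdd Eb by simp
  also have "\<dots> = emeasure ?A E"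
    unfolding SUP_emeasure_incseq[OF Es(2) inc] U ..
  finally show "emeasure (pos_variation \<nu>) E = emeasure ?A E" .
qed simp

lemma integral_pos_variation_atomic:
  fixes f :: "'a::euclidean_space \<Rightarrow> complex"
  assumes "signed_measure \<nu>" "atomic_on \<nu> D w" "f \<in> borel_measurable borel"
  shows "integral\<^sup>L (pos_variation \<nu>) f = (LINT d|count_space D. max 0 (w d) *\<^sub>R f d)"
proof -
  have "integral\<^sup>L (pos_variation \<nu>) f = integral\<^sup>L (density (count_space D) (\<lambda>d. ennreal (w d))) f"
    unfolding pos_variation_atomic[OF assms(1,2)] using assms(3) by (subst integral_distr) auto
  also have "density (count_space D) (\<lambda>d. ennreal (w d)) = density (count_space D) (\<lambda>d. ennreal (max 0 (w d)))"
    by (simp add: ennreal_max_0)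
  also have "integral\<^sup>L \<dots> f = (LINT d|count_space D. max 0 (w d) *\<^sub>R f d)"
    by (rule integral_density) auto
  finally show ?thesis .
qed

text \<open>Integrability of \<open>c d * f d\<close> dominates the integrands for all four
  variations, so none of the four integrals takes the default value 0 of a non-integrable
  function.\<close>

lemma cm_integral_atomic:
  fixes \<mu> :: "'a::euclidean_space set \<Rightarrow> complex" and f :: "'a \<Rightarrow> complex"
  assumes at: "atomic_on \<mu> D c" and f: "f \<in> borel_measurable borel"
    and int: "integrable (count_space D) (\<lambda>d. c d * f d)"
  shows "cm_integral \<mu> f = (LINT d|count_space D. c d * f d)"
proof -
  have cm: "cmeasure \<mu>" by (rule cmeasure_of_atomic_on[OF at])
  note sm = signed_measure_of_cmeasure[OF cm]
  have at4: "atomic_on (\<lambda>B. Re (\<mu> B)) D (\<lambda>d. Re (c d))" "atomic_on (\<lambda>B. - Re (\<mu> B)) D (\<lambda>d. - Re (c d))"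
    "atomic_on (\<lambda>B. Im (\<mu> B)) D (\<lambda>d. Im (c d))" "atomic_on (\<lambda>B. - Im (\<mu> B)) D (\<lambda>d. - Im (c d))"
    using at by (simp_all add: atomic_on_def sum_negf)
  have i: "integrable (count_space D) (\<lambda>d. max 0 (w d) *\<^sub>R f d)" if "\<And>d. \<bar>w d\<bar> \<le> cmod (c d)" for w
  proof (rule Bochner_Integration.integrable_bound[OF int])
    show "AE d in count_space D. norm (max 0 (w d) *\<^sub>R f d) \<le> norm (c d * f d)"
      using that by (intro AE_I2) (auto simp: norm_mult intro!: mult_right_mono order_trans[OF _ that])
  qed auto
  have i4: "integrable (count_space D) (\<lambda>d. max 0 (Re (c d)) *\<^sub>R f d)" "integrable (count_space D) (\<lambda>d. max 0 (- Re (c d)) *\<^sub>R f d)"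
    "integrable (count_space D) (\<lambda>d. max 0 (Im (c d)) *\<^sub>R f d)" "integrable (count_space D) (\<lambda>d. max 0 (- Im (c d)) *\<^sub>R f d)"
    by (intro i; simp add: abs_Re_le_cmod abs_Im_le_cmod)+
  have pt: "(max 0 (Re (c d)) *\<^sub>R f d - max 0 (- Re (c d)) *\<^sub>R f d)
      + \<i> * (max 0 (Im (c d)) *\<^sub>R f d - max 0 (- Im (c d)) *\<^sub>R f d) = c d * f d" for d
  proof -
    have m: "max 0 t *\<^sub>R z - max 0 (- t) *\<^sub>R z = of_real t * z" for t :: real and z :: complex
      by (simp add: max_def scaleR_conv_of_real)
    show ?thesis unfolding m by (subst (3) complex_eq) (simp add: algebra_simps)
  qed
  have "cm_integral \<mu> f = (LINT d|count_space D. (max 0 (Re (c d)) *\<^sub>R f d - max 0 (- Re (c d)) *\<^sub>R f d)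
      + \<i> * (max 0 (Im (c d)) *\<^sub>R f d - max 0 (- Im (c d)) *\<^sub>R f d))"
    unfolding cm_integral_def using i4 sm at4 f
    by (simp add: integral_pos_variation_atomic)
  then show ?thesis unfolding pt .
qed

lemma cm_integral_atomic_finite:
  fixes \<mu> :: "'a::euclidean_space set \<Rightarrow> complex" and f :: "'a \<Rightarrow> complex"
  assumes "atomic_on \<mu> D c" "f \<in> borel_measurable borel" "finite D"
  shows "cm_integral \<mu> f = (\<Sum>d\<in>D. c d * f d)"
  using cm_integral_atomic[OF assms(1,2)] assms(3)
  by (simp add: integrable_count_space lebesgue_integral_count_space_finite)

lemma cmod_le_total_variation:
  assumes "B \<in> bounded_borel" "B \<subseteq> E"
  shows "ennreal (cmod (\<mu> B)) \<le> total_variation \<mu> E"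
  unfolding total_variation_def
  by (rule SUP_upper2[of "{B}"]) (use assms in \<open>auto simp: pairwise_def disjnt_def\<close>)

lemma atomic_on_of_supported_by:
  fixes \<mu> :: "'a::metric_space set \<Rightarrow> complex"
  assumes cm: "cmeasure \<mu>" and supp: "supported_by \<mu> D" and D: "discrete_closed_set D"
  shows "atomic_on \<mu> D (\<lambda>x. \<mu> {x})"
  unfolding atomic_on_def
proof (intro conjI D ballI)
  fix B :: "'a set" assume B: "B \<in> bounded_borel"
  have fin: "finite (D \<inter> B)" by (rule discrete_closed_setD[OF D]) (use B in \<open>simp add: bounded_borel_def\<close>)
  have sum: "\<mu> F = (\<Sum>x\<in>F. \<mu> {x})" if "finite F" for F
    using that
  proof (induction F rule: finite_induct)
    case (insert x F)
    have "\<mu> ({x} \<union> F) = \<mu> {x} + \<mu> F"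
      using insert by (intro cmeasure_Un[OF cm] bounded_borel_finite) auto
    then show ?case using insert by simp
  qed (simp add: cmeasure_empty[OF cm])
  have C: "B - (D \<inter> B) \<in> bounded_borel"
    using B bounded_borel_finite[OF fin] by (intro bounded_borel_Diff) (auto simp: bounded_borel_def)
  have "ennreal (cmod (\<mu> (B - (D \<inter> B)))) \<le> total_variation \<mu> (UNIV - D)"
    by (rule cmod_le_total_variation[OF C]) auto
  then have "\<mu> (B - (D \<inter> B)) = 0" using supp by (simp add: supported_by_def)
  moreover have "\<mu> (B - (D \<inter> B)) = \<mu> B - \<mu> (D \<inter> B)"
    by (rule cmeasure_Diff[OF cm bounded_borel_finite[OF fin] B]) auto
  ultimately show "\<mu> B = (\<Sum>x\<in>D \<inter> B. \<mu> {x})" using sum[OF fin] by simp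
qed

lemma translation_bounded_atoms:
  assumes "translation_bounded \<mu>"
  obtains M where "\<And>x. cmod (\<mu> {x}) \<le> M"
proof -
  define T where "T = (SUP x. total_variation \<mu> (ball x 1))"
  have T: "T < \<infinity>" using assms by (simp add: translation_bounded_def T_def)
  have "cmod (\<mu> {x}) \<le> enn2real T" for x
  proof -
    have "ennreal (cmod (\<mu> {x})) \<le> total_variation \<mu> (ball x 1)"
      by (rule cmod_le_total_variation) (auto intro: bounded_borel_finite)
    also have "\<dots> \<le> T" unfolding T_def by (rule SUP_upper) simp
    finally have "ennreal (cmod (\<mu> {x})) \<le> ennreal (enn2real T)" using T by simp
    then show ?thesis by (subst (asm) ennreal_le_iff) auto
  qed
  then show thesis by (rule that)
qed

section \<open>Autocorrelation measures\<close>

text \<open>A packing inequality: the balls of radius \<open>e / 2\<close> are disjoint. It counts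
  points in a cube when \<open>g\<close> is an indicator and bounds Gaussian sums when
  \<open>g\<close> is a Gaussian.\<close>

lemma sum_integral_separated_balls_le:
  fixes X :: "'a::euclidean_space set" and g :: "'a \<Rightarrow> real"
  assumes X: "finite X" "\<And>x y. x \<in> X \<Longrightarrow> y \<in> X \<Longrightarrow> x \<noteq> y \<Longrightarrow> e \<le> dist x y"
    and g: "integrable lborel g" "\<And>x. 0 \<le> g x"
  shows "(\<Sum>x\<in>X. LINT y|lborel. indicator (ball x (e/2)) y * g y) \<le> (LINT y|lborel. g y)"
proof -
  have int: "integrable lborel (\<lambda>y. indicator (ball x (e/2)) y * g y)" for x :: 'a
    by (rule Bochner_Integration.integrable_bound[OF g(1)]) (use g in \<open>auto simp: indicator_def\<close>)
  have disj: "disjoint_family_on (\<lambda>x. ball x (e/2)) X"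
    unfolding disjoint_family_on_def
  proof (intro ballI impI)
    fix x y assume xy: "x \<in> X" "y \<in> X" "x \<noteq> y"
    show "ball x (e/2) \<inter> ball y (e/2) = {}"
    proof (rule ccontr)
      assume "ball x (e/2) \<inter> ball y (e/2) \<noteq> {}"
      then obtain z where "dist x z < e/2" "dist y z < e/2" by auto
      then have "dist x y < e" using dist_triangle_half_l[of x z e y] by (simp add: dist_commute)
      then show False using X(2)[OF xy] by simp
    qed
  qed
  have "(\<Sum>x\<in>X. LINT y|lborel. indicator (ball x (e/2)) y * g y)
      = (LINT y|lborel. (\<Sum>x\<in>X. indicator (ball x (e/2)) y * g y))"
    using int by (intro Bochner_Integration.integral_sum[symmetric]) auto
  also have "\<dots> \<le> (LINT y|lborel. g y)"
  proof (rule integral_mono)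
    show "integrable lborel (\<lambda>y. \<Sum>x\<in>X. indicator (ball x (e/2)) y * g y)"
      using int by (intro Bochner_Integration.integrable_sum) auto
    fix y
    have "(\<Sum>x\<in>X. indicator (ball x (e/2)) y :: real) = indicator (\<Union>x\<in>X. ball x (e/2)) y"
      by (rule indicator_UN_disjoint[OF X(1) disj, symmetric])
    then have "(\<Sum>x\<in>X. indicator (ball x (e/2)) y * g y) = indicator (\<Union>x\<in>X. ball x (e/2)) y * g y"
      by (simp flip: sum_distrib_right)
    also have "\<dots> \<le> g y" using g(2)[of y] by (simp add: indicator_def)
    finally show "(\<Sum>x\<in>X. indicator (ball x (e/2)) y * g y) \<le> g y" .
  qed (use g in auto)
  finally show ?thesis .
qed

definition cube :: "real \<Rightarrow> (real^'n) set" where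
  "cube R = {x. \<forall>i. \<bar>x $ i\<bar> \<le> R}"

lemma cube_eq_cbox: "cube R = cbox (\<chi> i. - R) (\<chi> i. R)"
  by (auto simp: cube_def mem_box_cart abs_le_iff minus_le_iff)

lemma compact_cube: "compact (cube R)"
  unfolding cube_eq_cbox by (rule compact_cbox)

lemma cube_bounded_borel: "cube R \<in> bounded_borel"
  by (intro bounded_borelI borel_closed compact_imp_closed compact_imp_bounded compact_cube)

lemma measure_cube:
  assumes "R \<ge> 0" shows "measure lborel (cube R :: (real^'n) set) = (2 * R) ^ CARD('n)"
proof -
  have "(0 :: real^'n) \<in> cube R" using assms by (simp add: cube_def)
  then have "cbox (\<chi> i. - R) (\<chi> i. R) \<noteq> ({} :: (real^'n) set)" unfolding cube_eq_cbox by blast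
  then show ?thesis unfolding cube_eq_cbox by (subst content_cbox_cart) auto
qed

lemma card_uniform_discrete_cube:
  fixes A :: "(real^'n) set"
  assumes "uniform_discrete A"
  obtains C where "\<And>R. R \<ge> 1 \<Longrightarrow> real (card (A \<inter> cube R)) \<le> C * (2 * R) ^ CARD('n)"
proof -
  obtain e where e: "e > 0" "\<And>x y. x \<in> A \<Longrightarrow> y \<in> A \<Longrightarrow> dist x y < e \<Longrightarrow> x = y"
    using assms unfolding uniform_discrete_def by blast
  define v where "v = measure lborel (ball (0 :: real^'n) (e/2))"
  have ball: "measure lborel (ball x (e/2)) = v" for x :: "real^'n"
    using e(1) by (simp add: v_def content_ball)
  have "v > 0" unfolding v_def using e(1) by (simp add: content_ball_pos)
  have "real (card (A \<inter> cube R)) \<le> (1 + e) ^ CARD('n) / v * (2 * R) ^ CARD('n)" if R: "R \<ge> 1" for R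
  proof -
    have fin: "finite (A \<inter> cube R)"
      by (rule discrete_closed_setD[OF uniform_discrete_imp_discrete_closed_set[OF assms]])
         (rule compact_imp_bounded[OF compact_cube])
    have int: "integrable lborel (indicator (cube (R + e)) :: real^'n \<Rightarrow> real)"
      unfolding cube_eq_cbox by (rule integrable_real_indicator, simp, rule emeasure_lborel_cbox_finite)
    have "(\<Sum>x\<in>A \<inter> cube R. LINT y|lborel. indicator (ball x (e/2)) y * indicator (cube (R + e)) y)
        \<le> (LINT y|lborel. indicator (cube (R + e)) (y :: real^'n) :: real)"
      by (rule sum_integral_separated_balls_le[OF fin _ int]) (use e(2) in force)+
    also have "\<dots> = (2 * (R + e)) ^ CARD('n)" using R e(1) by (simp add: measure_cube)
    \<comment> \<open>Here \<open>R \<ge> 1\<close> turns the boundary layer of width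
      \<open>e\<close> into a constant factor.\<close>
    also have "\<dots> \<le> ((1 + e) * (2 * R)) ^ CARD('n)"
      using R e(1) by (intro power_mono) (auto simp: algebra_simps)
    also have "(\<Sum>x\<in>A \<inter> cube R. LINT y|lborel. indicator (ball x (e/2)) y * indicator (cube (R + e)) y)
        = (\<Sum>x\<in>A \<inter> cube R. v)"
    proof (rule sum.cong[OF refl])
      fix x assume x: "x \<in> A \<inter> cube R"
      have "ball x (e/2) \<subseteq> cube (R + e)"
      proof
        fix y assume y: "y \<in> ball x (e/2)"
        have "\<bar>y $ i\<bar> \<le> R + e" for i
        proof -
          have "\<bar>(x - y) $ i\<bar> \<le> norm (x - y)" by (rule component_le_norm_cart)
          also have "\<dots> < e/2" using y by (simp add: dist_norm)
          finally have "\<bar>x $ i - y $ i\<bar> < e/2" by simp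
          moreover have "\<bar>x $ i\<bar> \<le> R" using x by (simp add: cube_def)
          ultimately show ?thesis using e(1) by linarith
        qed
        then show "y \<in> cube (R + e)" by (simp add: cube_def)
      qed
      then have prod: "indicator (ball x (e/2)) y * indicator (cube (R + e)) y = (indicator (ball x (e/2)) y :: real)" for y
        by (cases "y \<in> ball x (e/2)") (auto simp del: mem_ball)
      show "(LINT y|lborel. indicator (ball x (e/2)) y * indicator (cube (R + e)) y) = v"
        unfolding prod by (simp add: ball)
    qed
    finally have "real (card (A \<inter> cube R)) * v \<le> (1 + e) ^ CARD('n) * (2 * R) ^ CARD('n)"
      by (simp add: power_mult_distrib)
    then show ?thesis using \<open>v > 0\<close> by (simp add: field_simps)
  qed
  then show thesis by (rule that)
qed

lemma test_function_measurable: "f \<in> test_functions \<Longrightarrow> f \<in> borel_measurable borel"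
  by (auto simp: test_functions_def intro: borel_measurable_continuous_onI)

text \<open>In a pair with difference \<open>d\<close> the first point determines the second, so
  there are at most \<open>card A\<close> terms. After division by the volume of the cube the
  weights are therefore bounded uniformly in \<open>R\<close> and \<open>d\<close>.\<close>

lemma sum_diagonal_bound:
  fixes m :: "'a::ab_group_add \<Rightarrow> complex"
  assumes "finite A" "\<And>x. cmod (m x) \<le> M"
  shows "cmod (\<Sum>(x,z)\<in>{p \<in> A \<times> A. fst p - snd p = d}. m x * cnj (m z)) \<le> real (card A) * M\<^sup>2"
proof -
  have M: "M \<ge> 0" using assms(2)[of 0] norm_ge_zero order_trans by blast
  have "cmod (\<Sum>(x,z)\<in>{p \<in> A \<times> A. fst p - snd p = d}. m x * cnj (m z))
      \<le> (\<Sum>p\<in>{p \<in> A \<times> A. fst p - snd p = d}. M\<^sup>2)"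
    by (rule sum_norm_le) (auto simp: norm_mult power2_eq_square intro!: mult_mono assms(2) M)
  also have "\<dots> = real (card {p \<in> A \<times> A. fst p - snd p = d}) * M\<^sup>2" by simp
  also have "card {p \<in> A \<times> A. fst p - snd p = d} \<le> card A"
  proof (rule card_inj_on_le[where f = fst])
    show "inj_on fst {p \<in> A \<times> A. fst p - snd p = d}"
      by (auto simp: inj_on_def)
  qed (use assms in auto)
  finally show ?thesis by (simp add: mult_right_mono)
qed

lemma approx_autocorrelation_atomic:
  fixes \<mu> :: "(real^'n) set \<Rightarrow> complex"
  assumes at: "atomic_on \<mu> \<Lambda> m"
  defines "A \<equiv> \<lambda>R. \<Lambda> \<inter> cube R"
  shows "finite (A R)"
    "atomic_on (approx_autocorrelation \<mu> R) (difference_set (A R))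
       (\<lambda>d. (\<Sum>(x,z)\<in>{p \<in> A R \<times> A R. fst p - snd p = d}. m x * cnj (m z)) / complex_of_real ((2 * R) ^ CARD('n)))"
proof -
  have \<Lambda>: "discrete_closed_set \<Lambda>" using at by (simp add: atomic_on_def)
  show fin: "finite (A R)" unfolding A_def
    by (rule discrete_closed_setD[OF \<Lambda>]) (rule compact_imp_bounded[OF compact_cube])
  have fin_dcs: "discrete_closed_set F" if "finite F" for F :: "(real^'n) set"
    using that by (simp add: discrete_closed_set_def)
  have res: "cube_restrict \<mu> R E = (\<Sum>x\<in>A R \<inter> E. m x)" if "E \<in> sets borel" for E
  proof -
    have "E \<inter> cube R \<in> bounded_borel" by (rule bounded_borel_Int_left[OF that cube_bounded_borel])
    moreover have "\<Lambda> \<inter> (E \<inter> cube R) = A R \<inter> E" by (auto simp: A_def)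
    ultimately show ?thesis using at by (simp add: cube_restrict_def atomic_on_def flip: cube_def)
  qed
  have neg: "uminus ` E \<in> sets borel" if "E \<in> sets borel" for E :: "(real^'n) set"
  proof -
    have "uminus ` E = uminus -` E \<inter> space borel" by (force simp: image_iff)
    also have "\<dots> \<in> sets borel" using that by (rule measurable_sets[rotated]) simp
    finally show ?thesis .
  qed
  have tl: "atomic_on (tilde (cube_restrict \<mu> R)) (uminus ` A R) (\<lambda>y. cnj (m (- y)))"
    unfolding atomic_on_def
  proof (intro conjI ballI fin_dcs finite_imageI fin)
    fix B :: "(real^'n) set" assume "B \<in> bounded_borel"
    then have "tilde (cube_restrict \<mu> R) B = (\<Sum>x\<in>A R \<inter> uminus ` B. cnj (m x))"
      by (simp add: tilde_def res neg bounded_borel_def)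
    also have "\<dots> = (\<Sum>y\<in>uminus ` (A R \<inter> uminus ` B). cnj (m (- y)))"
      by (subst sum.reindex) auto
    also have "uminus ` (A R \<inter> uminus ` B) = uminus ` A R \<inter> B" by (force simp: image_iff)
    finally show "tilde (cube_restrict \<mu> R) B = (\<Sum>y\<in>uminus ` A R \<inter> B. cnj (m (- y)))" .
  qed
  show "atomic_on (approx_autocorrelation \<mu> R) (difference_set (A R))
       (\<lambda>d. (\<Sum>(x,z)\<in>{p \<in> A R \<times> A R. fst p - snd p = d}. m x * cnj (m z)) / complex_of_real ((2 * R) ^ CARD('n)))"
    unfolding atomic_on_def
  proof (intro conjI ballI)
    have ds: "difference_set (A R) = (\<lambda>p. fst p - snd p) ` (A R \<times> A R)"
      by (force simp: difference_set_def image_iff)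
    then have finD: "finite (difference_set (A R))" using fin by simp
    then show "discrete_closed_set (difference_set (A R))" by (rule fin_dcs)
    fix E :: "(real^'n) set" assume "E \<in> bounded_borel"
    then have E: "E \<in> sets borel" by (simp add: bounded_borel_def)
    have shift: "{x. x + y \<in> E} \<in> sets borel" for y
    proof -
      have "(\<lambda>x. x + y) -` E \<inter> space borel \<in> sets borel" using E by (rule measurable_sets[rotated]) simp
      then show ?thesis by (simp add: vimage_def)
    qed
    have f: "cube_restrict \<mu> R {x. x + y \<in> E} = (\<Sum>x\<in>A R. if x + y \<in> E then m x else 0)" for y
      unfolding res[OF shift] using sum.inter_restrict[OF fin, of m "{x. x + y \<in> E}"] by simp
    have meas: "(\<lambda>y. cube_restrict \<mu> R {x. x + y \<in> E}) \<in> borel_measurable borel"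
      unfolding f using E by measurable
    have "convolution (cube_restrict \<mu> R) (tilde (cube_restrict \<mu> R)) E
       = (\<Sum>y\<in>uminus ` A R. cnj (m (- y)) * (\<Sum>x\<in>A R. if x + y \<in> E then m x else 0))"
      unfolding convolution_def
      by (subst cm_integral_atomic_finite[OF tl meas finite_imageI[OF fin]]) (simp add: f)
    also have "\<dots> = (\<Sum>z\<in>A R. cnj (m z) * (\<Sum>x\<in>A R. if x - z \<in> E then m x else 0))"
      by (subst sum.reindex) auto
    also have "\<dots> = (\<Sum>z\<in>A R. \<Sum>x\<in>A R. if x - z \<in> E then m x * cnj (m z) else 0)"
      unfolding sum_distrib_left by (intro sum.cong) auto
    also have "\<dots> = (\<Sum>p\<in>A R \<times> A R. if fst p - snd p \<in> E then m (fst p) * cnj (m (snd p)) else 0)"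
      by (subst sum.swap) (simp add: sum.cartesian_product case_prod_unfold)
    also have "\<dots> = (\<Sum>d\<in>difference_set (A R). \<Sum>p\<in>{p \<in> A R \<times> A R. fst p - snd p = d}.
        if fst p - snd p \<in> E then m (fst p) * cnj (m (snd p)) else 0)"
      by (rule sum.group[symmetric]) (use fin ds finD in auto)
    also have "\<dots> = (\<Sum>d\<in>difference_set (A R). if d \<in> E then (\<Sum>p\<in>{p \<in> A R \<times> A R. fst p - snd p = d}.
        m (fst p) * cnj (m (snd p))) else 0)"
      by (intro sum.cong) auto
    also have "\<dots> = (\<Sum>d\<in>difference_set (A R) \<inter> E. \<Sum>p\<in>{p \<in> A R \<times> A R. fst p - snd p = d}.
        m (fst p) * cnj (m (snd p)))"
      by (rule sum.inter_restrict[OF finD, symmetric])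
    finally show "approx_autocorrelation \<mu> R E = (\<Sum>d\<in>difference_set (A R) \<inter> E.
        (\<Sum>(x,z)\<in>{p \<in> A R \<times> A R. fst p - snd p = d}. m x * cnj (m z)) / complex_of_real ((2 * R) ^ CARD('n)))"
      by (simp add: approx_autocorrelation_def case_prod_unfold sum_divide_distrib)
  qed
qed

section \<open>Test functions, and recovery of a measure from its integrals\<close>

lemma integrable_pos_variation_test_function:
  assumes \<nu>: "signed_measure \<nu>" and f: "f \<in> test_functions"
  shows "integrable (pos_variation \<nu>) f"
proof -
  obtain K where K: "compact K" "\<And>x. x \<notin> K \<Longrightarrow> f x = 0" and cont: "continuous_on UNIV f"
    using f by (auto simp: test_functions_def)
  have "bounded (f ` K)"
    by (intro compact_imp_bounded compact_continuous_image K continuous_on_subset[OF cont]) auto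
  then obtain M where M: "\<And>x. x \<in> K \<Longrightarrow> cmod (f x) \<le> M" by (auto simp: bounded_iff)
  have Kb: "K \<in> bounded_borel"
    using K(1) by (intro bounded_borelI borel_closed compact_imp_closed compact_imp_bounded)
  show ?thesis
  proof (rule integrableI_bounded_set[where A = K and B = M])
    show "K \<in> sets (pos_variation \<nu>)" using Kb by (simp add: bounded_borel_def)
    show "f \<in> borel_measurable (pos_variation \<nu>)"
      using test_function_measurable[OF f] by (simp cong: measurable_cong_sets)
    show "emeasure (pos_variation \<nu>) K < \<infinity>" by (rule emeasure_pos_variation_finite[OF \<nu> Kb])
    show "AE x in pos_variation \<nu>. x \<in> K \<longrightarrow> norm (f x) \<le> M" using M by simp
    show "AE x in pos_variation \<nu>. x \<notin> K \<longrightarrow> f x = 0" using K(2) by simp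
  qed
qed

lemma test_functions_add:
  assumes "f \<in> test_functions" "g \<in> test_functions"
  shows "(\<lambda>x. f x + a * g x) \<in> test_functions"
proof -
  obtain K K' where K: "compact K" "\<And>x. x \<notin> K \<Longrightarrow> f x = 0" "compact K'" "\<And>x. x \<notin> K' \<Longrightarrow> g x = 0"
    and cont: "continuous_on UNIV f" "continuous_on UNIV g"
    using assms by (auto simp: test_functions_def)
  have "compact (K \<union> K')" "\<And>x. x \<notin> K \<union> K' \<Longrightarrow> f x + a * g x = 0" using K by auto
  moreover have "continuous_on UNIV (\<lambda>x. f x + a * g x)" by (intro continuous_intros cont)
  ultimately show ?thesis unfolding test_functions_def by blast
qed

lemma cm_integral_test_function_add:
  assumes cm: "cmeasure \<gamma>" and f: "f \<in> test_functions" "g \<in> test_functions"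
  shows "cm_integral \<gamma> (\<lambda>x. f x + a * g x) = cm_integral \<gamma> f + a * cm_integral \<gamma> g"
proof -
  have "integral\<^sup>L (pos_variation \<nu>) (\<lambda>x. f x + a * g x) = integral\<^sup>L (pos_variation \<nu>) f + a * integral\<^sup>L (pos_variation \<nu>) g"
    if "signed_measure \<nu>" for \<nu>
    using integrable_pos_variation_test_function[OF that] f by simp
  then show ?thesis
    using signed_measure_of_cmeasure[OF cm] by (simp add: cm_integral_def algebra_simps)
qed

lemma cm_integral_test_function_sum:
  assumes cm: "cmeasure \<gamma>" and f: "f \<in> test_functions" and "finite F" "\<And>d. d \<in> F \<Longrightarrow> g d \<in> test_functions"
  shows "(\<lambda>x. f x + (\<Sum>d\<in>F. a d * g d x)) \<in> test_functions \<and>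
     cm_integral \<gamma> (\<lambda>x. f x + (\<Sum>d\<in>F. a d * g d x)) = cm_integral \<gamma> f + (\<Sum>d\<in>F. a d * cm_integral \<gamma> (g d))"
  using assms(3,4)
proof (induction F rule: finite_induct)
  case empty
  then show ?case using f by simp
next
  case (insert d F)
  let ?h = "\<lambda>x. f x + (\<Sum>d\<in>F. a d * g d x)"
  have IH: "?h \<in> test_functions" "cm_integral \<gamma> ?h = cm_integral \<gamma> f + (\<Sum>d\<in>F. a d * cm_integral \<gamma> (g d))"
    using insert by auto
  have eq: "(\<lambda>x. f x + (\<Sum>d\<in>insert d F. a d * g d x)) = (\<lambda>x. ?h x + a d * g d x)"
    using insert by (auto simp: add_ac)
  show ?case
    unfolding eq using test_functions_add[OF IH(1)] cm_integral_test_function_add[OF cm IH(1)] insert IH(2)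
    by (simp add: add_ac)
qed

text \<open>Continuous functions that decrease to the indicator of a closed nonempty
  \<open>C\<close>. The slope \<open>Suc k\<close> is at least 1, so all of them vanish outside the
  closed 1-neighbourhood of \<open>C\<close>. For empty \<open>C\<close> the \<open>infdist\<close>
  is 0 and the tent is constantly 1.\<close>

definition tent :: "'a::metric_space set \<Rightarrow> nat \<Rightarrow> 'a \<Rightarrow> complex" where
  "tent C k x = complex_of_real (max 0 (1 - real (Suc k) * infdist x C))"

lemma tent_eq_0:
  assumes "1 < infdist x C" shows "tent C k x = 0"
proof -
  have "1 * infdist x C \<le> real (Suc k) * infdist x C" using assms by (intro mult_right_mono) auto
  then have "1 - real (Suc k) * infdist x C \<le> 0" using assms by linarith
  then show ?thesis unfolding tent_def by (simp only: max_absorb1 of_real_0)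
qed

lemma norm_tent_le: "cmod (tent C k x) \<le> 1"
proof -
  have "0 \<le> real (Suc k) * infdist x C" by (intro mult_nonneg_nonneg infdist_nonneg) simp
  then have "\<bar>max 0 (1 - real (Suc k) * infdist x C)\<bar> \<le> 1" by linarith
  then show ?thesis unfolding tent_def norm_of_real .
qed

lemma continuous_on_tent: "continuous_on A (tent C k)"
  unfolding tent_def[abs_def] by (intro continuous_intros)

lemma tendsto_tent:
  assumes C: "closed C" "C \<noteq> {}"
  shows "(\<lambda>k. tent C k x) \<longlonglongrightarrow> indicator C x"
proof (cases "x \<in> C")
  case True
  then show ?thesis by (simp add: tent_def)
next
  case False
  then have pos: "infdist x C > 0"
    using in_closed_iff_infdist_zero[OF C, of x] infdist_nonneg[of x C] by simp
  obtain N :: nat where N: "1 < real N * infdist x C" using ex_less_of_nat_mult[OF pos] by blast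
  have "tent C k x = 0" if "k \<ge> N" for k
  proof -
    have "real N * infdist x C \<le> real (Suc k) * infdist x C" using that pos by (intro mult_right_mono) auto
    then have "1 - real (Suc k) * infdist x C \<le> 0" using N by linarith
    then show ?thesis unfolding tent_def by (simp only: max_absorb1 of_real_0)
  qed
  then have "\<forall>\<^sub>F k in sequentially. tent C k x = indicator C x"
    using False by (auto simp: eventually_sequentially)
  then show ?thesis by (rule tendsto_eventually)
qed

text \<open>Dominated convergence in each of the four variations; the Jordan decomposition
  reassembles \<open>\<gamma> C\<close>.\<close>

lemma cm_integral_compact_approx:
  fixes \<gamma> :: "'a::euclidean_space set \<Rightarrow> complex"
  assumes cm: "cmeasure \<gamma>" and C: "compact C" "C \<noteq> {}"
  shows "(\<lambda>k. cm_integral \<gamma> (tent C k)) \<longlonglongrightarrow> \<gamma> C"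
proof -
  define K where "K = {x. infdist x C \<le> 1}"
  have K: "compact K" unfolding K_def by (rule compact_infdist_le[OF C(2,1)]) simp
  have Kb: "K \<in> bounded_borel" "C \<in> bounded_borel"
    using K C(1) by (auto intro!: bounded_borelI borel_closed compact_imp_closed compact_imp_bounded)
  have meas: "tent C k \<in> borel_measurable borel" for k
    by (intro borel_measurable_continuous_onI continuous_on_tent)
  note lim = tendsto_tent[OF compact_imp_closed[OF C(1)] C(2)]
  have int: "(\<lambda>k. integral\<^sup>L (pos_variation \<nu>) (tent C k)) \<longlonglongrightarrow> of_real (measure (pos_variation \<nu>) C)"
    if \<nu>: "signed_measure \<nu>" for \<nu>
  proof -
    have Cs: "C \<in> sets (pos_variation \<nu>)" using Kb by (simp add: bounded_borel_def)
    have "(\<lambda>k. integral\<^sup>L (pos_variation \<nu>) (tent C k)) \<longlonglongrightarrow> integral\<^sup>L (pos_variation \<nu>) (indicator C :: 'a \<Rightarrow> complex)"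
    proof (rule integral_dominated_convergence[where w = "indicator K"])
      show "integrable (pos_variation \<nu>) (indicator K :: 'a \<Rightarrow> real)"
        using Kb emeasure_pos_variation_finite[OF \<nu> Kb(1)]
        by (intro integrable_real_indicator) (auto simp: bounded_borel_def)
      show "AE x in pos_variation \<nu>. norm (tent C k x) \<le> indicator K x" for k
        using norm_tent_le[of C k] tent_eq_0[of _ C k] by (intro AE_I2) (auto simp: indicator_def K_def)
    qed (use meas lim Cs in \<open>auto cong: measurable_cong_sets\<close>)
    also have "integral\<^sup>L (pos_variation \<nu>) (indicator C :: 'a \<Rightarrow> complex) = of_real (measure (pos_variation \<nu>) C)"
    proof -
      have "(indicator C :: 'a \<Rightarrow> complex) = (\<lambda>x. of_real (indicator C x))" by (auto simp: indicator_def)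
      then have "integral\<^sup>L (pos_variation \<nu>) (indicator C :: 'a \<Rightarrow> complex)
          = of_real (integral\<^sup>L (pos_variation \<nu>) (indicator C :: 'a \<Rightarrow> real))"
        by (simp only: integral_complex_of_real)
      then show ?thesis using Cs by simp
    qed
    finally show ?thesis .
  qed
  note sm = signed_measure_of_cmeasure[OF cm]
  let ?m = "\<lambda>\<nu>. complex_of_real (measure (pos_variation \<nu>) C)"
  have "(\<lambda>k. cm_integral \<gamma> (tent C k)) \<longlonglongrightarrow> (?m (\<lambda>B. Re (\<gamma> B)) - ?m (\<lambda>B. - Re (\<gamma> B)))
     + \<i> * (?m (\<lambda>B. Im (\<gamma> B)) - ?m (\<lambda>B. - Im (\<gamma> B)))"
    unfolding cm_integral_def by (intro tendsto_intros int sm)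
  also have "(?m (\<lambda>B. Re (\<gamma> B)) - ?m (\<lambda>B. - Re (\<gamma> B))) + \<i> * (?m (\<lambda>B. Im (\<gamma> B)) - ?m (\<lambda>B. - Im (\<gamma> B)))
     = of_real (Re (\<gamma> C)) + \<i> * of_real (Im (\<gamma> C))"
    using Jordan_decomposition[OF sm(1,2) Kb(2)] Jordan_decomposition[OF sm(3,4) Kb(2)]
    by (simp flip: of_real_diff)
  also have "\<dots> = \<gamma> C" by (rule complex_eq[symmetric])
  finally show ?thesis .
qed

text \<open>The induction over the sigma-algebra generated by closed sets takes place inside a ball
  \<open>K\<close>, as values on unbounded sets are meaningless; a closed set meets \<open>K\<close>
  in a compact set.\<close>

lemma cmeasure_eqI_compact:
  fixes \<gamma> \<gamma>' :: "'a::euclidean_space set \<Rightarrow> complex"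
  assumes cm: "cmeasure \<gamma>" "cmeasure \<gamma>'" and eq: "\<And>C. compact C \<Longrightarrow> \<gamma> C = \<gamma>' C" and B: "B \<in> bounded_borel"
  shows "\<gamma> B = \<gamma>' B"
proof -
  obtain r where r: "B \<subseteq> cball 0 r"
  proof -
    obtain r where "\<forall>x\<in>B. norm x \<le> r" using B by (auto simp: bounded_borel_def bounded_iff)
    then show ?thesis by (intro that[of r]) auto
  qed
  define K where "K = cball (0::'a) r"
  have Kb: "K \<in> bounded_borel" unfolding K_def by (intro bounded_borelI) auto
  have stable: "Int_stable {C :: 'a set. closed C}" "{C :: 'a set. closed C} \<subseteq> Pow UNIV"
    by (auto simp: Int_stable_def)
  have "B \<in> sigma_sets UNIV {C. closed C}"
    using B by (auto simp: bounded_borel_def borel_eq_closed sets_measure_of)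
  with stable have "\<gamma> (B \<inter> K) = \<gamma>' (B \<inter> K)"
  proof (induction rule: sigma_sets_induct_disjoint)
    case (basic A)
    then have "compact (A \<inter> K)" by (auto simp: K_def closed_Int_compact)
    then show ?case by (rule eq)
  next
    case empty
    show ?case by (simp add: cmeasure_empty[OF cm(1)] cmeasure_empty[OF cm(2)])
  next
    case (compl A)
    have A: "A \<in> sets borel" using compl(1) by (simp add: borel_eq_closed sets_measure_of)
    have e: "(UNIV - A) \<inter> K = K - A \<inter> K" by auto
    have "\<gamma> K = \<gamma>' K" by (rule eq) (simp add: K_def)
    then show ?case
      unfolding e using cmeasure_Diff[OF cm(1) bounded_borel_Int_left[OF A Kb] Kb]
        cmeasure_Diff[OF cm(2) bounded_borel_Int_left[OF A Kb] Kb] compl(2) by simp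
  next
    case (union A)
    have A: "A i \<in> sets borel" for i using union(2) by (auto simp: borel_eq_closed sets_measure_of)
    have e: "(\<Union>i. A i) \<inter> K = (\<Union>i. A i \<inter> K)" by auto
    have d: "disjoint_family (\<lambda>i. A i \<inter> K)" using union(1) by (auto simp: disjoint_family_on_def)
    have b: "bounded (\<Union>i. A i \<inter> K)"
      by (rule bounded_subset[of K]) (auto simp: K_def)
    have "(\<lambda>i. \<gamma> (A i \<inter> K)) sums \<gamma> (\<Union>i. A i \<inter> K)" "(\<lambda>i. \<gamma>' (A i \<inter> K)) sums \<gamma>' (\<Union>i. A i \<inter> K)"
      by (rule cmeasureD[OF cm(1)] cmeasureD[OF cm(2)]; use bounded_borel_Int_left[OF A Kb] d b in simp)+
    then show ?case unfolding e using union(3) sums_unique2 by simp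
  qed
  moreover have "B \<inter> K = B" using r by (auto simp: K_def)
  ultimately show ?thesis by simp
qed

lemma bump_test_function:
  fixes d :: "real^'n"
  assumes "\<delta> > 0"
  shows "(\<lambda>x. complex_of_real (max 0 (1 - dist x d / \<delta>))) \<in> test_functions"
  unfolding test_functions_def
proof (intro CollectI conjI exI[of _ "cball d \<delta>"] allI impI)
  show "continuous_on UNIV (\<lambda>x. complex_of_real (max 0 (1 - dist x d / \<delta>)))"
    by (intro continuous_intros) (use assms in auto)
  show "complex_of_real (max 0 (1 - dist x d / \<delta>)) = 0" if "x \<notin> cball d \<delta>" for x
    using that assms by (simp add: dist_commute field_simps)
qed simp

text \<open>The approximants bound the integral of a test function \<open>f\<close> by the values of \<open>f\<close> on the discrete set
  of differences, so \<open>f\<close> may be replaced by a combination of bump functions at these points.\<close>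
theorem autocorrelation_atomic:
  fixes \<Lambda> :: "(real^'n) set" and \<mu> \<gamma> :: "(real^'n) set \<Rightarrow> complex"
  assumes \<Lambda>: "uniform_discrete \<Lambda>" and D: "uniform_discrete (difference_set \<Lambda>)"
    and \<mu>: "cmeasure \<mu>" "translation_bounded \<mu>" "supported_by \<mu> \<Lambda>"
    and auto: "autocorrelation_measure \<mu> \<gamma>"
  obtains c M where "atomic_on \<gamma> (difference_set \<Lambda>) c" "\<And>d. d \<in> difference_set \<Lambda> \<Longrightarrow> cmod (c d) \<le> M"
proof -
  define DD where "DD = difference_set \<Lambda>"
  have dcD: "discrete_closed_set DD" unfolding DD_def by (rule uniform_discrete_imp_discrete_closed_set[OF D])
  have cm: "cmeasure \<gamma>" using auto by (simp add: autocorrelation_measure_def)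
  define m where "m x = \<mu> {x}" for x
  have at: "atomic_on \<mu> \<Lambda> m" unfolding m_def[abs_def]
    by (rule atomic_on_of_supported_by[OF \<mu>(1,3) uniform_discrete_imp_discrete_closed_set[OF \<Lambda>]])
  obtain M where M: "\<And>x. cmod (m x) \<le> M"
    using translation_bounded_atoms[OF \<mu>(2)] unfolding m_def by blast
  obtain Cd where Cd: "\<And>R. R \<ge> 1 \<Longrightarrow> real (card (\<Lambda> \<inter> cube R)) \<le> Cd * (2 * R) ^ CARD('n)"
    using card_uniform_discrete_cube[OF \<Lambda>] by blast
  \<comment> \<open>Point density of \<open>\<Lambda>\<close> times the square of the bound on the
    masses: this bounds all weights of the approximants, for every \<open>R \<ge> 1\<close>.\<close>
  define C where "C = Cd * M\<^sup>2"
  have approx: "cmod (cm_integral (approx_autocorrelation \<mu> R) f) \<le> C * (\<Sum>d\<in>DD \<inter> K. cmod (f d))"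
    if R: "R \<ge> 1" and f: "f \<in> test_functions" and K: "compact K" "\<And>x. x \<notin> K \<Longrightarrow> f x = 0" for R f K
  proof -
    define A where "A = \<Lambda> \<inter> cube R"
    define w where "w d = (\<Sum>(x,z)\<in>{p \<in> A \<times> A. fst p - snd p = d}. m x * cnj (m z)) / complex_of_real ((2 * R) ^ CARD('n))" for d
    have A: "finite A" "atomic_on (approx_autocorrelation \<mu> R) (difference_set A) w"
      using approx_autocorrelation_atomic[OF at, of R] by (simp_all add: A_def w_def[abs_def])
    have wb: "cmod (w d) \<le> C" for d
    proof -
      have "cmod (w d) \<le> real (card A) * M\<^sup>2 / (2 * R) ^ CARD('n)"
        unfolding w_def norm_divide using R
        by (intro frac_le sum_diagonal_bound[OF A(1) M]) (auto simp: norm_power norm_mult)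
      also have "\<dots> \<le> (Cd * (2 * R) ^ CARD('n)) * M\<^sup>2 / (2 * R) ^ CARD('n)"
        using Cd[OF R] R by (intro divide_right_mono mult_right_mono) (auto simp: A_def)
      also have "\<dots> = C" using R by (simp add: C_def)
      finally show ?thesis .
    qed
    have ds: "difference_set A = (\<lambda>p. fst p - snd p) ` (A \<times> A)"
      by (force simp: difference_set_def image_iff)
    have fin: "finite (difference_set A)" unfolding ds using A(1) by simp
    have sub: "difference_set A \<subseteq> DD" by (auto simp: difference_set_def DD_def A_def)
    have finK: "finite (DD \<inter> K)" by (rule discrete_closed_setD[OF dcD compact_imp_bounded[OF K(1)]])
    have "cmod (cm_integral (approx_autocorrelation \<mu> R) f) = cmod (\<Sum>d\<in>difference_set A. w d * f d)"
      by (subst cm_integral_atomic_finite[OF A(2) test_function_measurable[OF f] fin]) simp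
    also have "\<dots> \<le> (\<Sum>d\<in>difference_set A. C * cmod (f d))"
      by (rule sum_norm_le) (auto simp: norm_mult intro!: mult_right_mono wb)
    also have "\<dots> = C * (\<Sum>d\<in>difference_set A. cmod (f d))" by (simp add: sum_distrib_left)
    also have "(\<Sum>d\<in>difference_set A. cmod (f d)) = (\<Sum>d\<in>difference_set A \<inter> K. cmod (f d))"
      by (rule sum.mono_neutral_right[OF fin]) (use K(2) in auto)
    also have "C * \<dots> \<le> C * (\<Sum>d\<in>DD \<inter> K. cmod (f d))"
      using sub order_trans[OF norm_ge_zero wb] by (intro mult_left_mono sum_mono2 finK) auto
    finally show ?thesis .
  qed
  \<comment> \<open>A limit point is approached along some large \<open>R\<close> only, which
    suffices because the estimate \<open>approx\<close> is uniform in \<open>R\<close>.\<close>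
  have bound: "cmod (cm_integral \<gamma> f) \<le> C * (\<Sum>d\<in>DD \<inter> K. cmod (f d))"
    if f: "f \<in> test_functions" and K: "compact K" "\<And>x. x \<notin> K \<Longrightarrow> f x = 0" for f K
  proof (rule field_le_epsilon)
    fix e :: real assume "e > 0"
    have "\<exists>\<^sub>F R in at_top. \<forall>f\<in>{f}. dist (cm_integral (approx_autocorrelation \<mu> R) f) (cm_integral \<gamma> f) < e"
      using auto f \<open>e > 0\<close> unfolding autocorrelation_measure_def by blast
    then have "\<exists>\<^sub>F R in at_top. R \<ge> 1 \<and> (\<forall>f\<in>{f}. dist (cm_integral (approx_autocorrelation \<mu> R) f) (cm_integral \<gamma> f) < e)"
      by (rule frequently_mp[rotated, OF _ eventually_mono[OF eventually_ge_at_top[of 1]]]) simp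
    then obtain R where R: "R \<ge> 1" "dist (cm_integral (approx_autocorrelation \<mu> R) f) (cm_integral \<gamma> f) < e"
      using frequently_ex by fastforce
    have "cmod (cm_integral \<gamma> f) \<le> cmod (cm_integral (approx_autocorrelation \<mu> R) f) + e"
      using R(2) norm_triangle_sub[of "cm_integral \<gamma> f" "cm_integral (approx_autocorrelation \<mu> R) f"]
      by (simp add: dist_norm norm_minus_commute)
    then show "cmod (cm_integral \<gamma> f) \<le> C * (\<Sum>d\<in>DD \<inter> K. cmod (f d)) + e"
      using approx[OF R(1) f K] by simp
  qed
  obtain \<delta> where \<delta>: "\<delta> > 0" "\<And>x y. x \<in> DD \<Longrightarrow> y \<in> DD \<Longrightarrow> dist x y < \<delta> \<Longrightarrow> x = y"
    using D unfolding DD_def uniform_discrete_def by blast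
  \<comment> \<open>The radius \<open>\<delta>\<close> is a separation of the differences, so among
    them \<open>\<beta> d\<close> is 1 at \<open>d\<close> and 0 elsewhere.\<close>
  define \<beta> where "\<beta> d x = complex_of_real (max 0 (1 - dist x d / \<delta>))" for d x :: "real^'n"
  have \<beta>t: "\<beta> d \<in> test_functions" for d unfolding \<beta>_def[abs_def] by (rule bump_test_function[OF \<delta>(1)])
  have \<beta>D: "\<beta> d x = (if x = d then 1 else 0)" if "x \<in> DD" "d \<in> DD" for d x
    using \<delta>(2)[OF that] \<delta>(1) by (force simp: \<beta>_def field_simps)
  have \<beta>0: "\<beta> d x = 0" if "x \<notin> cball d \<delta>" for d x
    using that \<delta>(1) by (simp add: \<beta>_def dist_commute field_simps)
  define c where "c d = cm_integral \<gamma> (\<beta> d)" for d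
  have cb: "cmod (c d) \<le> C" if d: "d \<in> DD" for d
  proof -
    have "DD \<inter> cball d \<delta> = insert d (DD \<inter> cball d \<delta> - {d})" using d \<delta>(1) by auto
    have fin: "finite (DD \<inter> cball d \<delta>)" by (rule discrete_closed_setD[OF dcD]) simp
    have "cmod (c d) \<le> C * (\<Sum>x\<in>DD \<inter> cball d \<delta>. cmod (\<beta> d x))"
      unfolding c_def by (rule bound[OF \<beta>t]) (use \<beta>0 in auto)
    also have "(\<Sum>x\<in>DD \<inter> cball d \<delta>. cmod (\<beta> d x)) = (\<Sum>x\<in>DD \<inter> cball d \<delta>. if x = d then 1 else 0)"
      by (intro sum.cong) (auto simp: \<beta>D d)
    also have "\<dots> = 1" using fin d \<delta>(1) by simp
    finally show ?thesis by simp
  qed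
  have formula: "cm_integral \<gamma> f = (\<Sum>d\<in>DD \<inter> K. f d * c d)"
    if f: "f \<in> test_functions" and K: "compact K" "\<And>x. x \<notin> K \<Longrightarrow> f x = 0" for f K
  proof -
    define K' where "K' = K \<union> (\<Union>d\<in>DD \<inter> K. cball d \<delta>)"
    have fin: "finite (DD \<inter> K)" by (rule discrete_closed_setD[OF dcD compact_imp_bounded[OF K(1)]])
    have K': "compact K'" unfolding K'_def by (intro compact_Un K compact_UN fin) auto
    \<comment> \<open>\<open>h\<close> vanishes at all differences, so \<open>bound\<close> makes
      its integral 0 and the integral of \<open>f\<close> becomes a combination of the
      \<open>c d\<close>. The larger compact set \<open>K'\<close> contains the supports of the
      bumps.\<close>
    define h where "h x = f x + (\<Sum>d\<in>DD \<inter> K. - f d * \<beta> d x)" for x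
    have h: "h \<in> test_functions" "cm_integral \<gamma> h = cm_integral \<gamma> f + (\<Sum>d\<in>DD \<inter> K. - f d * c d)"
      using cm_integral_test_function_sum[OF cm f fin \<beta>t, of "\<lambda>d. - f d"] unfolding h_def[abs_def] c_def by auto
    have hD: "h x = 0" if x: "x \<in> DD" for x
    proof -
      have "(\<Sum>d\<in>DD \<inter> K. - f d * \<beta> d x) = (\<Sum>d\<in>DD \<inter> K. if x = d then - f d else 0)"
        by (intro sum.cong) (auto simp: \<beta>D x)
      also have "\<dots> = - f x" using fin x K(2) by auto
      finally show ?thesis by (simp add: h_def)
    qed
    have "cmod (cm_integral \<gamma> h) \<le> C * (\<Sum>d\<in>DD \<inter> K'. cmod (h d))"
    proof (rule bound[OF h(1) K'])
      fix x assume "x \<notin> K'"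
      then show "h x = 0" using K(2) \<beta>0 by (simp add: h_def K'_def)
    qed
    also have "\<dots> = 0" using hD by simp
    finally show ?thesis using h(2) by (simp add: sum_negf)
  qed
  define \<gamma>' where "\<gamma>' B = (\<Sum>d\<in>DD \<inter> B. c d)" for B
  have at': "atomic_on \<gamma>' DD c" using dcD by (simp add: atomic_on_def \<gamma>'_def)
  have eqC: "\<gamma> E = \<gamma>' E" if E: "compact E" for E
  \<comment> \<open>The tents of the empty set do not tend to its indicator, so this case is
    separate.\<close>
  proof (cases "E = {}")
    case True
    then show ?thesis using cmeasure_empty[OF cm] by (simp add: \<gamma>'_def)
  next
    case False
    define K where "K = {x. infdist x E \<le> 1}"
    have K: "compact K" unfolding K_def by (rule compact_infdist_le[OF False E]) simp
    have supp: "tent E k x = 0" if "x \<notin> K" for k x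
      by (rule tent_eq_0) (use that in \<open>simp add: K_def\<close>)
    have ft: "tent E k \<in> test_functions" for k
      unfolding test_functions_def
      by (intro CollectI conjI exI[of _ K] allI impI K supp continuous_on_tent)
    have "(\<lambda>k. cm_integral \<gamma> (tent E k)) \<longlonglongrightarrow> \<gamma> E"
      by (rule cm_integral_compact_approx[OF cm E False])
    moreover have "(\<lambda>k. \<Sum>d\<in>DD \<inter> K. tent E k d * c d) \<longlonglongrightarrow> (\<Sum>d\<in>DD \<inter> K. indicator E d * c d)"
      by (intro tendsto_intros tendsto_tent compact_imp_closed E False)
    moreover have "(\<lambda>k. cm_integral \<gamma> (tent E k)) = (\<lambda>k. \<Sum>d\<in>DD \<inter> K. tent E k d * c d)"
      using formula[OF ft K supp] by auto
    ultimately have "\<gamma> E = (\<Sum>d\<in>DD \<inter> K. indicator E d * c d)" using LIMSEQ_unique by metis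
    also have "\<dots> = \<gamma>' E"
    proof -
      have fin: "finite (DD \<inter> K)" by (rule discrete_closed_setD[OF dcD compact_imp_bounded[OF K]])
      have "E \<subseteq> K" by (auto simp: K_def infdist_zero)
      then have "DD \<inter> K \<inter> E = DD \<inter> E" by auto
      then show ?thesis unfolding \<gamma>'_def
        using sum.inter_restrict[OF fin, of c E] by (auto simp: indicator_def intro!: sum.cong)
    qed
    finally show ?thesis .
  qed
  have "atomic_on \<gamma> DD c"
    using dcD cmeasure_eqI_compact[OF cm cmeasure_of_atomic_on[OF at'] eqC] by (simp add: atomic_on_def \<gamma>'_def)
  with cb show thesis using that unfolding DD_def by blast
qed

section \<open>Gaussians\<close>

text \<open>Normalised by height and not by integral: the value at \<open>x\<close> is always 1, and
  as \<open>\<kappa>\<close> grows the functions shrink to the indicator of the point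
  \<open>x\<close>, so that integrals tend to the mass of an atom.\<close>

definition gaussian :: "real \<Rightarrow> 'a::real_inner \<Rightarrow> 'a \<Rightarrow> real" where
  "gaussian \<kappa> x t = exp (- (\<kappa>\<^sup>2 / 2) * ((t - x) \<bullet> (t - x)))"

lemma gaussian_pos: "gaussian \<kappa> x t > 0"
  by (simp add: gaussian_def)

lemma has_derivative_real_polynomial_line:
  fixes p :: "'a::real_normed_vector \<Rightarrow> real"
  assumes "real_polynomial_function p"
  shows "\<exists>p'. real_polynomial_function p' \<and> (\<forall>x. ((\<lambda>t. p (x + t *\<^sub>R e)) has_real_derivative p' x) (at 0))"
  using assms
proof (induction p rule: real_polynomial_function.induct)
  case (linear f)
  interpret bounded_linear f by fact
  have "((\<lambda>t. f (x + t *\<^sub>R e)) has_real_derivative f e) (at 0)" for x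
    unfolding add scaleR by (auto intro!: derivative_eq_intros)
  then show ?case by (intro exI[of _ "\<lambda>x. f e"]) auto
next
  case (const c)
  then show ?case by (intro exI[of _ "\<lambda>x. 0"]) auto
next
  case (add f g)
  then obtain f' g' where "real_polynomial_function f'" "real_polynomial_function g'"
    "\<And>x. ((\<lambda>t. f (x + t *\<^sub>R e)) has_real_derivative f' x) (at 0)"
    "\<And>x. ((\<lambda>t. g (x + t *\<^sub>R e)) has_real_derivative g' x) (at 0)" by blast
  then show ?case by (intro exI[of _ "\<lambda>x. f' x + g' x"]) (auto intro!: derivative_intros)
next
  case (mult f g)
  then obtain f' g' where "real_polynomial_function f'" "real_polynomial_function g'"
    "\<And>x. ((\<lambda>t. f (x + t *\<^sub>R e)) has_real_derivative f' x) (at 0)"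
    "\<And>x. ((\<lambda>t. g (x + t *\<^sub>R e)) has_real_derivative g' x) (at 0)" by blast
  then show ?case using mult.hyps
    by (intro exI[of _ "\<lambda>x. f' x * g x + g' x * f x"]) (auto intro!: derivative_eq_intros)
qed

lemma real_polynomial_function_growth:
  fixes p :: "'a::real_normed_vector \<Rightarrow> real"
  assumes "real_polynomial_function p"
  shows "\<exists>C k. C \<ge> 0 \<and> (\<forall>x. \<bar>p x\<bar> \<le> C * (1 + norm x) ^ k)"
  using assms
proof (induction p rule: real_polynomial_function.induct)
  case (linear f)
  then obtain K where K: "K > 0" "\<And>x. norm (f x) \<le> norm x * K" using bounded_linear.pos_bounded by blast
  have "\<bar>f x\<bar> \<le> K * (1 + norm x) ^ 1" for x using K(2)[of x] K(1) by (simp add: algebra_simps)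
  then show ?case using K(1) less_imp_le by blast
next
  case (const c)
  then show ?case by (intro exI[of _ "\<bar>c\<bar>"] exI[of _ 0]) auto
next
  case (add f g)
  then obtain C k C' k' where *: "C \<ge> 0" "\<And>x. \<bar>f x\<bar> \<le> C * (1 + norm x) ^ k"
    "C' \<ge> 0" "\<And>x. \<bar>g x\<bar> \<le> C' * (1 + norm x) ^ k'" by blast
  have "\<bar>f x + g x\<bar> \<le> (C + C') * (1 + norm x) ^ (k + k')" for x
  proof -
    have "(1 + norm x) ^ k \<le> (1 + norm x) ^ (k + k')" "(1 + norm x) ^ k' \<le> (1 + norm x) ^ (k + k')"
      by (intro power_increasing; simp)+
    then have "C * (1 + norm x) ^ k + C' * (1 + norm x) ^ k' \<le> C * (1 + norm x) ^ (k + k') + C' * (1 + norm x) ^ (k + k')"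
      using *(1,3) by (intro add_mono mult_left_mono)
    then show ?thesis using *(2)[of x] *(4)[of x] abs_triangle_ineq[of "f x" "g x"] by (simp add: distrib_right)
  qed
  then show ?case using *(1,3) by (intro exI[of _ "C + C'"] exI[of _ "k + k'"]) auto
next
  case (mult f g)
  then obtain C k C' k' where *: "C \<ge> 0" "\<And>x. \<bar>f x\<bar> \<le> C * (1 + norm x) ^ k"
    "C' \<ge> 0" "\<And>x. \<bar>g x\<bar> \<le> C' * (1 + norm x) ^ k'" by blast
  have "\<bar>f x * g x\<bar> \<le> (C * C') * (1 + norm x) ^ (k + k')" for x
  proof -
    have "\<bar>f x\<bar> * \<bar>g x\<bar> \<le> (C * (1 + norm x) ^ k) * (C' * (1 + norm x) ^ k')"
      using *(2)[of x] *(4)[of x] order_trans[OF abs_ge_zero *(2)[of x]] by (intro mult_mono) auto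
    then show ?thesis by (simp add: abs_mult power_add mult_ac)
  qed
  then show ?case using *(1,3) by (intro exI[of _ "C * C'"] exI[of _ "k + k'"]) auto
qed

text \<open>Completing the square bounds the Gaussian by a multiple of \<open>exp (- u)\<close> with
  \<open>u = norm (t - x)\<close>, and a single term of the exponential series dominates the
  power.\<close>

lemma power_gaussian_bounded:
  fixes x :: "'a::real_inner"
  assumes "\<kappa> > 0"
  shows "\<exists>K. \<forall>t. (1 + norm t) ^ k * gaussian \<kappa> x t \<le> K"
proof -
  have "(1 + norm t) ^ k * gaussian \<kappa> x t \<le> (1 + norm x) ^ k * (fact k * exp (1 + 1 / (2 * \<kappa>\<^sup>2)))" for t
  proof -
    define u where "u = norm (t - x)"
    have u: "u \<ge> 0" by (simp add: u_def)
    have "norm t \<le> norm x + u" unfolding u_def by (metis add.commute norm_triangle_sub)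
    also have "1 + (norm x + u) \<le> (1 + norm x) * (1 + u)" using u by (simp add: algebra_simps)
    finally have 1: "(1 + norm t) ^ k \<le> ((1 + norm x) * (1 + u)) ^ k" by (intro power_mono) auto
    have "(\<kappa>\<^sup>2 / 2) * u\<^sup>2 \<ge> u - 1 / (2 * \<kappa>\<^sup>2)"
    proof -
      have "0 \<le> (\<kappa> * u - 1 / \<kappa>)\<^sup>2" by simp
      also have "\<dots> = \<kappa>\<^sup>2 * u\<^sup>2 - 2 * u + 1 / \<kappa>\<^sup>2" using assms by (simp add: power2_eq_square field_simps)
      finally show ?thesis by simp
    qed
    then have "gaussian \<kappa> x t \<le> exp (1 / (2 * \<kappa>\<^sup>2) - u)"
      by (simp add: gaussian_def u_def power2_norm_eq_inner)
    also have "\<dots> = exp (1 + 1 / (2 * \<kappa>\<^sup>2)) / exp (1 + u)" by (simp flip: exp_diff)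
    finally have 2: "gaussian \<kappa> x t \<le> exp (1 + 1 / (2 * \<kappa>\<^sup>2)) / exp (1 + u)" .
    have "(1 + u) ^ k / fact k \<le> exp (1 + u)"
    proof -
      have "(\<Sum>n\<in>{k}. (1 + u) ^ n /\<^sub>R fact n) \<le> (\<Sum>n. (1 + u) ^ n /\<^sub>R fact n)"
        using u by (intro sum_le_suminf summable_exp_generic) auto
      then show ?thesis by (simp add: exp_def divide_inverse mult.commute)
    qed
    then have 3: "(1 + u) ^ k \<le> fact k * exp (1 + u)" by (simp add: field_simps)
    have "(1 + norm t) ^ k * gaussian \<kappa> x t
        \<le> ((1 + norm x) ^ k * (fact k * exp (1 + u))) * (exp (1 + 1 / (2 * \<kappa>\<^sup>2)) / exp (1 + u))"
    proof (rule mult_mono)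
      show "(1 + norm t) ^ k \<le> (1 + norm x) ^ k * (fact k * exp (1 + u))"
        using 1 mult_left_mono[OF 3, of "(1 + norm x) ^ k"] by (simp add: power_mult_distrib)
    qed (use 2 gaussian_pos[of \<kappa> x t] in auto)
    then show ?thesis by simp
  qed
  then show ?thesis by blast
qed

text \<open>Polynomials times a fixed Gaussian are closed under partial derivatives, so all iterated
  derivatives have this form and their decay reduces to
  \<open>power_gaussian_bounded\<close>.\<close>

lemma partial_deriv_polynomial_gaussian:
  fixes p :: "real^'n \<Rightarrow> real"
  assumes "real_polynomial_function p"
  shows "\<exists>q. real_polynomial_function q \<and>
    partial_deriv i (\<lambda>t. complex_of_real (p t * gaussian \<kappa> x t)) = (\<lambda>t. complex_of_real (q t * gaussian \<kappa> x t))"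
proof -
  obtain p' where p': "real_polynomial_function p'"
    "\<And>x. ((\<lambda>t. p (x + t *\<^sub>R axis i 1)) has_real_derivative p' x) (at 0)"
    using has_derivative_real_polynomial_line[OF assms] by blast
  define q where "q t = p' t - \<kappa>\<^sup>2 * ((t - x) \<bullet> axis i 1) * p t" for t
  have lin: "real_polynomial_function (\<lambda>t. t \<bullet> axis i 1 :: real)"
    by (rule real_polynomial_function.intros(1)) (rule bounded_linear_inner_left)
  have "real_polynomial_function (\<lambda>t. p' t - (\<kappa>\<^sup>2 * (t \<bullet> axis i 1 - x \<bullet> axis i 1)) * p t)"
    by (intro real_polynomial_function_diff real_polynomial_function.intros(2,4) p'(1) assms lin)
  then have q: "real_polynomial_function q" by (simp add: q_def[abs_def] inner_diff_left)
  have g: "((\<lambda>s. gaussian \<kappa> x (t + s *\<^sub>R axis i 1)) has_real_derivative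
      - \<kappa>\<^sup>2 * ((t - x) \<bullet> axis i 1) * gaussian \<kappa> x t) (at 0)" for t
  proof -
    have e: "gaussian \<kappa> x (t + s *\<^sub>R axis i 1)
      = exp (- (\<kappa>\<^sup>2 / 2) * ((t - x) \<bullet> (t - x) + 2 * s * ((t - x) \<bullet> axis i 1) + s\<^sup>2))" for s
    proof -
      have "(t + s *\<^sub>R axis i 1 - x) \<bullet> (t + s *\<^sub>R axis i 1 - x)
         = (t - x) \<bullet> (t - x) + 2 * s * ((t - x) \<bullet> axis i 1) + s\<^sup>2 * (axis i 1 \<bullet> axis i (1::real))"
        by (simp add: inner_add_left inner_add_right inner_diff_left inner_diff_right inner_commute
            power2_eq_square algebra_simps)
      then show ?thesis by (simp add: gaussian_def inner_axis_axis)
    qed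
    show ?thesis unfolding e by (auto intro!: derivative_eq_intros simp: gaussian_def)
  qed
  have "partial_deriv i (\<lambda>t. complex_of_real (p t * gaussian \<kappa> x t)) t = complex_of_real (q t * gaussian \<kappa> x t)" for t
    unfolding partial_deriv_def
  proof (rule vector_derivative_at)
    have "((\<lambda>s. p (t + s *\<^sub>R axis i 1) * gaussian \<kappa> x (t + s *\<^sub>R axis i 1)) has_real_derivative q t * gaussian \<kappa> x t) (at 0)"
      by (rule DERIV_cong[OF DERIV_mult[OF p'(2) g]]) (simp add: q_def algebra_simps)
    then show "((\<lambda>s. complex_of_real (p (t + s *\<^sub>R axis i 1) * gaussian \<kappa> x (t + s *\<^sub>R axis i 1)))
        has_vector_derivative complex_of_real (q t * gaussian \<kappa> x t)) (at 0)"
      by (intro has_vector_derivative_of_real) (simp add: has_real_derivative_iff_has_vector_derivative)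
  qed
  with q show ?thesis by blast
qed

lemma schwartz_gaussian:
  fixes x :: "real^'n"
  assumes \<kappa>: "\<kappa> > 0"
  shows "schwartz (\<lambda>t. complex_of_real (gaussian \<kappa> x t))"
  unfolding schwartz_def
proof (intro allI)
  fix "is" :: "'n list"
  have "\<exists>q. real_polynomial_function q \<and>
    foldr partial_deriv is (\<lambda>t. complex_of_real (gaussian \<kappa> x t)) = (\<lambda>t. complex_of_real (q t * gaussian \<kappa> x t))"
  proof (induction "is")
    case Nil
    show ?case by (intro exI[of _ "\<lambda>t. 1"]) auto
  next
    case (Cons i "is")
    then show ?case using partial_deriv_polynomial_gaussian by fastforce
  qed
  then obtain q where q: "real_polynomial_function q"
    and eq: "foldr partial_deriv is (\<lambda>t. complex_of_real (gaussian \<kappa> x t)) = (\<lambda>t. complex_of_real (q t * gaussian \<kappa> x t))"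
    by blast
  show "(\<forall>t. foldr partial_deriv is (\<lambda>t. complex_of_real (gaussian \<kappa> x t)) differentiable (at t)) \<and>
    (\<forall>k::nat. bounded (range (\<lambda>t. (1 + norm t) ^ k *\<^sub>R foldr partial_deriv is (\<lambda>t. complex_of_real (gaussian \<kappa> x t)) t)))"
    unfolding eq
  proof (intro conjI allI)
    fix t
    have "q differentiable (at t)"
      using differentiable_at_polynomial_function[of q t UNIV] q by (simp add: real_polynomial_function_eq)
    moreover have "gaussian \<kappa> x differentiable (at t)"
      unfolding gaussian_def[abs_def] differentiable_def
      by (rule exI) (auto intro!: derivative_eq_intros)
    ultimately have "(\<lambda>t. q t * gaussian \<kappa> x t) differentiable (at t)" by (rule differentiable_mult)
    then obtain D where "((\<lambda>t. q t * gaussian \<kappa> x t) has_derivative D) (at t)" by (auto simp: differentiable_def)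
    from bounded_linear.has_derivative[OF bounded_linear_of_real this]
    show "(\<lambda>t. complex_of_real (q t * gaussian \<kappa> x t)) differentiable (at t)" by (auto simp: differentiable_def)
  next
    fix k
    obtain C m where C: "C \<ge> 0" "\<And>t. \<bar>q t\<bar> \<le> C * (1 + norm t) ^ m" using real_polynomial_function_growth[OF q] by blast
    obtain K where K: "\<And>t. (1 + norm t) ^ (k + m) * gaussian \<kappa> x t \<le> K" using power_gaussian_bounded[OF \<kappa>] by blast
    have "norm ((1 + norm t) ^ k *\<^sub>R complex_of_real (q t * gaussian \<kappa> x t)) \<le> C * K" for t
    proof -
      have "norm ((1 + norm t) ^ k *\<^sub>R complex_of_real (q t * gaussian \<kappa> x t)) = (1 + norm t) ^ k * gaussian \<kappa> x t * \<bar>q t\<bar>"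
        using gaussian_pos[of \<kappa> x t] by (simp add: abs_mult norm_mult)
      also have "\<dots> \<le> (1 + norm t) ^ k * gaussian \<kappa> x t * (C * (1 + norm t) ^ m)"
        using gaussian_pos[of \<kappa> x t] by (intro mult_left_mono C) auto
      also have "\<dots> = C * ((1 + norm t) ^ (k + m) * gaussian \<kappa> x t)" by (simp add: power_add)
      also have "\<dots> \<le> C * K" by (intro mult_left_mono K C)
      finally show ?thesis .
    qed
    then show "bounded (range (\<lambda>t. (1 + norm t) ^ k *\<^sub>R complex_of_real (q t * gaussian \<kappa> x t)))"
      unfolding bounded_iff by blast
  qed
qed

section \<open>Fourier transforms of Gaussians\<close>

text \<open>This is the characteristic function of the standard normal distribution at
  \<open>r = - 2 * pi * s / \<kappa>\<close>, after the substitution that stretches \<open>t\<close>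
  by \<open>\<kappa>\<close>.\<close>

lemma fourier_gaussian_real:
  assumes "\<kappa> > 0"
  shows "integrable lborel (\<lambda>t::real. complex_of_real (exp (- (\<kappa>\<^sup>2 / 2) * t\<^sup>2)) * exp (- 2 * pi * \<i> * complex_of_real (s * t)))" (is ?int)
    and "(LINT t|lborel. complex_of_real (exp (- (\<kappa>\<^sup>2 / 2) * t\<^sup>2)) * exp (- 2 * pi * \<i> * complex_of_real (s * t)))
       = complex_of_real (sqrt (2 * pi) / \<kappa> * exp (- 2 * pi\<^sup>2 * s\<^sup>2 / \<kappa>\<^sup>2))" (is ?eq)
proof -
  define r where "r = - 2 * pi * s / \<kappa>"
  define f where "f x = complex_of_real (std_normal_density x) * iexp (r * x)" for x
  have "integrable std_normal_distribution (\<lambda>x. iexp (r * x))"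
    using real_dist_normal_dist by (intro prob_space.integrable_iexp real_distribution.axioms(1)) auto
  then have f: "integrable lborel f"
    unfolding f_def by (subst (asm) integrable_density) (auto simp: normal_density_nonneg scaleR_conv_of_real)
  have If: "integral\<^sup>L lborel f = complex_of_real (exp (- (r\<^sup>2) / 2))"
  proof -
    have "char std_normal_distribution r = integral\<^sup>L lborel f"
      unfolding char_def f_def by (subst integral_density) (auto simp: normal_density_nonneg scaleR_conv_of_real)
    then show ?thesis using char_std_normal_distribution by (simp add: fun_eq_iff)
  qed
  have eq: "(\<lambda>t::real. complex_of_real (exp (- (\<kappa>\<^sup>2 / 2) * t\<^sup>2)) * exp (- 2 * pi * \<i> * complex_of_real (s * t)))
     = (\<lambda>t. complex_of_real (sqrt (2 * pi)) * f (0 + \<kappa> * t))"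
  proof
    fix t :: real
    have "complex_of_real (sqrt (2 * pi)) * f (0 + \<kappa> * t) = complex_of_real (sqrt (2 * pi) * std_normal_density (\<kappa> * t)) * iexp (r * (\<kappa> * t))"
      by (simp add: f_def)
    also have "sqrt (2 * pi) * std_normal_density (\<kappa> * t) = exp (- (\<kappa>\<^sup>2 / 2) * t\<^sup>2)"
      by (simp add: std_normal_density_def power_mult_distrib)
    also have "\<i> * complex_of_real (r * (\<kappa> * t)) = - 2 * pi * \<i> * complex_of_real (s * t)"
      using assms by (simp add: r_def)
    finally show "complex_of_real (exp (- (\<kappa>\<^sup>2 / 2) * t\<^sup>2)) * exp (- 2 * pi * \<i> * complex_of_real (s * t))
      = complex_of_real (sqrt (2 * pi)) * f (0 + \<kappa> * t)" by simp
  qed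
  show ?int unfolding eq using lborel_integrable_real_affine[OF f, of \<kappa> 0] assms by simp
  have "integral\<^sup>L lborel f = \<bar>\<kappa>\<bar> *\<^sub>R (LINT t|lborel. f (0 + \<kappa> * t))"
    by (rule lborel_integral_real_affine) (use assms in simp)
  then have "(LINT t|lborel. f (0 + \<kappa> * t)) = complex_of_real (exp (- (r\<^sup>2) / 2)) / \<kappa>"
    using assms unfolding If by (simp add: scaleR_conv_of_real field_simps)
  then show ?eq unfolding eq
    by (simp add: r_def power_mult_distrib power_divide)
qed

text \<open>Fubini for product functions, as \<open>lborel\<close> is the image of the product
  measure over \<open>Basis\<close>.\<close>

lemma integral_lborel_prod:
  fixes f :: "'a::euclidean_space \<Rightarrow> real \<Rightarrow> complex"
  assumes int: "\<And>b. b \<in> Basis \<Longrightarrow> integrable lborel (f b)"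
  shows "integrable lborel (\<lambda>x. \<Prod>b\<in>Basis. f b (x \<bullet> b))"
    and "(LINT x|lborel. (\<Prod>b\<in>Basis. f b (x \<bullet> b))) = (\<Prod>b\<in>Basis. (LINT t|lborel. f b t))"
proof -
  interpret product_sigma_finite "\<lambda>b::'a. lborel :: real measure" by standard
  have meas: "(\<lambda>g. \<Sum>b\<in>Basis. g b *\<^sub>R b) \<in> measurable (\<Pi>\<^sub>M b\<in>(Basis::'a set). lborel) borel" by measurable
  have fm: "f b \<in> borel_measurable borel" if "b \<in> Basis" for b using int[OF that] by auto
  have F: "(\<lambda>x. \<Prod>b\<in>Basis. f b (x \<bullet> b)) \<in> borel_measurable borel"
    by (intro borel_measurable_prod measurable_compose[OF _ fm]) auto
  have eq: "(\<Prod>b\<in>Basis. f b ((\<Sum>b\<in>Basis. g b *\<^sub>R b) \<bullet> b)) = (\<Prod>b\<in>Basis. f b (g b))" for g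
    by (intro prod.cong) auto
  let ?d = "distr (\<Pi>\<^sub>M b\<in>(Basis::'a set). lborel) borel (\<lambda>g. \<Sum>b\<in>Basis. g b *\<^sub>R b)"
  have d: "lborel = ?d" by (rule lborel_eq)
  have "integrable ?d (\<lambda>x. \<Prod>b\<in>Basis. f b (x \<bullet> b))"
    unfolding integrable_distr_eq[OF meas F] eq by (rule product_integrable_prod[OF finite_Basis int])
  then show "integrable lborel (\<lambda>x. \<Prod>b\<in>Basis. f b (x \<bullet> b))" by (simp only: d[symmetric])
  have "integral\<^sup>L ?d (\<lambda>x. \<Prod>b\<in>Basis. f b (x \<bullet> b)) = (\<Prod>b\<in>Basis. (LINT t|lborel. f b t))"
    unfolding integral_distr[OF meas F] eq by (rule product_integral_prod[OF finite_Basis int])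
  then show "(LINT x|lborel. (\<Prod>b\<in>Basis. f b (x \<bullet> b))) = (\<Prod>b\<in>Basis. (LINT t|lborel. f b t))"
    by (simp only: d[symmetric])
qed

lemma fourier_gaussian_0:
  fixes s :: "'a::euclidean_space"
  assumes "\<kappa> > 0"
  shows "integrable lborel (\<lambda>t. complex_of_real (gaussian \<kappa> 0 t) * exp (- 2 * pi * \<i> * complex_of_real (s \<bullet> t)))"
    and "(LINT t|lborel. complex_of_real (gaussian \<kappa> 0 t) * exp (- 2 * pi * \<i> * complex_of_real (s \<bullet> t)))
      = complex_of_real ((sqrt (2 * pi) / \<kappa>) ^ DIM('a) * exp (- 2 * pi\<^sup>2 * (s \<bullet> s) / \<kappa>\<^sup>2))"
proof -
  define f where "f b t = complex_of_real (exp (- (\<kappa>\<^sup>2 / 2) * t\<^sup>2)) * exp (- 2 * pi * \<i> * complex_of_real ((s \<bullet> b) * t))" for b :: 'a and t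
  have eq: "complex_of_real (gaussian \<kappa> 0 t) * exp (- 2 * pi * \<i> * complex_of_real (s \<bullet> t)) = (\<Prod>b\<in>Basis. f b (t \<bullet> b))" for t
  proof -
    have "gaussian \<kappa> 0 t = (\<Prod>b\<in>Basis. exp (- (\<kappa>\<^sup>2 / 2) * (t \<bullet> b)\<^sup>2))"
      unfolding gaussian_def exp_sum[OF finite_Basis, symmetric] sum_distrib_left[symmetric]
      by (subst euclidean_inner) (simp add: power2_eq_square)
    moreover have "exp (- 2 * pi * \<i> * complex_of_real (s \<bullet> t)) = (\<Prod>b\<in>Basis. exp (- 2 * pi * \<i> * complex_of_real ((s \<bullet> b) * (t \<bullet> b))))"
      unfolding exp_sum[OF finite_Basis, symmetric] sum_distrib_left[symmetric] of_real_sum[symmetric]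
      by (subst euclidean_inner) simp
    ultimately show ?thesis by (simp add: f_def prod.distrib)
  qed
  have int: "integrable lborel (f b)" for b unfolding f_def by (rule fourier_gaussian_real(1)[OF assms])
  have val: "(LINT t|lborel. f b t) = complex_of_real (sqrt (2 * pi) / \<kappa> * exp (- 2 * pi\<^sup>2 * (s \<bullet> b)\<^sup>2 / \<kappa>\<^sup>2))" for b
    unfolding f_def by (rule fourier_gaussian_real(2)[OF assms])
  show "integrable lborel (\<lambda>t. complex_of_real (gaussian \<kappa> 0 t) * exp (- 2 * pi * \<i> * complex_of_real (s \<bullet> t)))"
    unfolding eq by (rule integral_lborel_prod(1)[OF int])
  have "(LINT t|lborel. complex_of_real (gaussian \<kappa> 0 t) * exp (- 2 * pi * \<i> * complex_of_real (s \<bullet> t)))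
     = complex_of_real (\<Prod>b\<in>(Basis::'a set). sqrt (2 * pi) / \<kappa> * exp (- 2 * pi\<^sup>2 * (s \<bullet> b)\<^sup>2 / \<kappa>\<^sup>2))"
    unfolding eq by (subst integral_lborel_prod(2)[OF int]) (simp only: val of_real_prod)
  also have "(\<Prod>b\<in>(Basis::'a set). sqrt (2 * pi) / \<kappa> * exp (- 2 * pi\<^sup>2 * (s \<bullet> b)\<^sup>2 / \<kappa>\<^sup>2))
     = (sqrt (2 * pi) / \<kappa>) ^ DIM('a) * exp (\<Sum>b\<in>Basis. - 2 * pi\<^sup>2 * (s \<bullet> b)\<^sup>2 / \<kappa>\<^sup>2)"
    by (simp only: prod.distrib prod_constant exp_sum[OF finite_Basis])
  also have "(\<Sum>b\<in>Basis. - 2 * pi\<^sup>2 * (s \<bullet> b)\<^sup>2 / \<kappa>\<^sup>2) = - 2 * pi\<^sup>2 * (s \<bullet> s) / \<kappa>\<^sup>2"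
    by (subst euclidean_inner) (simp add: power2_eq_square sum_divide_distrib sum_distrib_left sum_negf)
  finally show "(LINT t|lborel. complex_of_real (gaussian \<kappa> 0 t) * exp (- 2 * pi * \<i> * complex_of_real (s \<bullet> t)))
      = complex_of_real ((sqrt (2 * pi) / \<kappa>) ^ DIM('a) * exp (- 2 * pi\<^sup>2 * (s \<bullet> s) / \<kappa>\<^sup>2))" .
qed

lemma integral_gaussian:
  assumes "\<kappa> > 0"
  shows "integrable lborel (gaussian \<kappa> (0 :: 'a::euclidean_space))"
    and "(LINT t|lborel. gaussian \<kappa> (0 :: 'a::euclidean_space) t) = (sqrt (2 * pi) / \<kappa>) ^ DIM('a)"
proof -
  have "integrable lborel (\<lambda>t. complex_of_real (gaussian \<kappa> (0::'a) t))"
    using fourier_gaussian_0(1)[OF assms, of 0] by simp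
  then show "integrable lborel (gaussian \<kappa> (0 :: 'a))" by (simp only: complex_of_real_integrable_eq)
  have "(LINT t|lborel. complex_of_real (gaussian \<kappa> (0::'a) t)) = complex_of_real ((sqrt (2 * pi) / \<kappa>) ^ DIM('a))"
    using fourier_gaussian_0(2)[OF assms, of "0::'a"] by simp
  then show "(LINT t|lborel. gaussian \<kappa> (0 :: 'a) t) = (sqrt (2 * pi) / \<kappa>) ^ DIM('a)"
    by (simp only: integral_complex_of_real of_real_eq_iff)
qed

lemma fourier_gaussian:
  fixes x s :: "real^'n"
  assumes "\<kappa> > 0"
  shows "fourier (\<lambda>t. complex_of_real (gaussian \<kappa> x t)) s
    = complex_of_real ((sqrt (2 * pi) / \<kappa>) ^ CARD('n) * exp (- 2 * pi\<^sup>2 * (s \<bullet> s) / \<kappa>\<^sup>2)) * unit_char (- (s \<bullet> x))"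
proof -
  define F where "F t = complex_of_real (gaussian \<kappa> x t) * exp (- 2 * pi * \<i> * complex_of_real (s \<bullet> t))" for t
  have meas: "F \<in> borel_measurable borel" unfolding F_def gaussian_def by (intro borel_measurable_continuous_onI continuous_intros)
  have "integral\<^sup>L lborel F = integral\<^sup>L (distr lborel borel ((+) x)) F" by (simp only: lborel_distr_plus)
  also have "\<dots> = (LINT t|lborel. F (x + t))" by (rule integral_distr) (use meas in auto)
  also have "\<dots> = (LINT t|lborel. unit_char (- (s \<bullet> x)) * (complex_of_real (gaussian \<kappa> 0 t) * exp (- 2 * pi * \<i> * complex_of_real (s \<bullet> t))))"
  proof (rule Bochner_Integration.integral_cong[OF refl])
    fix t
    have "exp (- 2 * pi * \<i> * complex_of_real (s \<bullet> (x + t))) = unit_char (- (s \<bullet> x)) * exp (- 2 * pi * \<i> * complex_of_real (s \<bullet> t))"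
    proof -
      have "unit_char (- (s \<bullet> x)) = exp (- 2 * pi * \<i> * complex_of_real (s \<bullet> x))"
        by (simp add: unit_char_def cis_conv_exp mult_ac)
      moreover have "- 2 * pi * \<i> * complex_of_real (s \<bullet> (x + t))
          = - 2 * pi * \<i> * complex_of_real (s \<bullet> x) + - 2 * pi * \<i> * complex_of_real (s \<bullet> t)"
        by (simp add: inner_add_right distrib_left)
      ultimately show ?thesis by (simp only: exp_add)
    qed
    then show "F (x + t) = unit_char (- (s \<bullet> x)) * (complex_of_real (gaussian \<kappa> 0 t) * exp (- 2 * pi * \<i> * complex_of_real (s \<bullet> t)))"
      by (simp add: F_def gaussian_def mult_ac)
  qed
  also have "\<dots> = unit_char (- (s \<bullet> x)) * complex_of_real ((sqrt (2 * pi) / \<kappa>) ^ DIM(real^'n) * exp (- 2 * pi\<^sup>2 * (s \<bullet> s) / \<kappa>\<^sup>2))"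
    using fourier_gaussian_0[OF assms, of s] by (subst integral_mult_right_zero) (simp only:)
  finally have "integral\<^sup>L lborel F
    = complex_of_real ((sqrt (2 * pi) / \<kappa>) ^ CARD('n) * exp (- 2 * pi\<^sup>2 * (s \<bullet> s) / \<kappa>\<^sup>2)) * unit_char (- (s \<bullet> x))"
    by (simp add: mult.commute)
  then show ?thesis by (simp only: fourier_def F_def[abs_def])
qed

text \<open>The Fourier transform of the Gaussian centred at 0; moving the centre contributes a
  phase only.\<close>

definition gaussian_weight :: "real \<Rightarrow> real^'n \<Rightarrow> real" where
  "gaussian_weight \<kappa> s = (sqrt (2 * pi) / \<kappa>) ^ CARD('n) * exp (- 2 * pi\<^sup>2 * (s \<bullet> s) / \<kappa>\<^sup>2)"

lemma gaussian_weight_nonneg: "\<kappa> > 0 \<Longrightarrow> gaussian_weight \<kappa> s \<ge> 0"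
  by (simp add: gaussian_weight_def)

text \<open>Up to a constant, the value of the Gaussian at a point is at most its average over a ball about
  that point, after the Gaussian has been widened by a factor \<open>\<surd>2\<close>.\<close>
lemma sum_gaussian_weight_bounded:
  fixes A :: "(real^'n) set"
  assumes "uniform_discrete A"
  obtains K where "\<And>X \<kappa>. finite X \<Longrightarrow> X \<subseteq> A \<Longrightarrow> \<kappa> \<ge> 1 \<Longrightarrow> (\<Sum>x\<in>X. gaussian_weight \<kappa> x) \<le> K"
proof -
  obtain e where e: "e > 0" "\<And>x y. x \<in> A \<Longrightarrow> y \<in> A \<Longrightarrow> dist x y < e \<Longrightarrow> x = y"
    using assms unfolding uniform_discrete_def by blast
  define v where "v = measure lborel (ball (0 :: real^'n) (e/2))"
  have ball: "measure lborel (ball x (e/2)) = v" for x :: "real^'n"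
    using e(1) by (simp add: v_def content_ball)
  have "v > 0" unfolding v_def using e(1) by (simp add: content_ball_pos)
  define E where "E = exp (pi\<^sup>2 * e\<^sup>2 / 2)"
  have E: "E > 0" by (simp add: E_def)
  have "(\<Sum>x\<in>X. gaussian_weight \<kappa> x) \<le> E * sqrt 2 ^ CARD('n) / v" if X: "finite X" "X \<subseteq> A" and \<kappa>: "\<kappa> \<ge> 1" for X \<kappa>
  proof -
    \<comment> \<open>For \<open>y\<close> within \<open>e / 2\<close> of \<open>x\<close> the
      square of \<open>norm y\<close> is at most twice that of \<open>norm x\<close> plus
      \<open>e\<^sup>2 / 2\<close>. So half of the exponent at \<open>x\<close> can be moved to
      \<open>y\<close>, which leaves the Gaussian with parameter \<open>\<rho>\<close>.\<close>
    define \<rho> where "\<rho> = sqrt 2 * pi / \<kappa>"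
    have \<rho>: "\<rho> > 0" "\<rho>\<^sup>2 / 2 = pi\<^sup>2 / \<kappa>\<^sup>2" using \<kappa> by (simp_all add: \<rho>_def power_mult_distrib power_divide)
    define g where "g = gaussian \<rho> (0 :: real^'n)"
    have g: "integrable lborel g" "integral\<^sup>L lborel g = (sqrt (2 * pi) / \<rho>) ^ CARD('n)"
      using integral_gaussian[OF \<rho>(1), where 'a = "real^'n"] by (simp_all add: g_def)
    have pt: "exp (- 2 * pi\<^sup>2 * (x \<bullet> x) / \<kappa>\<^sup>2) \<le> E * g y" if y: "y \<in> ball x (e/2)" for x y :: "real^'n"
    proof -
      have "(norm (x - y))\<^sup>2 \<le> (e/2)\<^sup>2" using y by (intro power_mono) (auto simp: dist_norm)
      then have "(x - y) \<bullet> (x - y) \<le> (e/2)\<^sup>2" by (simp add: power2_norm_eq_inner)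
      moreover have "0 \<le> (2 *\<^sub>R x - y) \<bullet> (2 *\<^sub>R x - y)" by simp
      ultimately have "- 2 * (x \<bullet> x) \<le> e\<^sup>2 / 2 - y \<bullet> y"
        by (simp add: inner_diff_left inner_diff_right inner_commute power2_eq_square)
      then have "(pi\<^sup>2 / \<kappa>\<^sup>2) * (- 2 * (x \<bullet> x)) \<le> (pi\<^sup>2 / \<kappa>\<^sup>2) * (e\<^sup>2 / 2 - y \<bullet> y)" by (intro mult_left_mono) auto
      also have "\<dots> = pi\<^sup>2 * e\<^sup>2 / 2 / \<kappa>\<^sup>2 - (\<rho>\<^sup>2 / 2) * (y \<bullet> y)" unfolding \<rho>(2) by (simp add: right_diff_distrib)
      also have "\<dots> \<le> pi\<^sup>2 * e\<^sup>2 / 2 - (\<rho>\<^sup>2 / 2) * (y \<bullet> y)"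
        using \<kappa> divide_left_mono[of 1 "\<kappa>\<^sup>2" "pi\<^sup>2 * e\<^sup>2 / 2"] by simp
      finally have "exp (- 2 * pi\<^sup>2 * (x \<bullet> x) / \<kappa>\<^sup>2) \<le> exp (pi\<^sup>2 * e\<^sup>2 / 2 - (\<rho>\<^sup>2 / 2) * (y \<bullet> y))"
        by (simp add: mult_ac)
      also have "\<dots> = E * g y" by (simp add: E_def g_def gaussian_def flip: exp_add)
      finally show ?thesis .
    qed
    have int: "integrable lborel (\<lambda>y. indicator (ball x (e/2)) y * g y)" for x :: "real^'n"
      using integrable_mult_indicator[OF _ g(1), of "ball x (e/2)"] by simp
    have "v * exp (- 2 * pi\<^sup>2 * (x \<bullet> x) / \<kappa>\<^sup>2) \<le> E * (LINT y|lborel. indicator (ball x (e/2)) y * g y)" for x :: "real^'n"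
    proof -
      have ib: "integrable lborel (indicator (ball x (e/2)) :: _ \<Rightarrow> real)"
        using emeasure_bounded_finite[of "ball x (e/2)"] by (intro integrable_real_indicator) auto
      have "v * exp (- 2 * pi\<^sup>2 * (x \<bullet> x) / \<kappa>\<^sup>2) = (LINT y|lborel. indicator (ball x (e/2)) y * exp (- 2 * pi\<^sup>2 * (x \<bullet> x) / \<kappa>\<^sup>2))"
        by (simp add: ball)
      also have "\<dots> \<le> (LINT y|lborel. E * (indicator (ball x (e/2)) y * g y))"
      proof (rule integral_mono)
        show "integrable lborel (\<lambda>y. indicator (ball x (e/2)) y * exp (- 2 * pi\<^sup>2 * (x \<bullet> x) / \<kappa>\<^sup>2))"
          by (rule integrable_mult_left[OF ib])
        show "integrable lborel (\<lambda>y. E * (indicator (ball x (e/2)) y * g y))"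
          by (rule integrable_mult_right[OF int])
        show "indicator (ball x (e/2)) y * exp (- 2 * pi\<^sup>2 * (x \<bullet> x) / \<kappa>\<^sup>2) \<le> E * (indicator (ball x (e/2)) y * g y)" for y
          by (cases "y \<in> ball x (e/2)") (use pt in \<open>auto simp del: mem_ball\<close>)
      qed
      also have "\<dots> = E * (LINT y|lborel. indicator (ball x (e/2)) y * g y)" by simp
      finally show ?thesis .
    qed
    then have "(\<Sum>x\<in>X. v * exp (- 2 * pi\<^sup>2 * (x \<bullet> x) / \<kappa>\<^sup>2)) \<le> E * (\<Sum>x\<in>X. LINT y|lborel. indicator (ball x (e/2)) y * g y)"
      unfolding sum_distrib_left by (intro sum_mono)
    also have "\<dots> \<le> E * integral\<^sup>L lborel g"
    proof (intro mult_left_mono sum_integral_separated_balls_le[OF X(1) _ g(1)])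
      show "e \<le> dist x y" if "x \<in> X" "y \<in> X" "x \<noteq> y" for x y using that e(2) X(2) by force
      show "0 \<le> g x" for x using gaussian_pos[of \<rho> 0 x] by (simp add: g_def)
    qed (use E in auto)
    finally have "v * (\<Sum>x\<in>X. exp (- 2 * pi\<^sup>2 * (x \<bullet> x) / \<kappa>\<^sup>2)) \<le> E * (sqrt (2 * pi) / \<rho>) ^ CARD('n)"
      unfolding g(2) by (simp add: sum_distrib_left)
    then have "(\<Sum>x\<in>X. exp (- 2 * pi\<^sup>2 * (x \<bullet> x) / \<kappa>\<^sup>2)) \<le> E * (sqrt (2 * pi) / \<rho>) ^ CARD('n) / v"
      using \<open>v > 0\<close> by (simp only: pos_le_divide_eq mult.commute)
    then have "(sqrt (2 * pi) / \<kappa>) ^ CARD('n) * (\<Sum>x\<in>X. exp (- 2 * pi\<^sup>2 * (x \<bullet> x) / \<kappa>\<^sup>2))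
       \<le> (sqrt (2 * pi) / \<kappa>) ^ CARD('n) * (E * (sqrt (2 * pi) / \<rho>) ^ CARD('n) / v)"
      using \<kappa> by (intro mult_left_mono) auto
    also have "\<dots> = E * (sqrt (2 * pi) / \<kappa> * (sqrt (2 * pi) / \<rho>)) ^ CARD('n) / v" by (simp only: power_mult_distrib) simp
    \<comment> \<open>The parameter \<open>\<kappa>\<close> cancels, so the bound is uniform in
      it.\<close>
    also have "sqrt (2 * pi) / \<kappa> * (sqrt (2 * pi) / \<rho>) = sqrt 2"
    proof -
      have "sqrt (2 * pi) / \<kappa> * (sqrt (2 * pi) / \<rho>) = (sqrt (2 * pi) * sqrt (2 * pi)) / (\<kappa> * \<rho>)" by simp
      also have "\<dots> = 2 * pi / (sqrt 2 * pi)" using \<kappa> by (simp add: \<rho>_def)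
      also have "\<dots> = sqrt 2" by (simp add: real_div_sqrt)
      finally show ?thesis .
    qed
    finally show ?thesis by (simp add: gaussian_weight_def sum_distrib_left)
  qed
  then show thesis by (rule that)
qed

section \<open>Atoms as limits of exponential sums\<close>

text \<open>Dominated convergence with the widest Gaussian \<open>gaussian 1 x\<close> as majorant;
  \<open>Suc k\<close> keeps the parameter at least 1.\<close>

lemma integral_gaussian_tendsto_atom:
  fixes \<nu> :: "(real^'n) measure"
  assumes sets: "sets \<nu> = sets borel" and fin: "emeasure \<nu> {x} < \<infinity>"
    and int: "integrable \<nu> (\<lambda>t. complex_of_real (gaussian 1 x t))"
  shows "(\<lambda>k. LINT t|\<nu>. complex_of_real (gaussian (real (Suc k)) x t)) \<longlonglongrightarrow> complex_of_real (measure \<nu> {x})"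
proof -
  have meas: "(\<lambda>t. complex_of_real (gaussian \<kappa> x t)) \<in> borel_measurable \<nu>" for \<kappa>
    unfolding measurable_cong_sets[OF sets refl] gaussian_def[abs_def]
    by (intro borel_measurable_continuous_onI continuous_intros)
  have ind: "(indicator {x} :: _ \<Rightarrow> complex) = (\<lambda>t. complex_of_real (indicator {x} t))" by (auto simp: indicator_def)
  have xs: "{x} \<in> sets \<nu>" by (simp add: sets)
  have "(\<lambda>k. LINT t|\<nu>. complex_of_real (gaussian (real (Suc k)) x t)) \<longlonglongrightarrow> (LINT t|\<nu>. indicator {x} t :: complex)"
  proof (rule integral_dominated_convergence[where w = "\<lambda>t. gaussian 1 x t"])
    show "integrable \<nu> (gaussian 1 x)" using int by (simp only: complex_of_real_integrable_eq)
    show "AE t in \<nu>. norm (complex_of_real (gaussian (real (Suc k)) x t)) \<le> gaussian 1 x t" for k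
    proof (rule AE_I2)
      fix t
      have "1 * ((t - x) \<bullet> (t - x)) \<le> (real (Suc k))\<^sup>2 * ((t - x) \<bullet> (t - x))"
        by (intro mult_right_mono one_le_power) auto
      then show "norm (complex_of_real (gaussian (real (Suc k)) x t)) \<le> gaussian 1 x t"
        by (simp add: gaussian_def del: of_nat_Suc)
    qed
    show "AE t in \<nu>. (\<lambda>k. complex_of_real (gaussian (real (Suc k)) x t)) \<longlonglongrightarrow> indicator {x} t"
    proof (rule AE_I2)
      fix t
      show "(\<lambda>k. complex_of_real (gaussian (real (Suc k)) x t)) \<longlonglongrightarrow> indicator {x} t"
      proof (cases "t = x")
        case False
        define q where "q = (t - x) \<bullet> (t - x) / 2"
        have "q > 0" using False by (simp add: q_def)
        have eq: "gaussian (real (Suc k)) x t = exp (- (q * (real (Suc k))\<^sup>2))" for k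
          by (simp add: gaussian_def q_def mult.commute)
        have "(\<lambda>k. exp (- (q * (real (Suc k))\<^sup>2))) \<longlonglongrightarrow> 0"
        proof (rule Lim_null_comparison)
          show "\<forall>\<^sub>F k in sequentially. norm (exp (- (q * (real (Suc k))\<^sup>2))) \<le> 1 / q * (1 / real (Suc k))"
          proof (intro always_eventually allI)
            fix k
            have "q * real (Suc k) \<le> q * (real (Suc k))\<^sup>2"
              using \<open>q > 0\<close> by (intro mult_left_mono self_le_power) auto
            also have "\<dots> \<le> exp (q * (real (Suc k))\<^sup>2)" using exp_ge_add_one_self[of "q * (real (Suc k))\<^sup>2"] by linarith
            finally have "1 / exp (q * (real (Suc k))\<^sup>2) \<le> 1 / (q * real (Suc k))"
              using \<open>q > 0\<close> by (intro divide_left_mono) auto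
            then show "norm (exp (- (q * (real (Suc k))\<^sup>2))) \<le> 1 / q * (1 / real (Suc k))"
              by (simp add: exp_minus divide_inverse mult.commute del: of_nat_Suc)
          qed
          have "(\<lambda>k. 1 / q * (1 / real (Suc k))) \<longlonglongrightarrow> 1 / q * 0"
            by (intro tendsto_intros LIMSEQ_Suc[OF lim_1_over_n])
          then show "(\<lambda>k. 1 / q * (1 / real (Suc k))) \<longlonglongrightarrow> 0" by (simp only: mult_zero_right)
        qed
        then have "(\<lambda>k. complex_of_real (gaussian (real (Suc k)) x t)) \<longlonglongrightarrow> complex_of_real 0"
          unfolding eq by (rule tendsto_of_real)
        then show ?thesis using False by simp
      qed (simp add: gaussian_def)
    qed
  qed (use meas xs in auto)
  also have "(LINT t|\<nu>. indicator {x} t :: complex) = complex_of_real (measure \<nu> {x})"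
    unfolding ind integral_complex_of_real using xs by simp
  finally show ?thesis .
qed

text \<open>One finite \<open>X\<close> serves all unimodular \<open>u\<close>, so the same
  truncation of an exponential sum works at every point.\<close>

lemma abs_summable_finite_tail:
  fixes f :: "'a \<Rightarrow> complex"
  assumes f: "Infinite_Set_Sum.abs_summable_on f A" and "e > 0"
  obtains X where "finite X" "X \<subseteq> A"
    "\<And>u. (\<And>x. cmod (u x) = 1) \<Longrightarrow> cmod (infsetsum (\<lambda>x. f x * u x) A - (\<Sum>x\<in>X. f x * u x)) \<le> e"
proof -
  define T where "T = infsetsum (\<lambda>x. cmod (f x)) A"
  have n: "Infinite_Set_Sum.abs_summable_on (\<lambda>x. cmod (f x)) A" using f by simp
  have "\<exists>X. finite X \<and> X \<subseteq> A \<and> (\<Sum>x\<in>X. cmod (f x)) > T - e"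
  proof (rule ccontr)
    assume "\<not> ?thesis"
    then have "(\<Sum>x\<in>X. cmod (f x)) \<le> T - e" if "finite X" "X \<subseteq> A" for X using that by (meson linorder_not_le)
    then have "infsum (\<lambda>x. cmod (f x)) A \<le> T - e"
      using abs_summable_equivalent[of f A] f by (intro infsum_le_finite_sums) auto
    then show False using infsetsum_infsum[OF n] \<open>e > 0\<close> by (simp add: T_def)
  qed
  then obtain X where X: "finite X" "X \<subseteq> A" "(\<Sum>x\<in>X. cmod (f x)) > T - e" by blast
  show thesis
  proof (rule that[OF X(1,2)])
    fix u :: "'a \<Rightarrow> complex" assume u: "\<And>x. cmod (u x) = 1"
    have "Infinite_Set_Sum.abs_summable_on (\<lambda>x. norm (f x * u x)) A" using n by (simp add: norm_mult u)
    then have fu: "Infinite_Set_Sum.abs_summable_on (\<lambda>x. f x * u x) A" by (simp only: abs_summable_on_norm_iff)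
    have fX: "infsetsum (\<lambda>x. f x * u x) X = (\<Sum>x\<in>X. f x * u x)" using X(1) by simp
    have "infsetsum (\<lambda>x. f x * u x) A - (\<Sum>x\<in>X. f x * u x) = infsetsum (\<lambda>x. f x * u x) (A - X)"
      using infsetsum_Diff[OF fu X(2)] fX by simp
    also have "cmod \<dots> \<le> infsetsum (\<lambda>x. norm (f x * u x)) (A - X)" by (rule norm_infsetsum_bound)
    also have "\<dots> = infsetsum (\<lambda>x. cmod (f x)) (A - X)" by (simp add: norm_mult u)
    also have "\<dots> = T - (\<Sum>x\<in>X. cmod (f x))" using infsetsum_Diff[OF n X(2)] X(1) by (simp add: T_def)
    also have "\<dots> \<le> e" using X(3) by simp
    finally show "cmod (infsetsum (\<lambda>x. f x * u x) A - (\<Sum>x\<in>X. f x * u x)) \<le> e" .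
  qed
qed

text \<open>Pairing the diffraction measure with ever narrower Gaussians at \<open>x\<close> amounts
  to summing the \<open>c d\<close> against ever flatter weights. The total mass of these weights
  stays bounded because \<open>D\<close> is uniformly discrete.\<close>

theorem atom_limit_of_exponential_sums:
  fixes \<gamma> :: "(real^'n) set \<Rightarrow> complex" and \<nu> :: "(real^'n) measure"
  assumes at: "atomic_on \<gamma> D c" and D: "uniform_discrete D" and M: "\<And>d. d \<in> D \<Longrightarrow> cmod (c d) \<le> M"
    and \<nu>: "diffraction_measure \<gamma> \<nu>"
  obtains X \<omega> C where "\<And>i. X i \<subseteq> D" "\<And>i. finite (X i)" "\<And>i. (\<Sum>d\<in>X i. cmod (\<omega> i d)) \<le> C"
    "\<And>x. (\<lambda>i. \<Sum>d\<in>X i. \<omega> i d * unit_char (- (d \<bullet> x))) \<longlonglongrightarrow> complex_of_real (measure \<nu> {x})"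
proof -
  obtain K where K: "\<And>X \<kappa>. finite X \<Longrightarrow> X \<subseteq> D \<Longrightarrow> \<kappa> \<ge> 1 \<Longrightarrow> (\<Sum>x\<in>X. gaussian_weight \<kappa> x) \<le> K"
    using sum_gaussian_weight_bounded[OF D] by blast
  define \<omega> where "\<omega> i d = c d * complex_of_real (gaussian_weight (real (Suc i)) d)" for i d
  \<comment> \<open>The bound \<open>M\<close> may be negative when \<open>D\<close> is
    empty.\<close>
  define M' where "M' = max M 0"
  have mass: "(\<Sum>d\<in>X. cmod (\<omega> i d)) \<le> M' * K" if X: "finite X" "X \<subseteq> D" for X i
  proof -
    have "(\<Sum>d\<in>X. cmod (\<omega> i d)) \<le> (\<Sum>d\<in>X. M' * gaussian_weight (real (Suc i)) d)"
    proof (rule sum_mono)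
      fix d assume "d \<in> X"
      then have "cmod (c d) \<le> M'" using M X(2) by (force simp: M'_def)
      then show "cmod (\<omega> i d) \<le> M' * gaussian_weight (real (Suc i)) d"
        using gaussian_weight_nonneg[of "real (Suc i)" d] by (simp add: \<omega>_def norm_mult mult_right_mono)
    qed
    also have "\<dots> = M' * (\<Sum>d\<in>X. gaussian_weight (real (Suc i)) d)" by (simp add: sum_distrib_left)
    also have "\<dots> \<le> M' * K" by (intro mult_left_mono K X) (auto simp: M'_def)
    finally show ?thesis .
  qed
  have summable: "Infinite_Set_Sum.abs_summable_on (\<omega> i) D" for i by (rule abs_summable_finite_sumsI) (rule mass)
  have "\<exists>X. finite X \<and> X \<subseteq> D \<and> (\<forall>u. (\<forall>x. cmod (u x) = 1) \<longrightarrow>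
      cmod (infsetsum (\<lambda>d. \<omega> i d * u d) D - (\<Sum>d\<in>X. \<omega> i d * u d)) \<le> 1 / real (Suc i))" for i
    by (rule abs_summable_finite_tail[OF summable[of i], of "1 / real (Suc i)"]) auto
  then obtain X where X: "\<And>i. finite (X i)" "\<And>i. X i \<subseteq> D"
    "\<And>i u. (\<And>x. cmod (u x) = 1) \<Longrightarrow> cmod (infsetsum (\<lambda>d. \<omega> i d * u d) D - (\<Sum>d\<in>X i. \<omega> i d * u d)) \<le> 1 / real (Suc i)"
    by metis
  show thesis
  proof (rule that[OF X(2,1) mass[OF X(1,2)]])
    fix x :: "real^'n"
    have schw: "schwartz (\<lambda>t. complex_of_real (gaussian (real (Suc i)) x t))" for i
      by (rule schwartz_gaussian) simp
    have ft: "fourier (\<lambda>t. complex_of_real (gaussian (real (Suc i)) x t)) = (\<lambda>s. complex_of_real (gaussian_weight (real (Suc i)) s) * unit_char (- (s \<bullet> x)))" for i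
      by (rule ext) (simp add: fourier_gaussian gaussian_weight_def del: of_nat_Suc)
    have eq: "(LINT t|\<nu>. complex_of_real (gaussian (real (Suc i)) x t)) = infsetsum (\<lambda>d. \<omega> i d * unit_char (- (d \<bullet> x))) D" for i
    proof -
      have "(LINT t|\<nu>. complex_of_real (gaussian (real (Suc i)) x t)) = cm_integral \<gamma> (fourier (\<lambda>t. complex_of_real (gaussian (real (Suc i)) x t)))"
        using \<nu> schw[of i] unfolding diffraction_measure_def by blast
      also have "\<dots> = (LINT d|count_space D. c d * (complex_of_real (gaussian_weight (real (Suc i)) d) * unit_char (- (d \<bullet> x))))"
        unfolding ft
      proof (rule cm_integral_atomic[OF at])
        show "(\<lambda>s. complex_of_real (gaussian_weight (real (Suc i)) s) * unit_char (- (s \<bullet> x))) \<in> borel_measurable borel"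
          unfolding gaussian_weight_def unit_char_def by (intro borel_measurable_continuous_onI continuous_intros) auto
        have "Infinite_Set_Sum.abs_summable_on (\<lambda>d. norm (\<omega> i d * unit_char (- (d \<bullet> x)))) D" using summable[of i] by (simp add: norm_mult)
        then have "Infinite_Set_Sum.abs_summable_on (\<lambda>d. \<omega> i d * unit_char (- (d \<bullet> x))) D" by (simp only: abs_summable_on_norm_iff)
        then show "integrable (count_space D) (\<lambda>d. c d * (complex_of_real (gaussian_weight (real (Suc i)) d) * unit_char (- (d \<bullet> x))))"
          by (simp add: abs_summable_on_def \<omega>_def mult.assoc)
      qed
      finally show ?thesis by (simp add: infsetsum_def \<omega>_def mult.assoc)
    qed
    have "emeasure \<nu> {x} < \<infinity>" using \<nu> bounded_borel_finite[of "{x}"] by (auto simp: diffraction_measure_def)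
    then have "(\<lambda>i. infsetsum (\<lambda>d. \<omega> i d * unit_char (- (d \<bullet> x))) D) \<longlonglongrightarrow> complex_of_real (measure \<nu> {x})"
      using integral_gaussian_tendsto_atom[of \<nu> x] \<nu> schw[of 0] unfolding eq by (simp add: diffraction_measure_def)
    moreover have "(\<lambda>i. infsetsum (\<lambda>d. \<omega> i d * unit_char (- (d \<bullet> x))) D - (\<Sum>d\<in>X i. \<omega> i d * unit_char (- (d \<bullet> x)))) \<longlonglongrightarrow> 0"
    proof (rule Lim_null_comparison)
      show "\<forall>\<^sub>F i in sequentially. norm (infsetsum (\<lambda>d. \<omega> i d * unit_char (- (d \<bullet> x))) D - (\<Sum>d\<in>X i. \<omega> i d * unit_char (- (d \<bullet> x)))) \<le> 1 / real (Suc i)"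
        by (intro always_eventually allI X(3)) simp
      show "(\<lambda>i. 1 / real (Suc i)) \<longlonglongrightarrow> 0" by (rule LIMSEQ_Suc[OF lim_1_over_n])
    qed
    ultimately have "(\<lambda>i. infsetsum (\<lambda>d. \<omega> i d * unit_char (- (d \<bullet> x))) D
        - (infsetsum (\<lambda>d. \<omega> i d * unit_char (- (d \<bullet> x))) D - (\<Sum>d\<in>X i. \<omega> i d * unit_char (- (d \<bullet> x))))) \<longlonglongrightarrow> complex_of_real (measure \<nu> {x}) - 0"
      by (rule tendsto_diff)
    then show "(\<lambda>i. \<Sum>d\<in>X i. \<omega> i d * unit_char (- (d \<bullet> x))) \<longlonglongrightarrow> complex_of_real (measure \<nu> {x})" by simp
  qed
qed

section \<open>The diffraction measure as a sum of weighted combs\<close>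

theorem theorem9p2:
  fixes \<Lambda> :: "(real^'n) set"
    and \<mu> \<gamma> :: "(real^'n) set \<Rightarrow> complex"
    and \<nu> :: "(real^'n) measure"
  assumes "Meyer_set \<Lambda>"
    and "cmeasure \<mu>" and "translation_bounded \<mu>" and "supported_by \<mu> \<Lambda>"
    and "autocorrelation_measure \<mu> \<gamma>"
    and "diffraction_measure \<gamma> \<nu>"
    and "purely_atomic \<nu>" and "discrete_closed_set (atoms \<nu>)"
  shows "\<exists>L :: (real^'n) set. lattice_set L \<and>
     (\<exists>T. finite T \<and> atoms \<nu> \<subseteq> (\<Union>\<tau>\<in>T. translate L \<tau>)) \<and>
     (\<exists>(N::nat) (\<tau> :: nat \<Rightarrow> real^'n) (P :: nat \<Rightarrow> real^'n \<Rightarrow> complex).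
        N > 0 \<and> (\<forall>j\<in>{1..N}. trig_polynomial (P j)) \<and>
        (\<forall>E\<in>bounded_borel.
           complex_of_real (measure \<nu> E) = (\<Sum>j=1..N. weighted_comb (translate L (\<tau> j)) (P j) E)))"
proof -
  define D where "D = difference_set \<Lambda>"
  have ud: "uniform_discrete \<Lambda>" using assms(1) by (simp add: Meyer_set_def Delone_set_def)
  have udD: "uniform_discrete D"
    unfolding D_def by (rule uniform_discrete_of_difference_set[OF Meyer_set_iterated_difference[OF assms(1)]])
  obtain c M where c: "atomic_on \<gamma> D c" "\<And>d. d \<in> D \<Longrightarrow> cmod (c d) \<le> M"
    by (rule autocorrelation_atomic[OF ud _ assms(2-5), folded D_def, OF udD]) (rule that, assumption+)
  define N where "N x = complex_of_real (measure \<nu> {x})" for x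
  obtain X \<omega> C where X: "\<And>i. X i \<subseteq> D" "\<And>i. finite (X i)" "\<And>i. (\<Sum>d\<in>X i. cmod (\<omega> i d)) \<le> C"
    "\<And>x. (\<lambda>i. \<Sum>d\<in>X i. \<omega> i d * unit_char (- (d \<bullet> x))) \<longlonglongrightarrow> N x"
    by (rule atom_limit_of_exponential_sums[OF c(1) udD c(2) assms(6), folded N_def]) (assumption, rule that, assumption+)
  obtain G :: "(real^'n) set" and a b B where G: "finite G"
    "\<And>d g. d \<in> D \<Longrightarrow> g \<in> G \<Longrightarrow> a g \<bullet> d + b d g \<in> \<int>"
    "\<And>d g. d \<in> D \<Longrightarrow> g \<in> G \<Longrightarrow> \<bar>b d g\<bar> \<le> B"
    "\<And>d. d \<in> D \<Longrightarrow> (\<Sum>g\<in>G. b d g *\<^sub>R g) = 0"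
    "\<And>x. (\<Sum>g\<in>G. (a g \<bullet> x) *\<^sub>R g) = x"
    "\<And>k :: real^'n \<Rightarrow> int. (\<Sum>g\<in>G. of_int (k g) *\<^sub>R g) = 0 \<Longrightarrow> \<forall>g\<in>G. k g = 0"
    by (rule Meyer_set_coordinates[OF assms(1), folded D_def]) (rule that, assumption+)
  have sets: "sets \<nu> = sets borel" and fin: "\<And>E. E \<in> bounded_borel \<Longrightarrow> emeasure \<nu> E < \<infinity>"
    using assms(6) by (auto simp: diffraction_measure_def)
  have atom: "x \<in> atoms \<nu> \<longleftrightarrow> N x \<noteq> 0" for x
    using fin[OF bounded_borel_finite[of "{x}"]] by (auto simp: atoms_def N_def measure_def enn2real_eq_0_iff)
  \<comment> \<open>The index set is the integer basis \<open>G\<close> itself, hence the identity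
    in place of \<open>g\<close>.\<close>
  have ap: "almost_periodic_comb G (\<lambda>g. g) a b D X \<omega> N B C"
  proof
    show "finite (S \<inter> {x. N x \<noteq> 0})" if "bounded S" for S
      using discrete_closed_setD[OF assms(8) that] by (simp add: atom[symmetric] Int_commute)
  qed (fact G X)+
  obtain L T P where L: "lattice_set L" and T: "finite T" "T \<noteq> {}"
    and cover: "{x. N x \<noteq> 0} \<subseteq> (\<Union>\<tau>\<in>T. translate L \<tau>)"
    and disj: "\<forall>\<tau>\<in>T. \<forall>\<sigma>\<in>T. \<tau> \<noteq> \<sigma> \<longrightarrow> translate L \<tau> \<inter> translate L \<sigma> = {}"
    and P: "\<forall>\<tau>\<in>T. trig_polynomial (P \<tau>) \<and> (\<forall>x\<in>translate L \<tau>. P \<tau> x = N x)"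
    using comb_structure[OF ap] by (elim exE conjE) (rule that, assumption+)
  obtain h where h: "bij_betw h {1..card T} T"
    using ex_bij_betw_nat_finite_1[OF T(1)] by blast
  have formula: "complex_of_real (measure \<nu> E) = (\<Sum>\<tau>\<in>T. weighted_comb (translate L \<tau>) (P \<tau>) E)"
    if E: "E \<in> bounded_borel" for E
  proof -
    have bE: "bounded E" "E \<in> sets \<nu>" using E sets by (auto simp: bounded_borel_def)
    have finS: "finite (atoms \<nu> \<inter> E)" by (rule discrete_closed_setD[OF assms(8) bE(1)])
    have finL: "finite (translate L \<tau> \<inter> E)" for \<tau> by (rule lattice_set_bounded_finite[OF L bE(1)])
    have em: "emeasure \<nu> {x} = ennreal (measure \<nu> {x})" for x
      using fin[OF bounded_borel_finite[of "{x}"]] by (intro emeasure_eq_ennreal_measure) auto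
    have "emeasure \<nu> E = (\<integral>\<^sup>+x. emeasure \<nu> {x} \<partial>count_space E)"
      using assms(7) bE(2) by (simp add: purely_atomic_def)
    also have "\<dots> = (\<Sum>x\<in>atoms \<nu> \<inter> E. emeasure \<nu> {x})"
      by (rule nn_integral_count_space'[OF finS]) (auto simp: atoms_def)
    also have "\<dots> = ennreal (\<Sum>x\<in>atoms \<nu> \<inter> E. measure \<nu> {x})"
      unfolding em by (rule sum_ennreal) simp
    finally have "measure \<nu> E = (\<Sum>x\<in>atoms \<nu> \<inter> E. measure \<nu> {x})"
      by (simp add: measure_def[of \<nu> E] sum_nonneg)
    then have "complex_of_real (measure \<nu> E) = (\<Sum>x\<in>atoms \<nu> \<inter> E. N x)" by (simp add: N_def)
    \<comment> \<open>Points of the translates that are not atoms have \<open>N x = 0\<close>, and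
      the translates are disjoint, so adding up the cosets counts every atom once.\<close>
    also have "\<dots> = (\<Sum>x\<in>(\<Union>\<tau>\<in>T. translate L \<tau> \<inter> E). N x)"
    proof (rule sum.mono_neutral_left)
      show "finite (\<Union>\<tau>\<in>T. translate L \<tau> \<inter> E)" using T(1) finL by blast
    qed (use cover atom in auto)
    also have "\<dots> = (\<Sum>\<tau>\<in>T. \<Sum>x\<in>translate L \<tau> \<inter> E. N x)"
      by (rule sum.UNION_disjoint) (use T(1) finL disj in blast)+
    also have "\<dots> = (\<Sum>\<tau>\<in>T. weighted_comb (translate L \<tau>) (P \<tau>) E)"
      unfolding weighted_comb_def by (intro sum.cong refl) (use P in auto)
    finally show ?thesis .
  qed
  show ?thesis
  proof (rule exI[of _ L], intro conjI L)
    show "\<exists>T. finite T \<and> atoms \<nu> \<subseteq> (\<Union>\<tau>\<in>T. translate L \<tau>)"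
      using T(1) cover atom by (intro exI[of _ T]) auto
    show "\<exists>(N::nat) (\<tau> :: nat \<Rightarrow> real^'n) (P :: nat \<Rightarrow> real^'n \<Rightarrow> complex).
        N > 0 \<and> (\<forall>j\<in>{1..N}. trig_polynomial (P j)) \<and>
        (\<forall>E\<in>bounded_borel.
           complex_of_real (measure \<nu> E) = (\<Sum>j=1..N. weighted_comb (translate L (\<tau> j)) (P j) E))"
    proof (rule exI[of _ "card T"], rule exI[of _ h], rule exI[of _ "\<lambda>j. P (h j)"], intro conjI ballI)
      show "card T > 0" using T by (simp add: card_gt_0_iff)
      show "trig_polynomial (P (h j))" if "j \<in> {1..card T}" for j
        using P bij_betwE[OF h] that by blast
      show "complex_of_real (measure \<nu> E) = (\<Sum>j=1..card T. weighted_comb (translate L (h j)) (P (h j)) E)"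
        if "E \<in> bounded_borel" for E
        unfolding formula[OF that] by (rule sum.reindex_bij_betw[OF h, symmetric])
    qed
  qed
qed

end
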